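(* There is a constant $R'_{\epsilon,\delta,\beta}$, depending on $\epsilon,\delta,\beta$, such that for every $\eta_0\in H^2_{\mathrm{od}}(\mathbb{T}^2)$ the solution $\eta$ of the initial value problem $$\eta_t+\eta\eta_x+(\beta-1)\eta_{xx}-\eta_{yy}-\delta\Lambda^3\eta+\epsilon\Delta^2\eta=0,\quad (x,y)\in\mathbb{T}^2,\ t>0,\qquad \eta(x,y,0)=\eta_0(x,y),$$ satisfies $$\limsup_{t\to\infty}\|\eta(t)\|_{H^2(\mathbb{T}^2)}\le R'_{\epsilon,\delta,\beta}.$$
   Context: $\mathbb{T}^2=[0,2\pi]^2$ with periodic boundary conditions; functions are real-valued. The nonlocal operator $\Lambda$ is defined on Fourier coefficients by $\widehat{\Lambda u}(\xi)=|\xi|\widehat{u}(\xi)$, $\xi\in\mathbb{Z}^2$, $|\xi|=(\xi_1^2+\xi_2^2)^{1/2}$. The parameters are $\beta>0$, $\delta=\gamma\lambda$ and $\epsilon=\lambda^2$, where $0\le\gamma\le 2$ and $\lambda=2\pi/L$ with $L>0$. The space of data that are odd in $x$ is $$H^2_{\mathrm{od}}(\mathbb{T}^2)=\{\eta\in H^2(\mathbb{T}^2): -\eta(-x,y)=\eta(x,y)\ \forall (x,y)\in\mathbb{T}^2\}.$$ "The solution" is the unique global solution, belonging to $C([0,T];H^2(\mathbb{T}^2))\cap L^2(0,T;H^4(\mathbb{T}^2))$ for every $0<T<\infty$. *)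

theory Defs
  imports "HOL-Analysis.Analysis"
begin

text \<open>
  Functions on the torus are functions on the plane that are \<open>2\<pi>\<close>-periodic in both variables.
  Elements of \<open>L\<^sup>2\<close> and of the Sobolev spaces are represented by such functions; two of
  them denote the same element iff they agree almost everywhere with respect to \<open>torus\<close>.
\<close>

definition torus :: "(real \<times> real) measure" where
  "torus = restrict_space lborel ({0..2 * pi} \<times> {0..2 * pi})"

definition periodic :: "(real \<times> real \<Rightarrow> real) \<Rightarrow> bool" where
  "periodic u \<longleftrightarrow> (\<forall>x y. u (x + 2 * pi, y) = u (x, y) \<and> u (x, y + 2 * pi) = u (x, y))"

definition L2_torus :: "(real \<times> real \<Rightarrow> real) set" where
  "L2_torus = {u. periodic u \<and> u \<in> borel_measurable torus \<and> integrable torus (\<lambda>p. (u p)\<^sup>2)}"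

definition L2_inner :: "(real \<times> real \<Rightarrow> real) \<Rightarrow> (real \<times> real \<Rightarrow> real) \<Rightarrow> real" where
  "L2_inner u v = (\<integral>p. u p * v p \<partial>torus)"

definition fourier :: "(real \<times> real \<Rightarrow> real) \<Rightarrow> int \<times> int \<Rightarrow> complex" where
  "fourier u \<xi> =
     (\<integral>p. of_real (u p) * cis (- (real_of_int (fst \<xi>) * fst p + real_of_int (snd \<xi>) * snd p)) \<partial>torus)
       / of_real ((2 * pi)\<^sup>2)"

definition freq_norm :: "int \<times> int \<Rightarrow> real" where
  "freq_norm \<xi> = sqrt ((real_of_int (fst \<xi>))\<^sup>2 + (real_of_int (snd \<xi>))\<^sup>2)"

text \<open>
  \<open>sobolev_norm s u\<close> is meaningful only for \<open>u \<in> sobolev s\<close>: outside, \<open>infsum\<close> may take its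
  default value \<open>0\<close>.
\<close>

definition sobolev :: "nat \<Rightarrow> (real \<times> real \<Rightarrow> real) set" where
  "sobolev s = {u \<in> L2_torus.
     (\<lambda>\<xi>. (1 + (freq_norm \<xi>)\<^sup>2) ^ s * (cmod (fourier u \<xi>))\<^sup>2) summable_on UNIV}"

definition sobolev_norm :: "nat \<Rightarrow> (real \<times> real \<Rightarrow> real) \<Rightarrow> real" where
  "sobolev_norm s u =
     sqrt (\<Sum>\<^sub>\<infinity>\<xi>. (1 + (freq_norm \<xi>)\<^sup>2) ^ s * (cmod (fourier u \<xi>))\<^sup>2)"

text \<open>
  By Sobolev embedding, every \<open>H\<^sup>2\<close> class has a continuous representative, and an odd class has
  one that is odd at every point; so the pointwise condition excludes no class.
\<close>

definition H2_odd :: "(real \<times> real \<Rightarrow> real) set" where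
  "H2_odd = {u \<in> sobolev 2. \<forall>x y. - u (- x, y) = u (x, y)}"

text \<open>
  \<open>has_symbol m u v\<close>: the distribution on the torus with Fourier coefficients
  \<open>m \<xi> * fourier u \<xi>\<close> is (represented by) the \<open>L\<^sup>2\<close> function \<open>v\<close>. Derivatives in the sense of
  distributions have symbols \<open>\<i> \<xi>\<^sub>1\<close> and \<open>\<i> \<xi>\<^sub>2\<close>.
\<close>

definition has_symbol ::
    "(int \<times> int \<Rightarrow> complex) \<Rightarrow> (real \<times> real \<Rightarrow> real) \<Rightarrow> (real \<times> real \<Rightarrow> real) \<Rightarrow> bool" where
  "has_symbol m u v \<longleftrightarrow> v \<in> L2_torus \<and> (\<forall>\<xi>. fourier v \<xi> = m \<xi> * fourier u \<xi>)"

definition sym_dx :: "int \<times> int \<Rightarrow> complex" where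
  "sym_dx \<xi> = \<i> * of_int (fst \<xi>)"

definition sym_dy :: "int \<times> int \<Rightarrow> complex" where
  "sym_dy \<xi> = \<i> * of_int (snd \<xi>)"

definition sym_Laplace :: "int \<times> int \<Rightarrow> complex" where
  "sym_Laplace \<xi> = (sym_dx \<xi>)\<^sup>2 + (sym_dy \<xi>)\<^sup>2"

definition sym_Lambda :: "int \<times> int \<Rightarrow> complex" where
  "sym_Lambda \<xi> = of_real (freq_norm \<xi>)"

definition in_C_H2 :: "real \<Rightarrow> (real \<Rightarrow> real \<times> real \<Rightarrow> real) \<Rightarrow> bool" where
  "in_C_H2 T \<eta> \<longleftrightarrow>
     (\<forall>t\<in>{0..T}. \<eta> t \<in> sobolev 2) \<and>
     (\<forall>t\<in>{0..T}. ((\<lambda>s. sobolev_norm 2 (\<lambda>p. \<eta> s p - \<eta> t p)) \<longlongrightarrow> 0) (at t within {0..T}))"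

text \<open>
  Strong measurability of \<open>\<eta>\<close> as an \<open>H\<^sup>4\<close>-valued map is not listed: it follows from \<open>in_C_H2\<close>,
  with which this predicate is always combined, because then all Fourier coefficients are
  continuous in time and \<open>H\<^sup>4\<close> is separable.
\<close>

definition in_L2_H4 :: "real \<Rightarrow> (real \<Rightarrow> real \<times> real \<Rightarrow> real) \<Rightarrow> bool" where
  "in_L2_H4 T \<eta> \<longleftrightarrow>
     (AE t in lborel. t \<in> {0<..<T} \<longrightarrow> \<eta> t \<in> sobolev 4) \<and>
     set_integrable lborel {0<..<T} (\<lambda>t. (sobolev_norm 4 (\<eta> t))\<^sup>2)"

text \<open>
  \<open>g\<close> is the weak time derivative of \<open>\<eta>\<close>: \<open>\<eta> t - \<eta> 0\<close> is the integral of the \<open>L\<^sup>2\<close>-valued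
  function \<open>g\<close> over \<open>(0, t)\<close>, the integral being characterised by its pairings with \<open>L\<^sup>2\<close>.
\<close>

definition weak_time_deriv ::
    "(real \<Rightarrow> real \<times> real \<Rightarrow> real) \<Rightarrow> (real \<Rightarrow> real \<times> real \<Rightarrow> real) \<Rightarrow> bool" where
  "weak_time_deriv \<eta> g \<longleftrightarrow>
     (AE t in lborel. t > 0 \<longrightarrow> g t \<in> L2_torus) \<and>
     (\<forall>w\<in>L2_torus. \<forall>t\<ge>0.
        set_integrable lborel {0<..<t} (\<lambda>s. L2_inner (g s) w) \<and>
        L2_inner (\<eta> t) w - L2_inner (\<eta> 0) w = (LINT s:{0<..<t}|lborel. L2_inner (g s) w))"

definition solves_equation ::
    "real \<Rightarrow> real \<Rightarrow> real \<Rightarrow> (real \<Rightarrow> real \<times> real \<Rightarrow> real) \<Rightarrow> bool" where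
  "solves_equation \<epsilon> \<delta> \<beta> \<eta> \<longleftrightarrow>
     (\<exists>\<eta>\<^sub>t. weak_time_deriv \<eta> \<eta>\<^sub>t \<and>
       (AE t in lborel. t > 0 \<longrightarrow>
         (\<exists>\<eta>\<^sub>x \<eta>\<^sub>x\<^sub>x \<eta>\<^sub>y\<^sub>y \<Lambda>3\<eta> \<Delta>2\<eta>.
            has_symbol sym_dx (\<eta> t) \<eta>\<^sub>x \<and>
            has_symbol (\<lambda>\<xi>. (sym_dx \<xi>)\<^sup>2) (\<eta> t) \<eta>\<^sub>x\<^sub>x \<and>
            has_symbol (\<lambda>\<xi>. (sym_dy \<xi>)\<^sup>2) (\<eta> t) \<eta>\<^sub>y\<^sub>y \<and>
            has_symbol (\<lambda>\<xi>. (sym_Lambda \<xi>) ^ 3) (\<eta> t) \<Lambda>3\<eta> \<and>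
            has_symbol (\<lambda>\<xi>. (sym_Laplace \<xi>)\<^sup>2) (\<eta> t) \<Delta>2\<eta> \<and>
            (AE p in torus.
               \<eta>\<^sub>t t p + \<eta> t p * \<eta>\<^sub>x p + (\<beta> - 1) * \<eta>\<^sub>x\<^sub>x p - \<eta>\<^sub>y\<^sub>y p
                 - \<delta> * \<Lambda>3\<eta> p + \<epsilon> * \<Delta>2\<eta> p = 0))))"

definition global_solution ::
    "real \<Rightarrow> real \<Rightarrow> real \<Rightarrow> (real \<times> real \<Rightarrow> real) \<Rightarrow> (real \<Rightarrow> real \<times> real \<Rightarrow> real) \<Rightarrow> bool" where
  "global_solution \<epsilon> \<delta> \<beta> \<eta>\<^sub>0 \<eta> \<longleftrightarrow>
     (\<forall>T>0. in_C_H2 T \<eta> \<and> in_L2_H4 T \<eta>) \<and>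
     solves_equation \<epsilon> \<delta> \<beta> \<eta> \<and>
     (AE p in torus. \<eta> 0 p = \<eta>\<^sub>0 p)"

end

theory Submission
  imports Defs
begin

text \<open>
  On the Fourier side the equation is the system
  \<open>a\<^sub>k' = - \<sigma>\<^sub>k a\<^sub>k - (\<i> k\<^sub>1 / 2) \<Sum>\<^sub>j a\<^sub>j a\<^sub>k\<^sub>-\<^sub>j\<close> with \<open>\<sigma>\<^sub>k \<ge> (\<epsilon> / 4) (1 + \<bar>k\<bar>\<^sup>2)\<^sup>2 - C\<close>. Since the solution is
  continuous into \<open>H\<^sup>2\<close>, every right-hand side is continuous in time, so every mode is a classical
  solution. An energy estimate for \<open>\<eta>(x, y) + \<eta>(-x, y)\<close> shows that oddness persists.

  For the absorbing ball in \<open>L\<^sup>2\<close> one subtracts a background profile \<open>\<phi>(x)\<close>, as Nicolaenko, Scheurer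
  and Temam do for the Kuramoto-Sivashinsky equation: \<open>\<phi>'\<close> is \<open>M (1 - D)\<close> with \<open>D\<close> a Dirichlet kernel.
  In the energy balance of \<open>\<eta> - \<phi>\<close> the cubic term cancels, the constant \<open>M\<close> beats the unstable modes, and
  the kernel contributes little because an odd function vanishes at \<open>x = 0\<close>. A uniform
  \<open>L\<^sup>2\<close> bound makes the nonlinear term of mode \<open>k\<close> of size \<open>\<bar>k\<bar>\<close>; integrating the
  mode equations over unit time gives \<open>\<bar>a\<^sub>k\<bar> \<lesssim> \<bar>k\<bar>\<^sup>-\<^sup>3\<close>, which makes the nonlinear terms bounded, and then
  \<open>\<bar>a\<^sub>k\<bar> \<lesssim> \<bar>k\<bar>\<^sup>-\<^sup>4\<close>, which is a bound in \<open>H\<^sup>2\<close>.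
\<close>

section \<open>Sums over frequencies\<close>

text \<open>The plain energy identity gives no absorbing set: the nonlinear term drops out of it,
  and for large \<beta> some modes have negative \<open>linear_symbol\<close> and grow. Shifting by
  \<phi> brings the nonlinear term back as damping, because its pairing with \<phi> is a multiple of
  the integral of \<open>\<phi>' \<eta>^2\<close>. A constant \<open>\<phi>'\<close> would be ideal,
  but \<phi> is periodic, so \<open>\<phi>'\<close> must have mean zero; the kernel removes the mean
  and concentrates the defect near \<open>x = 0\<close>. Measured in H^2 the defect is of order
  \<open>M / N\<close>, so N is fixed after M to keep it below the dissipation. As \<phi> is a
  trigonometric polynomial, the forcing it creates is a finite constant. All constants come from
  \<epsilon>, \<delta>, \<beta>; only the time of entry into the ball depends on the data.

  The passage from the equation to the modes rests on the convolution formula for the coefficients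
  of \<open>\<eta> \<eta>_x\<close>. It needs \<eta> to agree almost everywhere with its Fourier
  series, that is, uniqueness of Fourier coefficients, which is obtained from Stone-Weierstrass on a
  product of two circles.\<close>

definition bracket :: "int \<times> int \<Rightarrow> real" where
  "bracket k = 1 + (freq_norm k)\<^sup>2"

lemma bracket_eq: "bracket k = 1 + (real_of_int (fst k))\<^sup>2 + (real_of_int (snd k))\<^sup>2"
  by (simp add: bracket_def freq_norm_def)

lemma bracket_ge_1: "1 \<le> bracket k"
  by (simp add: bracket_def)

lemma bracket_pos: "0 < bracket k"
  using bracket_ge_1[of k] by linarith

lemma summable_on_int_even:
  fixes f :: "int \<Rightarrow> real"
  assumes "summable (\<lambda>n. f (int n))" "\<And>p. 0 \<le> f p" "\<And>p. f (- p) = f p"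
  shows "f summable_on UNIV"
proof -
  have nat: "(\<lambda>n. f (int n)) summable_on UNIV"
    using assms by (intro summable_nonneg_imp_summable_on) auto
  have "f summable_on range int"
    using nat by (subst summable_on_reindex) (auto simp: o_def)
  moreover have "f summable_on range (\<lambda>n. - int n)"
    using nat assms(3) by (subst summable_on_reindex) (auto simp: o_def inj_on_def)
  ultimately have "f summable_on (range int \<union> range (\<lambda>n. - int n))"
    by (rule summable_on_union)
  moreover have "range int \<union> range (\<lambda>n. - int n) = UNIV"
    by (auto simp: image_iff) (metis int_cases2)
  ultimately show ?thesis by simp
qed

lemma summable_on_inverse_squares_int: "(\<lambda>p. 1 / (real_of_int p)\<^sup>2) summable_on UNIV"
  using inverse_power_summable[of 2, where 'a = real]
  by (intro summable_on_int_even) (auto simp: field_simps)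

lemma summable_on_inverse_squares_int': "(\<lambda>p. 1 / (1 + (real_of_int p)\<^sup>2)) summable_on UNIV"
proof (rule summable_on_int_even)
  have "summable (\<lambda>n. 1 / (1 + (real n)\<^sup>2))"
  proof (rule summable_comparison_test_ev)
    show "\<forall>\<^sub>F n in sequentially. norm (1 / (1 + (real n)\<^sup>2)) \<le> inverse (real n ^ 2)"
      using eventually_gt_at_top[of 0] by eventually_elim (simp add: inverse_eq_divide frac_le)
    show "summable (\<lambda>n. inverse (real n ^ 2))"
      by (rule inverse_power_summable) auto
  qed
  then show "summable (\<lambda>n. 1 / (1 + (real_of_int (int n))\<^sup>2))" by simp
qed auto

lemma summable_on_Times_mult:
  fixes f :: "'a \<Rightarrow> real" and g :: "'b \<Rightarrow> real"
  assumes f: "f summable_on A" and g: "g summable_on B"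
  shows "(\<lambda>(x, y). f x * g y) summable_on (A \<times> B)"
proof -
  have f': "(\<lambda>x. \<bar>f x\<bar>) summable_on A" and g': "(\<lambda>y. \<bar>g y\<bar>) summable_on B"
    using f g summable_on_iff_abs_summable_on_real by force+
  have "(\<lambda>p. norm (case p of (x, y) \<Rightarrow> f x * g y)) summable_on (A \<times> B)"
    unfolding Infinite_Sum.abs_summable_on_Sigma_iff
    using f' g' by (auto simp: abs_mult infsum_cmult_right intro!: summable_on_cmult_left summable_on_cmult_right)
  then show ?thesis by (rule abs_summable_summable)
qed

lemma infsum_Times_mult:
  fixes f :: "'a \<Rightarrow> real" and g :: "'b \<Rightarrow> real"
  assumes f: "f summable_on A" and g: "g summable_on B"
  shows "(\<Sum>\<^sub>\<infinity>(x, y)\<in>A \<times> B. f x * g y) = infsum f A * infsum g B"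
  using infsum_Sigma_banach[OF summable_on_Times_mult[OF f g]]
  by (simp add: infsum_cmult_right infsum_cmult_left f g)

text \<open>The double sum factors because \<open>(1 + p^2) * (1 + q^2)\<close> is at most
  \<open>(bracket (p, q))^2\<close>. Its convergence in dimension two makes H^2 coefficients
  summable, and at the end it turns a modewise bound by \<open>1 / (bracket k)^2\<close> into a
  bound in H^2.\<close>

lemma summable_on_inverse_bracket: "(\<lambda>k. 1 / (bracket k)\<^sup>2) summable_on UNIV"
proof -
  have "(\<lambda>(p, q). 1 / (1 + (real_of_int p)\<^sup>2) * (1 / (1 + (real_of_int q)\<^sup>2))) summable_on UNIV \<times> UNIV"
    by (intro summable_on_Times_mult summable_on_inverse_squares_int')
  then have s: "(\<lambda>(p, q). 1 / (1 + (real_of_int p)\<^sup>2) * (1 / (1 + (real_of_int q)\<^sup>2))) summable_on UNIV"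
    by simp
  show ?thesis
  proof (rule summable_on_comparison_test[OF s])
    fix k :: "int \<times> int"
    obtain p q where k: "k = (p, q)" by (cases k)
    have "(1 + (real_of_int p)\<^sup>2) * (1 + (real_of_int q)\<^sup>2) \<le> (bracket k)\<^sup>2"
      unfolding power2_eq_square[of "bracket k"] by (intro mult_mono) (auto simp: k bracket_eq)
    then have "1 / (bracket k)\<^sup>2 \<le> 1 / ((1 + (real_of_int p)\<^sup>2) * (1 + (real_of_int q)\<^sup>2))"
      by (intro divide_left_mono) (auto simp: bracket_pos intro!: mult_pos_pos add_pos_nonneg zero_less_power)
    then show "1 / (bracket k)\<^sup>2 \<le> (case k of (p, q) \<Rightarrow> 1 / (1 + (real_of_int p)\<^sup>2) * (1 / (1 + (real_of_int q)\<^sup>2)))"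
      by (simp add: k)
  qed auto
qed

lemma infsum_Cauchy_Schwarz:
  fixes f g :: "'a \<Rightarrow> real"
  assumes f: "(\<lambda>x. (f x)\<^sup>2) summable_on A" and g: "(\<lambda>x. (g x)\<^sup>2) summable_on A"
  shows "(\<lambda>x. \<bar>f x * g x\<bar>) summable_on A"
    and "(\<Sum>\<^sub>\<infinity>x\<in>A. \<bar>f x * g x\<bar>) \<le> sqrt (\<Sum>\<^sub>\<infinity>x\<in>A. (f x)\<^sup>2) * sqrt (\<Sum>\<^sub>\<infinity>x\<in>A. (g x)\<^sup>2)"
proof -
  show s: "(\<lambda>x. \<bar>f x * g x\<bar>) summable_on A"
  proof (rule summable_on_comparison_test)
    show "(\<lambda>x. (f x)\<^sup>2 + (g x)\<^sup>2) summable_on A" using f g by (rule summable_on_add)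
    fix x
    have "2 * \<bar>f x\<bar> * \<bar>g x\<bar> \<le> \<bar>f x\<bar>\<^sup>2 + \<bar>g x\<bar>\<^sup>2" by (rule sum_squares_bound)
    moreover have "0 \<le> \<bar>f x\<bar> * \<bar>g x\<bar>" by simp
    ultimately show "\<bar>f x * g x\<bar> \<le> (f x)\<^sup>2 + (g x)\<^sup>2" unfolding abs_mult power2_abs by linarith
  qed auto
  show "(\<Sum>\<^sub>\<infinity>x\<in>A. \<bar>f x * g x\<bar>) \<le> sqrt (\<Sum>\<^sub>\<infinity>x\<in>A. (f x)\<^sup>2) * sqrt (\<Sum>\<^sub>\<infinity>x\<in>A. (g x)\<^sup>2)"
  proof (rule infsum_le_finite_sums[OF s])
    fix F assume F: "finite F" "F \<subseteq> A"
    have "(\<Sum>x\<in>F. \<bar>f x * g x\<bar>) \<le> L2_set f F * L2_set g F"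
      using L2_set_mult_ineq[of f g F] by (simp add: abs_mult)
    also have "\<dots> \<le> sqrt (\<Sum>\<^sub>\<infinity>x\<in>A. (f x)\<^sup>2) * sqrt (\<Sum>\<^sub>\<infinity>x\<in>A. (g x)\<^sup>2)"
      unfolding L2_set_def using F f g
      by (intro mult_mono real_sqrt_le_mono finite_sum_le_infsum)
        (auto intro!: sum_nonneg infsum_nonneg)
    finally show "(\<Sum>x\<in>F. \<bar>f x * g x\<bar>) \<le> sqrt (\<Sum>\<^sub>\<infinity>x\<in>A. (f x)\<^sup>2) * sqrt (\<Sum>\<^sub>\<infinity>x\<in>A. (g x)\<^sup>2)" .
  qed
qed

text \<open>Duhamel's formula over unit time: the initial value is damped by
  \<open>exp (- \<sigma>)\<close> and the forcing contributes at most \<open>B / \<sigma>\<close>.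
  Since \<open>exp (- \<sigma>) \<le> 1 / \<sigma>\<close>, both gain the same factor, so the bound
  at the end no longer remembers how rough the data were.\<close>

lemma linear_ode_bound:
  fixes a n :: "real \<Rightarrow> complex"
  assumes "0 < \<sigma>"
    and ode: "\<And>t. t \<in> {s..s + 1} \<Longrightarrow>
      (a has_vector_derivative (- of_real \<sigma> * a t + n t)) (at t within {s..s + 1})"
    and n: "\<And>t. t \<in> {s..s + 1} \<Longrightarrow> cmod (n t) \<le> B"
    and a: "cmod (a s) \<le> R"
  shows "cmod (a (s + 1)) \<le> (R + B) / \<sigma>"
proof -
  define y where "y t = of_real (exp (\<sigma> * (t - s))) * a t" for t
  have dy: "(y has_vector_derivative (of_real (exp (\<sigma> * (t - s))) * n t)) (at t within {s..s + 1})"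
    if t: "t \<in> {s..s + 1}" for t
  proof -
    have "((\<lambda>t. exp (\<sigma> * (t - s))) has_real_derivative exp (\<sigma> * (t - s)) * \<sigma>) (at t within {s..s + 1})"
      by (auto intro!: derivative_eq_intros)
    then have "((\<lambda>t. complex_of_real (exp (\<sigma> * (t - s)))) has_vector_derivative
        of_real (exp (\<sigma> * (t - s)) * \<sigma>)) (at t within {s..s + 1})"
      by (intro has_vector_derivative_of_real) (simp add: has_real_derivative_iff_has_vector_derivative)
    from has_vector_derivative_mult[OF this ode[OF t]]
    show ?thesis unfolding y_def by (simp add: algebra_simps)
  qed
  have i1: "((\<lambda>t. of_real (exp (\<sigma> * (t - s))) * n t) has_integral (y (s + 1) - y s)) {s..s + 1}"
    using dy by (intro fundamental_theorem_of_calculus) auto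
  have i2: "((\<lambda>t. B * exp (\<sigma> * (t - s))) has_integral
      (B / \<sigma> * exp (\<sigma> * (s + 1 - s)) - B / \<sigma> * exp (\<sigma> * (s - s)))) {s..s + 1}"
  proof (rule fundamental_theorem_of_calculus)
    fix t assume "t \<in> {s..s + 1}"
    have "((\<lambda>t. B / \<sigma> * exp (\<sigma> * (t - s))) has_real_derivative B * exp (\<sigma> * (t - s)))
        (at t within {s..s + 1})"
      using \<open>0 < \<sigma>\<close> by (auto intro!: derivative_eq_intros)
    then show "((\<lambda>t. B / \<sigma> * exp (\<sigma> * (t - s))) has_vector_derivative B * exp (\<sigma> * (t - s)))
        (at t within {s..s + 1})"
      by (simp add: has_real_derivative_iff_has_vector_derivative)
  qed auto
  have "B \<ge> 0" using n[of s] norm_ge_zero[of "n s"] by (auto simp del: norm_ge_zero)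
  have "R \<ge> 0" using a norm_ge_zero[of "a s"] by linarith
  have "norm (y (s + 1) - y s) \<le> B / \<sigma> * exp \<sigma> - B / \<sigma>"
  proof -
    have "norm (integral {s..s + 1} (\<lambda>t. of_real (exp (\<sigma> * (t - s))) * n t)) \<le>
        integral {s..s + 1} (\<lambda>t. B * exp (\<sigma> * (t - s)))"
    proof (rule integral_norm_bound_integral)
      show "norm (of_real (exp (\<sigma> * (t - s))) * n t) \<le> B * exp (\<sigma> * (t - s))"
        if "t \<in> {s..s + 1}" for t
        using n[OF that] by (simp add: norm_mult mult.commute)
    qed (use i1 i2 in blast)+
    then show ?thesis
      using integral_unique[OF i1] integral_unique[OF i2] by simp
  qed
  then have "norm (y (s + 1)) \<le> norm (y s) + B / \<sigma> * exp \<sigma> - B / \<sigma>"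
    using norm_triangle_ineq2[of "y (s + 1)" "y s"] by linarith
  then have *: "exp \<sigma> * cmod (a (s + 1)) \<le> R + B / \<sigma> * exp \<sigma>"
    using a divide_nonneg_pos[OF \<open>B \<ge> 0\<close> \<open>0 < \<sigma>\<close>] by (simp add: y_def norm_mult)
  have "R \<le> R / \<sigma> * exp \<sigma>"
  proof -
    have "\<sigma> \<le> exp \<sigma>" using exp_ge_add_one_self[of \<sigma>] by linarith
    then have "R * \<sigma> \<le> R * exp \<sigma>" using \<open>R \<ge> 0\<close> by (intro mult_left_mono)
    then show ?thesis using \<open>0 < \<sigma>\<close> by (simp add: field_simps)
  qed
  with * have "exp \<sigma> * cmod (a (s + 1)) \<le> exp \<sigma> * ((R + B) / \<sigma>)"
    by (simp add: field_simps add_divide_distrib)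
  then show ?thesis using mult_le_cancel_left_pos[OF exp_gt_zero[of \<sigma>]] by blast
qed

section \<open>Energy inequalities for infinite systems\<close>

text \<open>An exhaustion indexed by \<open>nat\<close>: dominated convergence applies to sequences,
  whereas \<open>infsum\<close> is a limit along the filter of finite sets.\<close>

definition freq_box :: "nat \<Rightarrow> (int \<times> int) set" where
  "freq_box n = {- int n..int n} \<times> {- int n..int n}"

lemma finite_freq_box [simp]: "finite (freq_box n)"
  by (simp add: freq_box_def)

lemma filterlim_freq_box: "filterlim freq_box (finite_subsets_at_top UNIV) sequentially"
proof (unfold filterlim_finite_subsets_at_top, intro allI impI)
  fix X :: "(int \<times> int) set" assume "finite X \<and> X \<subseteq> UNIV"
  then have X: "finite X" by simp
  define N where "N = (\<Sum>k\<in>X. nat \<bar>fst k\<bar> + nat \<bar>snd k\<bar>)"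
  have "X \<subseteq> freq_box n" if "n \<ge> N" for n
  proof
    fix k assume k: "k \<in> X"
    have "nat \<bar>fst k\<bar> + nat \<bar>snd k\<bar> \<le> N"
      unfolding N_def using X k by (intro member_le_sum[of k X "\<lambda>k. nat \<bar>fst k\<bar> + nat \<bar>snd k\<bar>"]) auto
    with that show "k \<in> freq_box n" by (cases k) (auto simp: freq_box_def)
  qed
  then show "\<forall>\<^sub>F n in sequentially. finite (freq_box n) \<and> X \<subseteq> freq_box n \<and> freq_box n \<subseteq> UNIV"
    by (auto simp: eventually_sequentially)
qed

lemma sum_freq_box_tendsto:
  fixes f :: "int \<times> int \<Rightarrow> 'a::{comm_monoid_add, t2_space}"
  assumes "f summable_on UNIV"
  shows "(\<lambda>n. sum f (freq_box n)) \<longlonglongrightarrow> infsum f UNIV"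
  using filterlim_compose[OF infsum_tendsto[OF assms] filterlim_freq_box] .

text \<open>Gronwall's inequality for the l^2 norm of a system of infinitely many modes. The series
  is never differentiated term by term: the identity is integrated in time for the modes of one box,
  and the limit is taken under the integral, with \<open>B\<close> providing the dominating
  constant. The rate \<open>c\<close> may have either sign: a positive one gives absorption, a
  negative one shows that zero data stay zero.\<close>

lemma energy_inequality:
  fixes v g :: "int \<times> int \<Rightarrow> real \<Rightarrow> complex"
  assumes T: "0 \<le> T"
    and der: "\<And>k t. t \<in> {0..T} \<Longrightarrow> (v k has_vector_derivative g k t) (at t within {0..T})"
    and v: "\<And>t. t \<in> {0..T} \<Longrightarrow> (\<lambda>k. (cmod (v k t))\<^sup>2) summable_on UNIV"
    and vB: "\<And>t. t \<in> {0..T} \<Longrightarrow> (\<Sum>\<^sub>\<infinity>k. (cmod (v k t))\<^sup>2) \<le> B"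
    and g: "\<And>t. t \<in> {0..T} \<Longrightarrow> (\<lambda>k. cmod (v k t) * cmod (g k t)) summable_on UNIV"
    and gB: "\<And>t. t \<in> {0..T} \<Longrightarrow> (\<Sum>\<^sub>\<infinity>k. cmod (v k t) * cmod (g k t)) \<le> B"
    and c: "c \<noteq> 0"
    and ineq: "\<And>t. t \<in> {0..T} \<Longrightarrow>
      c * (\<Sum>\<^sub>\<infinity>k. (cmod (v k t))\<^sup>2) + (\<Sum>\<^sub>\<infinity>k. 2 * Re (cnj (v k t) * g k t)) \<le> \<kappa>"
  shows "exp (c * T) * (\<Sum>\<^sub>\<infinity>k. (cmod (v k T))\<^sup>2) - (\<Sum>\<^sub>\<infinity>k. (cmod (v k 0))\<^sup>2) \<le> \<kappa> / c * (exp (c * T) - 1)"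
proof -
  define W where "W t = (\<Sum>\<^sub>\<infinity>k. (cmod (v k t))\<^sup>2)" for t
  define D where "D t = (\<Sum>\<^sub>\<infinity>k. 2 * Re (cnj (v k t) * g k t))" for t
  define f where "f n t = exp (c * t) * (\<Sum>k\<in>freq_box n. c * (cmod (v k t))\<^sup>2 + 2 * Re (cnj (v k t) * g k t))" for n t
  define F where "F n t = exp (c * t) * (\<Sum>k\<in>freq_box n. (cmod (v k t))\<^sup>2)" for n t
  have sD: "(\<lambda>k. 2 * Re (cnj (v k t) * g k t)) summable_on UNIV" if "t \<in> {0..T}" for t
  proof (rule abs_summable_summable, rule Infinite_Sum.abs_summable_on_comparison_test'[OF summable_on_cmult_right[OF g[OF that], of 2]])
    fix k
    show "norm (2 * Re (cnj (v k t) * g k t)) \<le> 2 * (cmod (v k t) * cmod (g k t))"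
      using abs_Re_le_cmod[of "cnj (v k t) * g k t"] by (simp add: norm_mult abs_mult)
  qed
  have int: "(f n has_integral (F n T - F n 0)) {0..T}" for n
  proof (rule fundamental_theorem_of_calculus[OF T])
    fix t assume t: "t \<in> {0..T}"
    have 1: "((\<lambda>t. (cmod (v k t))\<^sup>2) has_real_derivative 2 * Re (cnj (v k t) * g k t)) (at t within {0..T})" for k
    proof -
      have "((\<lambda>t. v k t \<bullet> v k t) has_derivative (\<lambda>h. v k t \<bullet> (h *\<^sub>R g k t) + (h *\<^sub>R g k t) \<bullet> v k t)) (at t within {0..T})"
        using der[OF t, of k] by (intro has_derivative_inner) (auto simp: has_vector_derivative_def)
      then show ?thesis
        unfolding has_field_derivative_def power2_norm_eq_inner
        by (rule has_derivative_eq_rhs) (auto simp: inner_complex_def algebra_simps fun_eq_iff)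
    qed
    have "(F n has_real_derivative exp (c * t) * c * (\<Sum>k\<in>freq_box n. (cmod (v k t))\<^sup>2)
        + (\<Sum>k\<in>freq_box n. 2 * Re (cnj (v k t) * g k t)) * exp (c * t)) (at t within {0..T})"
      unfolding F_def
    proof (rule DERIV_mult)
      show "((\<lambda>t. exp (c * t)) has_real_derivative exp (c * t) * c) (at t within {0..T})"
        by (auto intro!: derivative_eq_intros)
      show "((\<lambda>t. \<Sum>k\<in>freq_box n. (cmod (v k t))\<^sup>2) has_real_derivative
          (\<Sum>k\<in>freq_box n. 2 * Re (cnj (v k t) * g k t))) (at t within {0..T})"
        by (rule DERIV_sum[OF 1])
    qed
    also have "exp (c * t) * c * (\<Sum>k\<in>freq_box n. (cmod (v k t))\<^sup>2)
        + (\<Sum>k\<in>freq_box n. 2 * Re (cnj (v k t) * g k t)) * exp (c * t) = f n t"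
      unfolding f_def sum.distrib sum_distrib_left[symmetric] by (simp add: algebra_simps sum_distrib_left)
    finally show "(F n has_vector_derivative f n t) (at t within {0..T})"
      by (simp add: has_real_derivative_iff_has_vector_derivative)
  qed
  have B: "0 \<le> B" using vB[of 0] T infsum_nonneg[of UNIV "\<lambda>k. (cmod (v k 0))\<^sup>2"] by force
  have bound: "norm (f n t) \<le> exp (\<bar>c\<bar> * T) * (\<bar>c\<bar> * B + 2 * B)" if t: "t \<in> {0..T}" for n t
  proof -
    have "\<bar>\<Sum>k\<in>freq_box n. c * (cmod (v k t))\<^sup>2 + 2 * Re (cnj (v k t) * g k t)\<bar>
        \<le> (\<Sum>k\<in>freq_box n. \<bar>c * (cmod (v k t))\<^sup>2 + 2 * Re (cnj (v k t) * g k t)\<bar>)"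
      by (rule sum_abs)
    also have "\<dots> \<le> (\<Sum>k\<in>freq_box n. \<bar>c\<bar> * (cmod (v k t))\<^sup>2 + 2 * (cmod (v k t) * cmod (g k t)))"
    proof (rule sum_mono)
      fix k
      show "\<bar>c * (cmod (v k t))\<^sup>2 + 2 * Re (cnj (v k t) * g k t)\<bar> \<le> \<bar>c\<bar> * (cmod (v k t))\<^sup>2 + 2 * (cmod (v k t) * cmod (g k t))"
        using abs_Re_le_cmod[of "cnj (v k t) * g k t"] abs_triangle_ineq[of "c * (cmod (v k t))\<^sup>2" "2 * Re (cnj (v k t) * g k t)"]
        by (simp add: norm_mult abs_mult)
    qed
    also have "\<dots> = \<bar>c\<bar> * (\<Sum>k\<in>freq_box n. (cmod (v k t))\<^sup>2) + 2 * (\<Sum>k\<in>freq_box n. cmod (v k t) * cmod (g k t))"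
      by (simp add: sum.distrib sum_distrib_left)
    also have "\<dots> \<le> \<bar>c\<bar> * B + 2 * B"
    proof (intro add_mono mult_left_mono)
      show "(\<Sum>k\<in>freq_box n. (cmod (v k t))\<^sup>2) \<le> B"
        by (rule order_trans[OF finite_sum_le_infsum[OF v[OF t]] vB[OF t]]) auto
      show "(\<Sum>k\<in>freq_box n. cmod (v k t) * cmod (g k t)) \<le> B"
        by (rule order_trans[OF finite_sum_le_infsum[OF g[OF t]] gB[OF t]]) auto
    qed auto
    finally have "\<bar>\<Sum>k\<in>freq_box n. c * (cmod (v k t))\<^sup>2 + 2 * Re (cnj (v k t) * g k t)\<bar> \<le> \<bar>c\<bar> * B + 2 * B" .
    moreover have "exp (c * t) \<le> exp (\<bar>c\<bar> * T)"
    proof -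
      have "c * t \<le> \<bar>c\<bar> * t" using t by (intro mult_right_mono) auto
      also have "\<dots> \<le> \<bar>c\<bar> * T" using t by (intro mult_left_mono) auto
      finally show ?thesis by simp
    qed
    ultimately show ?thesis unfolding f_def by (auto simp: abs_mult intro!: mult_mono)
  qed
  have lim: "(\<lambda>n. f n t) \<longlonglongrightarrow> exp (c * t) * (c * W t + D t)" if t: "t \<in> {0..T}" for t
  proof -
    have "(\<lambda>n. exp (c * t) * (c * (\<Sum>k\<in>freq_box n. (cmod (v k t))\<^sup>2) + (\<Sum>k\<in>freq_box n. 2 * Re (cnj (v k t) * g k t))))
        \<longlonglongrightarrow> exp (c * t) * (c * W t + D t)"
      unfolding W_def D_def by (intro tendsto_intros sum_freq_box_tendsto v t sD)
    then show ?thesis unfolding f_def by (simp add: sum.distrib sum_distrib_left)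
  qed
  have limF: "(\<lambda>n. F n t) \<longlonglongrightarrow> exp (c * t) * W t" if t: "t \<in> {0..T}" for t
    unfolding F_def W_def by (intro tendsto_intros sum_freq_box_tendsto v t)
  have limD: "(\<lambda>n. F n T - F n 0) \<longlonglongrightarrow> exp (c * T) * W T - exp (c * 0) * W 0"
    using T by (intro tendsto_diff limF) auto
  have 1: "((\<lambda>t. exp (c * t) * (c * W t + D t)) has_integral (exp (c * T) * W T - exp (c * 0) * W 0)) {0..T}"
    by (rule has_integral_dominated_convergence[where f = f and h = "\<lambda>_. exp (\<bar>c\<bar> * T) * (\<bar>c\<bar> * B + 2 * B)"])
      (use int bound lim limD in auto)
  have 2: "((\<lambda>t. \<kappa> * exp (c * t)) has_integral (\<kappa> / c * exp (c * T) - \<kappa> / c * exp (c * 0))) {0..T}"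
  proof (rule fundamental_theorem_of_calculus[OF T])
    fix t assume "t \<in> {0..T}"
    have "((\<lambda>t. \<kappa> / c * exp (c * t)) has_real_derivative \<kappa> * exp (c * t)) (at t within {0..T})"
      using c by (auto intro!: derivative_eq_intros)
    then show "((\<lambda>t. \<kappa> / c * exp (c * t)) has_vector_derivative \<kappa> * exp (c * t)) (at t within {0..T})"
      by (simp add: has_real_derivative_iff_has_vector_derivative)
  qed
  have "exp (c * T) * W T - exp (c * 0) * W 0 \<le> \<kappa> / c * exp (c * T) - \<kappa> / c * exp (c * 0)"
  proof (rule has_integral_le[OF 1 2])
    fix t assume "t \<in> {0..T}"
    then show "exp (c * t) * (c * W t + D t) \<le> \<kappa> * exp (c * t)"
      using ineq[of t] by (simp add: W_def D_def mult.commute)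
  qed
  then show ?thesis by (simp add: W_def algebra_simps)
qed

lemma bij_shift: "bij_betw (\<lambda>(k, j). (k - j, j)) UNIV (UNIV :: ('a::ab_group_add \<times> 'a) set)"
  by (rule bij_betw_byWitness[where f' = "\<lambda>(k, j). (k + j, j)"]) auto

text \<open>Young's inequality in dual form, by AM-GM under the double sum.\<close>

lemma summable_on_trilinear:
  fixes s u w :: "int \<times> int \<Rightarrow> real"
  assumes s: "s summable_on UNIV" "\<And>j. 0 \<le> s j"
    and u: "(\<lambda>k. (u k)\<^sup>2) summable_on UNIV" and w: "(\<lambda>k. (w k)\<^sup>2) summable_on UNIV"
    and u0: "\<And>k. 0 \<le> u k" and w0: "\<And>k. 0 \<le> w k" and \<theta>: "0 < \<theta>"
  shows "(\<lambda>(k, j). u k * (s j * w (k - j))) summable_on UNIV"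
    and "(\<Sum>\<^sub>\<infinity>(k, j). u k * (s j * w (k - j))) \<le>
      infsum s UNIV * (\<theta> * (\<Sum>\<^sub>\<infinity>k. (u k)\<^sup>2) + (\<Sum>\<^sub>\<infinity>k. (w k)\<^sup>2) / (4 * \<theta>))"
proof -
  define G where "G = (\<lambda>(k, j). (\<theta> * (u k)\<^sup>2) * s j)"
  define H where "H = (\<lambda>(k, j). ((w k)\<^sup>2 / (4 * \<theta>)) * s j)"
  have s': "(\<lambda>j. s j) summable_on UNIV" using s by simp
  have u': "(\<lambda>k. \<theta> * (u k)\<^sup>2) summable_on UNIV" using u by (rule summable_on_cmult_right)
  have w': "(\<lambda>k. (w k)\<^sup>2 / (4 * \<theta>)) summable_on UNIV"
    using summable_on_cmult_left[OF w, of "1 / (4 * \<theta>)"] by simp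
  have G: "G summable_on UNIV" "infsum G UNIV = \<theta> * (\<Sum>\<^sub>\<infinity>k. (u k)\<^sup>2) * infsum s UNIV"
    using summable_on_Times_mult[OF u' s'] infsum_Times_mult[OF u' s']
    by (simp_all add: G_def infsum_cmult_right u)
  have H0: "H summable_on UNIV" "infsum H UNIV = (\<Sum>\<^sub>\<infinity>k. (w k)\<^sup>2) / (4 * \<theta>) * infsum s UNIV"
    using summable_on_Times_mult[OF w' s'] infsum_Times_mult[OF w' s'] infsum_cmult_left[of "1 / (4 * \<theta>)" "\<lambda>k. (w k)\<^sup>2" UNIV] w
    by (simp_all add: H_def)
  define H' where "H' = (\<lambda>x. H ((\<lambda>(k, j). (k - j, j)) x))"
  have H: "H' summable_on UNIV" "infsum H' UNIV = infsum H UNIV"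
    unfolding H'_def using summable_on_reindex_bij_betw[OF bij_shift, of H] infsum_reindex_bij_betw[OF bij_shift, of H] H0(1)
    by simp_all
  have GH: "(\<lambda>x. G x + H' x) summable_on UNIV" using G(1) H(1) by (rule summable_on_add)
  have le: "(case x of (k, j) \<Rightarrow> u k * (s j * w (k - j))) \<le> G x + H' x" for x
  proof -
    obtain k j where x: "x = (k, j)" by (cases x)
    have "0 \<le> (2 * \<theta> * u k - w (k - j))\<^sup>2" by simp
    then have "4 * \<theta> * (u k * w (k - j)) \<le> 4 * \<theta> * (\<theta> * (u k)\<^sup>2) + (w (k - j))\<^sup>2"
      by (simp add: power2_eq_square algebra_simps)
    then have "u k * w (k - j) \<le> \<theta> * (u k)\<^sup>2 + (w (k - j))\<^sup>2 / (4 * \<theta>)"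
      using \<theta> by (simp add: field_simps)
    from mult_right_mono[OF this s(2)[of j]]
    show ?thesis by (simp add: x G_def H'_def H_def algebra_simps)
  qed
  show S: "(\<lambda>(k, j). u k * (s j * w (k - j))) summable_on UNIV"
    by (rule summable_on_comparison_test[OF GH]) (use le u0 w0 s(2) in \<open>auto split: prod.split\<close>)
  have "(\<Sum>\<^sub>\<infinity>(k, j). u k * (s j * w (k - j))) \<le> (\<Sum>\<^sub>\<infinity>x. G x + H' x)"
    using S GH le by (intro infsum_mono) auto
  also have "\<dots> = infsum G UNIV + infsum H' UNIV"
    using G(1) H(1) by (rule infsum_add)
  finally show "(\<Sum>\<^sub>\<infinity>(k, j). u k * (s j * w (k - j))) \<le>
      infsum s UNIV * (\<theta> * (\<Sum>\<^sub>\<infinity>k. (u k)\<^sup>2) + (\<Sum>\<^sub>\<infinity>k. (w k)\<^sup>2) / (4 * \<theta>))"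
    using G(2) H(2) H0(2) by (simp add: algebra_simps)
qed

section \<open>Sobolev sequences and convolution\<close>

definition h2 :: "(int \<times> int \<Rightarrow> complex) \<Rightarrow> bool" where
  "h2 f \<longleftrightarrow> (\<lambda>k. (bracket k)\<^sup>2 * (cmod (f k))\<^sup>2) summable_on UNIV"

definition h2_sq :: "(int \<times> int \<Rightarrow> complex) \<Rightarrow> real" where
  "h2_sq f = (\<Sum>\<^sub>\<infinity>k. (bracket k)\<^sup>2 * (cmod (f k))\<^sup>2)"

definition l2_sq :: "(int \<times> int \<Rightarrow> complex) \<Rightarrow> real" where
  "l2_sq f = (\<Sum>\<^sub>\<infinity>k. (cmod (f k))\<^sup>2)"

definition inv_bracket_sum :: real where
  "inv_bracket_sum = (\<Sum>\<^sub>\<infinity>k. 1 / (bracket k)\<^sup>2)"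

lemma inv_bracket_sum_nonneg: "0 \<le> inv_bracket_sum"
  unfolding inv_bracket_sum_def by (rule infsum_nonneg) auto

lemma h2_sq_nonneg: "0 \<le> h2_sq f" and l2_sq_nonneg: "0 \<le> l2_sq f"
  by (auto simp: h2_sq_def l2_sq_def intro!: infsum_nonneg)

lemma fst_le_bracket: "(real_of_int (fst k))\<^sup>2 \<le> bracket k" "\<bar>real_of_int (fst k)\<bar> \<le> bracket k"
proof -
  show 1: "(real_of_int (fst k))\<^sup>2 \<le> bracket k"
    by (simp add: bracket_eq)
  have "0 \<le> (\<bar>real_of_int (fst k)\<bar> - 1)\<^sup>2" by simp
  then have "2 * \<bar>real_of_int (fst k)\<bar> \<le> 1 + (real_of_int (fst k))\<^sup>2"
    by (simp only: power2_diff power2_abs) simp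
  also have "\<dots> \<le> 2 * bracket k" using 1 bracket_ge_1[of k] by linarith
  finally show "\<bar>real_of_int (fst k)\<bar> \<le> bracket k" by simp
qed

lemma h2_weighted:
  assumes "h2 f" "\<And>k. \<bar>m k\<bar> \<le> bracket k"
  shows "(\<lambda>k. (m k * cmod (f k))\<^sup>2) summable_on UNIV"
    and "(\<Sum>\<^sub>\<infinity>k. (m k * cmod (f k))\<^sup>2) \<le> h2_sq f"
proof -
  have le: "(m k * cmod (f k))\<^sup>2 \<le> (bracket k)\<^sup>2 * (cmod (f k))\<^sup>2" for k
    unfolding power_mult_distrib using assms(2)[of k] bracket_pos[of k]
    by (intro mult_right_mono) (auto simp: abs_le_square_iff[symmetric])
  show s: "(\<lambda>k. (m k * cmod (f k))\<^sup>2) summable_on UNIV"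
    by (rule summable_on_comparison_test[OF assms(1)[unfolded h2_def]]) (use le in auto)
  show "(\<Sum>\<^sub>\<infinity>k. (m k * cmod (f k))\<^sup>2) \<le> h2_sq f"
    unfolding h2_sq_def using s assms(1)[unfolded h2_def] le by (rule infsum_mono)
qed

lemma h2_l2:
  assumes "h2 f"
  shows "(\<lambda>k. (cmod (f k))\<^sup>2) summable_on UNIV" and "l2_sq f \<le> h2_sq f"
  using h2_weighted[OF assms, of "\<lambda>_. 1"] bracket_ge_1 by (auto simp: l2_sq_def)

text \<open>Cauchy-Schwarz against \<open>1 / bracket k\<close>: the embedding of H^2 into the
  absolutely convergent Fourier series.\<close>

lemma h2_l1:
  assumes "h2 f"
  shows "(\<lambda>k. cmod (f k)) summable_on UNIV"
    and "(\<Sum>\<^sub>\<infinity>k. cmod (f k)) \<le> sqrt (h2_sq f) * sqrt inv_bracket_sum"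
proof -
  have 1: "(\<lambda>k. (bracket k * cmod (f k))\<^sup>2) summable_on UNIV"
    using h2_weighted(1)[OF assms, of bracket] bracket_pos by (simp add: less_imp_le)
  have 2: "(\<lambda>k. (1 / bracket k)\<^sup>2) summable_on UNIV"
    using summable_on_inverse_bracket by (simp add: power_divide)
  have eq: "\<bar>bracket k * cmod (f k) * (1 / bracket k)\<bar> = cmod (f k)" for k
    using bracket_pos[of k] by simp
  show "(\<lambda>k. cmod (f k)) summable_on UNIV"
    using infsum_Cauchy_Schwarz(1)[OF 1 2] by (simp only: eq)
  show "(\<Sum>\<^sub>\<infinity>k. cmod (f k)) \<le> sqrt (h2_sq f) * sqrt inv_bracket_sum"
    using infsum_Cauchy_Schwarz(2)[OF 1 2] unfolding eq
    by (simp add: h2_sq_def inv_bracket_sum_def power_mult_distrib power_divide)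
qed

lemma bij_reflect_at: "bij_betw (\<lambda>j. k - j) UNIV (UNIV :: ('a::ab_group_add) set)"
  by (rule bij_betw_byWitness[where f' = "\<lambda>j. k - j"]) auto

definition conv :: "(int \<times> int \<Rightarrow> complex) \<Rightarrow> (int \<times> int \<Rightarrow> complex) \<Rightarrow> int \<times> int \<Rightarrow> complex" where
  "conv f g k = (\<Sum>\<^sub>\<infinity>j. f j * g (k - j))"

lemma conv_bound:
  assumes f: "(\<lambda>k. (cmod (f k))\<^sup>2) summable_on UNIV" and g: "(\<lambda>k. (cmod (g k))\<^sup>2) summable_on UNIV"
  shows "(\<lambda>j. f j * g (k - j)) summable_on UNIV"
    and "cmod (conv f g k) \<le> sqrt (l2_sq f) * sqrt (l2_sq g)"
proof -
  have g': "(\<lambda>j. (cmod (g (k - j)))\<^sup>2) summable_on UNIV"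
    "(\<Sum>\<^sub>\<infinity>j. (cmod (g (k - j)))\<^sup>2) = l2_sq g"
    using g summable_on_reindex_bij_betw[OF bij_reflect_at, of "\<lambda>j. (cmod (g j))\<^sup>2" k]
      infsum_reindex_bij_betw[OF bij_reflect_at, of "\<lambda>j. (cmod (g j))\<^sup>2" k]
    by (auto simp: l2_sq_def)
  have s: "(\<lambda>j. cmod (f j) * cmod (g (k - j))) summable_on UNIV"
    using infsum_Cauchy_Schwarz(1)[OF f g'(1)] by (simp add: abs_mult)
  have le: "(\<Sum>\<^sub>\<infinity>j. cmod (f j) * cmod (g (k - j))) \<le> sqrt (l2_sq f) * sqrt (l2_sq g)"
    using infsum_Cauchy_Schwarz(2)[OF f g'(1)] by (simp add: abs_mult g'(2) l2_sq_def)
  have s': "(\<lambda>j. norm (f j * g (k - j))) summable_on UNIV"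
    using s by (simp add: norm_mult)
  then show "(\<lambda>j. f j * g (k - j)) summable_on UNIV"
    by (rule abs_summable_summable)
  show "cmod (conv f g k) \<le> sqrt (l2_sq f) * sqrt (l2_sq g)"
    using norm_infsum_bound[OF s'] le by (simp add: conv_def norm_mult)
qed

text \<open>Absolute convergence over pairs of frequencies is what later permits arbitrary
  permutations of the frequencies. The parameter \<theta> moves the weight between \<open>u\<close>,
  which will carry a derivative and must be absorbed by dissipation, and \<open>w\<close>, which
  only costs an l^2 norm.\<close>

lemma trilinear_conv:
  assumes s: "(\<lambda>k. cmod (s k)) summable_on UNIV"
    and u: "(\<lambda>k. (cmod (u k))\<^sup>2) summable_on UNIV" and w: "(\<lambda>k. (cmod (w k))\<^sup>2) summable_on UNIV"
    and \<theta>: "0 < \<theta>"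
  shows "(\<lambda>(k, j). u k * (s j * w (k - j))) summable_on UNIV"
    and "(\<lambda>k. cmod (u k) * cmod (conv s w k)) summable_on UNIV"
    and "(\<Sum>\<^sub>\<infinity>k. cmod (u k) * cmod (conv s w k)) \<le>
      (\<Sum>\<^sub>\<infinity>k. cmod (s k)) * (\<theta> * l2_sq u + l2_sq w / (4 * \<theta>))"
    and "(\<Sum>\<^sub>\<infinity>k. u k * conv s w k) = (\<Sum>\<^sub>\<infinity>(k, j). u k * (s j * w (k - j)))"
proof -
  define K where "K = (\<lambda>(k, j). u k * (s j * w (k - j)))"
  note tri = summable_on_trilinear[OF s _ u w _ _ \<theta>]
  have nK: "norm (K p) = (case p of (k, j) \<Rightarrow> cmod (u k) * (cmod (s j) * cmod (w (k - j))))" for p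
    by (auto simp: K_def norm_mult split: prod.split)
  have absK: "(\<lambda>p. norm (K p)) summable_on UNIV" unfolding nK by (rule tri(1)) auto
  then have K: "K summable_on UNIV" by (rule abs_summable_summable)
  then show "(\<lambda>(k, j). u k * (s j * w (k - j))) summable_on UNIV" by (simp add: K_def)
  have K': "K summable_on UNIV \<times> UNIV" and absK': "(\<lambda>p. norm (K p)) summable_on UNIV \<times> UNIV"
    using K absK by simp_all
  have inner: "(\<Sum>\<^sub>\<infinity>j. K (k, j)) = u k * conv s w k" for k
    by (simp add: K_def conv_def infsum_cmult_right')
  show "(\<Sum>\<^sub>\<infinity>k. u k * conv s w k) = (\<Sum>\<^sub>\<infinity>(k, j). u k * (s j * w (k - j)))"
    using infsum_Sigma_banach[OF K'] by (simp add: inner) (simp add: K_def)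
  have rows: "(\<lambda>j. norm (K (k, j))) summable_on UNIV" for k
    using absK' unfolding Infinite_Sum.abs_summable_on_Sigma_iff by blast
  have outer: "(\<lambda>k. \<Sum>\<^sub>\<infinity>j. norm (K (k, j))) summable_on UNIV"
    using summable_on_Sigma_banach[of "\<lambda>k j. norm (K (k, j))" UNIV "\<lambda>_. UNIV"] absK by (simp add: cond_case_prod_eta)
  have le: "cmod (u k) * cmod (conv s w k) \<le> (\<Sum>\<^sub>\<infinity>j. norm (K (k, j)))" for k
    using norm_infsum_bound[OF rows, of k] by (simp add: inner norm_mult)
  show S: "(\<lambda>k. cmod (u k) * cmod (conv s w k)) summable_on UNIV"
    by (rule summable_on_comparison_test[OF outer]) (use le in auto)
  have "(\<Sum>\<^sub>\<infinity>k. cmod (u k) * cmod (conv s w k)) \<le> (\<Sum>\<^sub>\<infinity>k. \<Sum>\<^sub>\<infinity>j. norm (K (k, j)))"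
    using S outer le by (rule infsum_mono)
  also have "\<dots> = (\<Sum>\<^sub>\<infinity>p. norm (K p))"
    using infsum_Sigma_banach[OF absK'] by simp
  also have "\<dots> \<le> (\<Sum>\<^sub>\<infinity>k. cmod (s k)) * (\<theta> * l2_sq u + l2_sq w / (4 * \<theta>))"
    unfolding nK l2_sq_def by (rule tri(2)) auto
  finally show "(\<Sum>\<^sub>\<infinity>k. cmod (u k) * cmod (conv s w k)) \<le>
      (\<Sum>\<^sub>\<infinity>k. cmod (s k)) * (\<theta> * l2_sq u + l2_sq w / (4 * \<theta>))" .
qed

lemma h2_fst:
  assumes "h2 f"
  shows "(\<lambda>k. (cmod (of_int (fst k) * f k))\<^sup>2) summable_on UNIV"
    and "l2_sq (\<lambda>k. of_int (fst k) * f k) \<le> h2_sq f"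
  using h2_weighted[OF assms fst_le_bracket(2)]
  by (auto simp: l2_sq_def norm_mult power_mult_distrib)

text \<open>The Fourier form of the fact that \<open>f^2 f_x\<close> has integral zero. With
  \<open>k = j + l\<close> and the reality condition the sum runs over the product
  \<open>\<Phi>\<close> of the coefficients at \<open>- (j + l)\<close>, \<open>j\<close>,
  \<open>l\<close>, which is symmetric in these three frequencies of sum zero. Permuting them
  replaces the weight \<open>j + l\<close> by \<open>- j\<close> or by \<open>- l\<close> without
  changing the value \<open>X\<close>; the three weights are related by
  \<open>- (j + l) = - j - l\<close>, whence \<open>- X = X + X\<close>.\<close>

lemma conv_cancel:
  assumes f: "h2 f" and real: "\<And>k. f (- k) = cnj (f k)"
  shows "(\<Sum>\<^sub>\<infinity>k. cnj (f k) * (of_int (fst k) * conv f f k)) = 0"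
proof -
  define u where "u k = of_int (fst k) * cnj (f k)" for k
  have u: "(\<lambda>k. (cmod (u k))\<^sup>2) summable_on UNIV"
    using h2_fst(1)[OF f] by (simp add: u_def norm_mult)
  note tri = trilinear_conv[OF h2_l1(1)[OF f] u h2_l2(1)[OF f] zero_less_one]
  define \<Phi> where "\<Phi> = (\<lambda>(j, l). f (- (j + l)) * (f j * f l))"
  define q :: "int \<times> int \<Rightarrow> complex" where "q k = of_int (fst k)" for k
  define X where "X = (\<Sum>\<^sub>\<infinity>(k, j). u k * (f j * f (k - j)))"
  have b1: "bij_betw (\<lambda>(j, l). (j + l, j)) UNIV (UNIV :: ((int \<times> int) \<times> (int \<times> int)) set)"
    by (rule bij_betw_byWitness[where f' = "\<lambda>(k, j). (j, k - j)"]) auto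
  have b2: "bij_betw (\<lambda>(j, l). (- (j + l), l)) UNIV (UNIV :: ((int \<times> int) \<times> (int \<times> int)) set)"
    by (rule bij_betw_byWitness[where f' = "\<lambda>(j, l). (- (j + l), l)"]) auto
  have b3: "bij_betw (\<lambda>(j, l). (l, j)) UNIV (UNIV :: ((int \<times> int) \<times> (int \<times> int)) set)"
    by (rule bij_betw_byWitness[where f' = "\<lambda>(j, l). (l, j)"]) auto
  have r1: "(case (\<lambda>(j, l). (j + l, j)) p of (k, j) \<Rightarrow> u k * (f j * f (k - j))) = q (fst p + snd p) * \<Phi> p" for p
    by (cases p) (simp add: u_def \<Phi>_def q_def real del: minus_add_distrib)
  have X1: "(\<lambda>p. q (fst p + snd p) * \<Phi> p) summable_on UNIV" "X = (\<Sum>\<^sub>\<infinity>p. q (fst p + snd p) * \<Phi> p)"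
    using tri(1) summable_on_reindex_bij_betw[OF b1, of "\<lambda>(k, j). u k * (f j * f (k - j))"]
      infsum_reindex_bij_betw[OF b1, of "\<lambda>(k, j). u k * (f j * f (k - j))"]
    unfolding r1 X_def by auto
  have r2: "q (fst ((\<lambda>(j, l). (- (j + l), l)) p) + snd ((\<lambda>(j, l). (- (j + l), l)) p)) * \<Phi> ((\<lambda>(j, l). (- (j + l), l)) p)
      = - (q (fst p) * \<Phi> p)" for p
    by (cases p) (simp add: \<Phi>_def q_def algebra_simps)
  have X2: "(\<lambda>p. - (q (fst p) * \<Phi> p)) summable_on UNIV" "X = (\<Sum>\<^sub>\<infinity>p. - (q (fst p) * \<Phi> p))"
    using X1 summable_on_reindex_bij_betw[OF b2, of "\<lambda>p. q (fst p + snd p) * \<Phi> p"]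
      infsum_reindex_bij_betw[OF b2, of "\<lambda>p. q (fst p + snd p) * \<Phi> p"]
    unfolding r2 by auto
  have r3: "- (q (fst ((\<lambda>(j, l). (l, j)) p)) * \<Phi> ((\<lambda>(j, l). (l, j)) p)) = - (q (snd p) * \<Phi> p)" for p
    by (cases p) (simp add: \<Phi>_def add.commute mult.commute del: minus_add_distrib)
  have X3: "(\<lambda>p. - (q (snd p) * \<Phi> p)) summable_on UNIV" "X = (\<Sum>\<^sub>\<infinity>p. - (q (snd p) * \<Phi> p))"
    using X2 summable_on_reindex_bij_betw[OF b3, of "\<lambda>p. - (q (fst p) * \<Phi> p)"]
      infsum_reindex_bij_betw[OF b3, of "\<lambda>p. - (q (fst p) * \<Phi> p)"]
    unfolding r3 by auto
  have "- X = - (\<Sum>\<^sub>\<infinity>p. q (fst p + snd p) * \<Phi> p)" using X1(2) by simp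
  also have "\<dots> = (\<Sum>\<^sub>\<infinity>p. - (q (fst p) * \<Phi> p) + - (q (snd p) * \<Phi> p))"
    unfolding infsum_uminus[symmetric] by (intro infsum_cong) (simp add: q_def algebra_simps)
  also have "\<dots> = X + X"
    unfolding infsum_add[OF X2(1) X3(1)] using X2(2) X3(2) by simp
  finally have "X = 0" by (simp add: algebra_simps)
  moreover have "(\<Sum>\<^sub>\<infinity>k. cnj (f k) * (of_int (fst k) * conv f f k)) = (\<Sum>\<^sub>\<infinity>k. u k * conv f f k)"
    by (intro infsum_cong) (simp add: u_def)
  ultimately show ?thesis using tri(4) by (simp add: X_def)
qed

section \<open>Bounds on the linear symbol\<close>

definition linear_symbol :: "real \<Rightarrow> real \<Rightarrow> real \<Rightarrow> int \<times> int \<Rightarrow> real" where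
  "linear_symbol \<epsilon> \<delta> \<beta> k = \<epsilon> * freq_norm k ^ 4 - \<delta> * freq_norm k ^ 3
     + (real_of_int (snd k))\<^sup>2 - (\<beta> - 1) * (real_of_int (fst k))\<^sup>2"

text \<open>Two completed squares: the cubic term costs a quarter of
  \<open>\<epsilon> * r ^ 4\<close> and a multiple of \<open>r^2\<close>, and all quadratic terms
  together, collected in \<open>A\<close>, cost another quarter and a constant. Half of the quartic
  term is left, and \<open>(bracket k)^2 \<le> 2 + 2 * r ^ 4\<close> converts it.\<close>

lemma linear_symbol_lower:
  assumes "0 < \<epsilon>"
  shows "\<exists>C\<ge>0. \<forall>k. \<epsilon> / 4 * (bracket k)\<^sup>2 - C \<le> linear_symbol \<epsilon> \<delta> \<beta> k"
proof -
  define A where "A = \<delta>\<^sup>2 / \<epsilon> + \<bar>\<beta> - 1\<bar>"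
  have A: "0 \<le> A" using assms by (simp add: A_def)
  have "\<epsilon> / 4 * (bracket k)\<^sup>2 - (\<epsilon> / 2 + A\<^sup>2 / \<epsilon>) \<le> linear_symbol \<epsilon> \<delta> \<beta> k" for k
  proof -
    define r where "r = freq_norm k"
    have r: "r\<^sup>2 = (real_of_int (fst k))\<^sup>2 + (real_of_int (snd k))\<^sup>2"
      by (simp add: r_def freq_norm_def)
    have 1: "\<delta> * r ^ 3 \<le> \<epsilon> / 4 * r ^ 4 + \<delta>\<^sup>2 / \<epsilon> * r\<^sup>2"
    proof -
      have "0 \<le> (\<epsilon> * r\<^sup>2 - 2 * \<delta> * r)\<^sup>2" by simp
      then have "4 * \<epsilon> * (\<delta> * r ^ 3) \<le> 4 * \<epsilon> * (\<epsilon> / 4 * r ^ 4 + \<delta>\<^sup>2 / \<epsilon> * r\<^sup>2)"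
        using assms by (simp add: power2_eq_square power3_eq_cube power4_eq_xxxx algebra_simps)
      then show ?thesis using assms by simp
    qed
    have 2: "(\<beta> - 1) * (real_of_int (fst k))\<^sup>2 \<le> \<bar>\<beta> - 1\<bar> * r\<^sup>2"
      unfolding r by (intro mult_mono) auto
    have 3: "A * r\<^sup>2 \<le> \<epsilon> / 4 * r ^ 4 + A\<^sup>2 / \<epsilon>"
    proof -
      have "0 \<le> (\<epsilon> * r\<^sup>2 - 2 * A)\<^sup>2" by simp
      then have "4 * \<epsilon> * (A * r\<^sup>2) \<le> 4 * \<epsilon> * (\<epsilon> / 4 * r ^ 4 + A\<^sup>2 / \<epsilon>)"
        using assms by (simp add: power2_eq_square power4_eq_xxxx algebra_simps)
      then show ?thesis using assms by simp
    qed
    have 4: "\<epsilon> / 4 * (bracket k)\<^sup>2 \<le> \<epsilon> / 2 + \<epsilon> / 2 * r ^ 4"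
    proof -
      have "0 \<le> (1 - r\<^sup>2)\<^sup>2" by simp
      then have "(bracket k)\<^sup>2 \<le> 2 + 2 * r ^ 4"
        by (simp add: bracket_def r_def[symmetric] power2_eq_square power4_eq_xxxx algebra_simps)
      then have "\<epsilon> / 4 * (bracket k)\<^sup>2 \<le> \<epsilon> / 4 * (2 + 2 * r ^ 4)"
        using assms by (intro mult_left_mono) auto
      then show ?thesis by (simp add: algebra_simps)
    qed
    have "0 \<le> (real_of_int (snd k))\<^sup>2" by simp
    moreover have "A * r\<^sup>2 = \<delta>\<^sup>2 / \<epsilon> * r\<^sup>2 + \<bar>\<beta> - 1\<bar> * r\<^sup>2" by (simp add: A_def algebra_simps)
    ultimately show ?thesis
      using 1 2 3 4 unfolding linear_symbol_def r_def[symmetric] by linarith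
  qed
  moreover have "0 \<le> \<epsilon> / 2 + A\<^sup>2 / \<epsilon>" using assms by simp
  ultimately show ?thesis by blast
qed

lemma linear_symbol_upper:
  "\<bar>linear_symbol \<epsilon> \<delta> \<beta> k\<bar> \<le> (\<bar>\<epsilon>\<bar> + \<bar>\<delta>\<bar> + 1 + \<bar>\<beta> - 1\<bar>) * (bracket k)\<^sup>2"
proof -
  define r where "r = freq_norm k"
  have r0: "0 \<le> r" by (simp add: r_def freq_norm_def)
  have r: "bracket k = 1 + r\<^sup>2" by (simp add: bracket_def r_def)
  have b: "bracket k \<le> (bracket k)\<^sup>2" using bracket_ge_1[of k] by (simp add: power2_eq_square)
  have 1: "r ^ 4 \<le> (bracket k)\<^sup>2"
  proof -
    have "r ^ 4 = (r\<^sup>2)\<^sup>2" by simp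
    also have "\<dots> \<le> (bracket k)\<^sup>2" unfolding r by (intro power_mono) auto
    finally show ?thesis .
  qed
  have 2: "r ^ 3 \<le> (bracket k)\<^sup>2"
  proof -
    have "0 \<le> (r - 1)\<^sup>2" by simp
    then have "2 * r \<le> bracket k" unfolding r by (simp add: power2_diff)
    then have "r \<le> bracket k" using r0 by linarith
    moreover have "r\<^sup>2 \<le> bracket k" by (simp add: r)
    ultimately have "r * r\<^sup>2 \<le> bracket k * bracket k" using r0 by (intro mult_mono) auto
    then show ?thesis by (simp add: power2_eq_square power3_eq_cube)
  qed
  have 3: "(real_of_int (snd k))\<^sup>2 \<le> (bracket k)\<^sup>2"
    using b bracket_eq[of k] zero_le_power2[of "real_of_int (fst k)"] by linarith
  have 4: "(real_of_int (fst k))\<^sup>2 \<le> (bracket k)\<^sup>2"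
    using b fst_le_bracket(1)[of k] by linarith
  have "\<bar>linear_symbol \<epsilon> \<delta> \<beta> k\<bar> \<le> \<bar>\<epsilon>\<bar> * r ^ 4 + \<bar>\<delta>\<bar> * r ^ 3 + 1 * (real_of_int (snd k))\<^sup>2
      + \<bar>\<beta> - 1\<bar> * (real_of_int (fst k))\<^sup>2"
  proof -
    have "\<bar>\<epsilon> * r ^ 4\<bar> = \<bar>\<epsilon>\<bar> * r ^ 4" "\<bar>\<delta> * r ^ 3\<bar> = \<bar>\<delta>\<bar> * r ^ 3"
      "\<bar>(\<beta> - 1) * (real_of_int (fst k))\<^sup>2\<bar> = \<bar>\<beta> - 1\<bar> * (real_of_int (fst k))\<^sup>2"
      using r0 by (auto simp: abs_mult)
    moreover have "0 \<le> (real_of_int (snd k))\<^sup>2" by simp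
    ultimately show ?thesis unfolding linear_symbol_def r_def[symmetric] by linarith
  qed
  also have "\<dots> \<le> \<bar>\<epsilon>\<bar> * (bracket k)\<^sup>2 + \<bar>\<delta>\<bar> * (bracket k)\<^sup>2 + 1 * (bracket k)\<^sup>2 + \<bar>\<beta> - 1\<bar> * (bracket k)\<^sup>2"
    by (intro add_mono mult_left_mono 1 2 3 4) auto
  finally show ?thesis by (simp add: algebra_simps)
qed

section \<open>Odd sequences against the Dirichlet kernel\<close>

lemma infsum_sum_finite:
  fixes f :: "'b \<Rightarrow> 'a \<Rightarrow> 'c::real_normed_vector"
  assumes "finite F" "\<And>m. m \<in> F \<Longrightarrow> f m summable_on A"
  shows "(\<lambda>x. \<Sum>m\<in>F. f m x) summable_on A"
    and "(\<Sum>\<^sub>\<infinity>x\<in>A. \<Sum>m\<in>F. f m x) = (\<Sum>m\<in>F. infsum (f m) A)"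
proof -
  have "(\<lambda>x. \<Sum>m\<in>F. f m x) summable_on A \<and>
      (\<Sum>\<^sub>\<infinity>x\<in>A. \<Sum>m\<in>F. f m x) = (\<Sum>m\<in>F. infsum (f m) A)"
    using assms
    by (induction F rule: finite_induct) (auto simp: infsum_add intro!: summable_on_add)
  then show "(\<lambda>x. \<Sum>m\<in>F. f m x) summable_on A"
    "(\<Sum>\<^sub>\<infinity>x\<in>A. \<Sum>m\<in>F. f m x) = (\<Sum>m\<in>F. infsum (f m) A)" by auto
qed

text \<open>The term at \<open>p = 0\<close> is \<open>1 / 0 = 0\<close>, so this is twice the sum
  over the positive integers.\<close>

definition inv_square_sum :: real where
  "inv_square_sum = (\<Sum>\<^sub>\<infinity>p. 1 / (real_of_int p)\<^sup>2)"

lemma inv_square_sum_nonneg: "0 \<le> inv_square_sum"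
  unfolding inv_square_sum_def by (rule infsum_nonneg) auto

text \<open>The sum over \<open>m\<close> pairs a Dirichlet kernel, an approximate point evaluation at \<open>0\<close>, with the
  squared modulus of the odd function with coefficients \<open>b\<close>, which vanishes there. Concretely, each window
  \<open>{p - 2N..p + 2N}\<close> with \<open>\<bar>p\<bar> \<le> N\<close> contains \<open>{-N..N}\<close>, over which \<open>b\<close> sums to \<open>0\<close>.\<close>

lemma dirichlet_odd:
  fixes b :: "int \<Rightarrow> complex"
  assumes odd: "\<And>p. b (- p) = - b p"
    and S: "(\<lambda>p. ((real_of_int p)\<^sup>2 * cmod (b p))\<^sup>2) summable_on UNIV"
    and N: "1 \<le> N"
  shows "cmod (\<Sum>m\<in>{- 2 * N..2 * N}. \<Sum>\<^sub>\<infinity>p. b p * cnj (b (p - m))) \<le>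
      inv_square_sum / real_of_int N * (\<Sum>\<^sub>\<infinity>p. ((real_of_int p)\<^sup>2 * cmod (b p))\<^sup>2)"
proof -
  have b0: "b 0 = 0" using odd[of 0] by simp
  have I: "(\<lambda>p. (1 / real_of_int p)\<^sup>2) summable_on UNIV"
    using summable_on_inverse_squares_int by (simp add: power_divide)
  have eq: "\<bar>(real_of_int p)\<^sup>2 * cmod (b p) * (1 / real_of_int p)\<bar> = \<bar>real_of_int p\<bar> * cmod (b p)" for p
    by (simp add: abs_mult power2_eq_square)
  \<comment> \<open>Of the two powers of \<open>p\<close> in the hypothesis one is spent, by
    Cauchy-Schwarz, on l^1 summability. The other remains inside \<open>s\<close> and pays for the
    factor \<open>1 / N\<close> at frequencies beyond \<open>N\<close>.\<close>
  define s where "s = (\<Sum>\<^sub>\<infinity>p. \<bar>real_of_int p\<bar> * cmod (b p))"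
  have s: "(\<lambda>p. \<bar>real_of_int p\<bar> * cmod (b p)) summable_on UNIV"
    using infsum_Cauchy_Schwarz(1)[OF S I] by (simp only: eq)
  have s_le: "s \<le> sqrt (\<Sum>\<^sub>\<infinity>p. ((real_of_int p)\<^sup>2 * cmod (b p))\<^sup>2) * sqrt inv_square_sum"
    using infsum_Cauchy_Schwarz(2)[OF S I] unfolding eq
    by (simp add: s_def inv_square_sum_def power_divide)
  have s0: "0 \<le> s" unfolding s_def by (rule infsum_nonneg) auto
  have b_le: "cmod (b p) \<le> \<bar>real_of_int p\<bar> * cmod (b p)" for p
  proof (cases "p = 0")
    case False
    then have "1 \<le> \<bar>real_of_int p\<bar>" by linarith
    then show ?thesis by (simp add: mult_le_cancel_right1)
  qed (simp add: b0)
  have fin: "(\<Sum>p\<in>F. \<bar>real_of_int p\<bar> * cmod (b p)) \<le> s" if "finite F" for F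
    unfolding s_def using s that by (intro finite_sum_le_infsum) auto
  have bs: "cmod (b p) \<le> s" for p
    using fin[of "{p}"] b_le[of p] by simp
  have sum_b: "(\<lambda>p. b p * cnj (b (p - m))) summable_on UNIV" for m
  proof (rule abs_summable_summable, rule summable_on_comparison_test)
    show "(\<lambda>p. (\<bar>real_of_int p\<bar> * cmod (b p)) * s) summable_on UNIV"
      using s by (rule summable_on_cmult_left)
    show "norm (b p * cnj (b (p - m))) \<le> (\<bar>real_of_int p\<bar> * cmod (b p)) * s" for p
      using b_le[of p] bs[of "p - m"] s0 by (auto simp: norm_mult intro!: mult_mono)
  qed auto
  define W where "W p = (\<Sum>m\<in>{- 2 * N..2 * N}. cnj (b (p - m)))" for p
  have W: "W p = (\<Sum>q\<in>{p - 2 * N..p + 2 * N}. cnj (b q))" for p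
    unfolding W_def by (rule sum.reindex_bij_witness[of _ "\<lambda>q. p - q" "\<lambda>m. p - m"]) auto
  have W_s: "cmod (W p) \<le> s" for p
  proof -
    have "cmod (W p) \<le> (\<Sum>q\<in>{p - 2 * N..p + 2 * N}. cmod (b q))"
      unfolding W by (rule order_trans[OF norm_sum]) simp
    also have "\<dots> \<le> (\<Sum>q\<in>{p - 2 * N..p + 2 * N}. \<bar>real_of_int q\<bar> * cmod (b q))"
      by (rule sum_mono) (rule b_le)
    also have "\<dots> \<le> s" by (rule fin) simp
    finally show ?thesis .
  qed
  have centre: "(\<Sum>q\<in>{- N..N}. cnj (b q)) = 0"
  proof -
    have "(\<Sum>q\<in>{- N..N}. cnj (b q)) = (\<Sum>q\<in>{- N..N}. cnj (b (- q)))"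
      by (rule sum.reindex_bij_witness[of _ uminus uminus]) auto
    also have "\<dots> = - (\<Sum>q\<in>{- N..N}. cnj (b q))" by (simp add: odd sum_negf)
    finally show ?thesis by simp
  qed
  have W_tail: "cmod (W p) \<le> s / N" if p: "\<bar>p\<bar> \<le> N" for p
  proof -
    have "W p = (\<Sum>q\<in>{p - 2 * N..p + 2 * N} - {- N..N}. cnj (b q)) + (\<Sum>q\<in>{- N..N}. cnj (b q))"
      unfolding W using p by (intro sum.subset_diff) auto
    then have "cmod (W p) \<le> (\<Sum>q\<in>{p - 2 * N..p + 2 * N} - {- N..N}. cmod (b q))"
      unfolding centre by (simp add: order_trans[OF norm_sum])
    also have "\<dots> \<le> (\<Sum>q\<in>{p - 2 * N..p + 2 * N} - {- N..N}. (\<bar>real_of_int q\<bar> * cmod (b q)) / N)"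
    proof (rule sum_mono)
      fix q assume "q \<in> {p - 2 * N..p + 2 * N} - {- N..N}"
      then have "N \<le> \<bar>q\<bar>" by auto
      then have "real_of_int N \<le> \<bar>real_of_int q\<bar>" by linarith
      then have "N * cmod (b q) \<le> \<bar>real_of_int q\<bar> * cmod (b q)" by (rule mult_right_mono) simp
      then show "cmod (b q) \<le> (\<bar>real_of_int q\<bar> * cmod (b q)) / N"
        using N by (simp add: field_simps)
    qed
    also have "\<dots> = (\<Sum>q\<in>{p - 2 * N..p + 2 * N} - {- N..N}. \<bar>real_of_int q\<bar> * cmod (b q)) / N"
      by (simp add: sum_divide_distrib)
    also have "\<dots> \<le> s / N" using N by (intro divide_right_mono fin) auto
    finally show ?thesis .
  qed
  \<comment> \<open>A factor \<open>1 / N\<close> is gained in both cases: for small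
    \<open>p\<close> the window sum \<open>W p\<close> is only a tail, because its central part
    cancels; for large \<open>p\<close> the coefficient \<open>b p\<close> itself lies in the
    tail.\<close>
  have term_le: "cmod (b p * W p) \<le> s / N * (\<bar>real_of_int p\<bar> * cmod (b p))" for p
  proof (cases "\<bar>p\<bar> \<le> N")
    case True
    have "cmod (b p) * cmod (W p) \<le> (\<bar>real_of_int p\<bar> * cmod (b p)) * (s / N)"
      using b_le[of p] W_tail[OF True] by (intro mult_mono) auto
    then show ?thesis by (simp add: norm_mult mult.commute)
  next
    case False
    then have "real_of_int N \<le> \<bar>real_of_int p\<bar>" by linarith
    then have "N * cmod (b p) \<le> \<bar>real_of_int p\<bar> * cmod (b p)" by (rule mult_right_mono) simp
    then have "cmod (b p) \<le> (\<bar>real_of_int p\<bar> * cmod (b p)) / N"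
      using N by (simp add: field_simps)
    then have "cmod (b p) * cmod (W p) \<le> ((\<bar>real_of_int p\<bar> * cmod (b p)) / N) * s"
      using W_s[of p] N by (intro mult_mono) auto
    then show ?thesis by (simp add: norm_mult field_simps)
  qed
  have major: "(\<lambda>p. s / N * (\<bar>real_of_int p\<bar> * cmod (b p))) summable_on UNIV"
    using s by (rule summable_on_cmult_right)
  have sumW: "(\<lambda>p. norm (b p * W p)) summable_on UNIV"
    by (rule summable_on_comparison_test[OF major]) (use term_le in auto)
  have "(\<Sum>m\<in>{- 2 * N..2 * N}. \<Sum>\<^sub>\<infinity>p. b p * cnj (b (p - m))) =
      (\<Sum>\<^sub>\<infinity>p. \<Sum>m\<in>{- 2 * N..2 * N}. b p * cnj (b (p - m)))"
    by (rule infsum_sum_finite(2)[symmetric]) (use sum_b in auto)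
  also have "\<dots> = (\<Sum>\<^sub>\<infinity>p. b p * W p)" by (simp add: W_def sum_distrib_left)
  finally have "cmod (\<Sum>m\<in>{- 2 * N..2 * N}. \<Sum>\<^sub>\<infinity>p. b p * cnj (b (p - m))) \<le> (\<Sum>\<^sub>\<infinity>p. norm (b p * W p))"
    using norm_infsum_bound[OF sumW] by simp
  also have "\<dots> \<le> (\<Sum>\<^sub>\<infinity>p. s / N * (\<bar>real_of_int p\<bar> * cmod (b p)))"
    using sumW major term_le by (rule infsum_mono)
  also have "\<dots> = s / N * s" unfolding infsum_cmult_right' by (simp only: s_def)
  also have "\<dots> = s\<^sup>2 / N" by (simp add: power2_eq_square)
  also have "\<dots> \<le> (inv_square_sum * (\<Sum>\<^sub>\<infinity>p. ((real_of_int p)\<^sup>2 * cmod (b p))\<^sup>2)) / N"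
  proof (rule divide_right_mono)
    have "0 \<le> (\<Sum>\<^sub>\<infinity>p. ((real_of_int p)\<^sup>2 * cmod (b p))\<^sup>2)"
      by (auto intro!: infsum_nonneg)
    with inv_square_sum_nonneg power_mono[OF s_le s0, of 2]
    show "s\<^sup>2 \<le> inv_square_sum * (\<Sum>\<^sub>\<infinity>p. ((real_of_int p)\<^sup>2 * cmod (b p))\<^sup>2)"
      by (simp add: power_mult_distrib mult.commute)
  qed (use N in auto)
  finally show "cmod (\<Sum>m\<in>{- 2 * N..2 * N}. \<Sum>\<^sub>\<infinity>p. b p * cnj (b (p - m))) \<le>
      inv_square_sum / real_of_int N * (\<Sum>\<^sub>\<infinity>p. ((real_of_int p)\<^sup>2 * cmod (b p))\<^sup>2)"
    by simp
qed

section \<open>Reflection in the first variable\<close>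

definition mirror :: "int \<times> int \<Rightarrow> int \<times> int" where
  "mirror k = (- fst k, snd k)"

lemma mirror_simps [simp]: "mirror (mirror k) = k" "fst (mirror k) = - fst k" "snd (mirror k) = snd k"
  by (simp_all add: mirror_def)

lemma mirror_diff: "mirror (k - j) = mirror k - mirror j"
  by (simp add: mirror_def)

lemma bij_mirror: "bij_betw mirror UNIV UNIV"
  by (rule bij_betw_byWitness[where f' = mirror]) auto

lemma freq_norm_mirror [simp]: "freq_norm (mirror k) = freq_norm k"
  by (simp add: freq_norm_def)

lemma bracket_mirror [simp]: "bracket (mirror k) = bracket k"
  by (simp add: bracket_def)

lemma h2_mirror:
  shows "h2 (\<lambda>k. f (mirror k)) \<longleftrightarrow> h2 f" and "h2_sq (\<lambda>k. f (mirror k)) = h2_sq f"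
  using summable_on_reindex_bij_betw[OF bij_mirror, of "\<lambda>k. (bracket k)\<^sup>2 * (cmod (f k))\<^sup>2"]
    infsum_reindex_bij_betw[OF bij_mirror, of "\<lambda>k. (bracket k)\<^sup>2 * (cmod (f k))\<^sup>2"]
  by (simp_all add: h2_def h2_sq_def)

lemma norm_add_sq_le: "(norm (x + y))\<^sup>2 \<le> 2 * (norm x)\<^sup>2 + 2 * (norm y)\<^sup>2"
  for x y :: "'a::real_normed_vector"
proof -
  have "(norm (x + y))\<^sup>2 \<le> (norm x + norm y)\<^sup>2"
    by (intro power_mono norm_triangle_ineq) auto
  also have "\<dots> \<le> 2 * (norm x)\<^sup>2 + 2 * (norm y)\<^sup>2"
    using sum_squares_bound[of "norm x" "norm y"] by (simp add: power2_sum)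
  finally show ?thesis .
qed

lemma h2_add:
  assumes f: "h2 f" and g: "h2 g"
  shows "h2 (\<lambda>k. f k + g k)" and "h2_sq (\<lambda>k. f k + g k) \<le> 2 * h2_sq f + 2 * h2_sq g"
proof -
  define F where "F k = 2 * ((bracket k)\<^sup>2 * (cmod (f k))\<^sup>2) + 2 * ((bracket k)\<^sup>2 * (cmod (g k))\<^sup>2)" for k
  have F: "F summable_on UNIV"
    unfolding F_def using f g by (intro summable_on_add summable_on_cmult_right) (auto simp: h2_def)
  have le: "(bracket k)\<^sup>2 * (cmod (f k + g k))\<^sup>2 \<le> F k" for k
    using mult_left_mono[OF norm_add_sq_le[of "f k" "g k"], of "(bracket k)\<^sup>2"]
    by (simp add: F_def algebra_simps)
  show s: "h2 (\<lambda>k. f k + g k)"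
    unfolding h2_def by (rule summable_on_comparison_test[OF F]) (use le in auto)
  have "h2_sq (\<lambda>k. f k + g k) \<le> infsum F UNIV"
    unfolding h2_sq_def using s[unfolded h2_def] F le by (rule infsum_mono)
  also have "\<dots> = 2 * h2_sq f + 2 * h2_sq g"
    unfolding F_def h2_sq_def using f g unfolding h2_def
    by (subst infsum_add) (auto simp: infsum_cmult_right' intro!: summable_on_cmult_right)
  finally show "h2_sq (\<lambda>k. f k + g k) \<le> 2 * h2_sq f + 2 * h2_sq g" .
qed

lemma h2_uminus [simp]: "h2 (\<lambda>k. - f k) = h2 f" "h2_sq (\<lambda>k. - f k) = h2_sq f"
  by (simp_all add: h2_def h2_sq_def)

lemma h2_diff:
  assumes f: "h2 f" and g: "h2 g"
  shows "h2 (\<lambda>k. f k - g k)" and "h2_sq (\<lambda>k. f k - g k) \<le> 2 * h2_sq f + 2 * h2_sq g"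
  using h2_add[OF f, of "\<lambda>k. - g k"] g by simp_all

lemma conv_commute: "conv f g k = conv g f k"
  unfolding conv_def
  using infsum_reindex_bij_betw[OF bij_reflect_at, of "\<lambda>j. f j * g (k - j)" k]
  by (simp add: mult.commute)

lemma conv_mirror: "conv f g (mirror k) = conv (\<lambda>j. f (mirror j)) (\<lambda>j. g (mirror j)) k"
  unfolding conv_def
  using infsum_reindex_bij_betw[OF bij_mirror, of "\<lambda>j. f j * g (mirror k - j)"]
  by (simp add: mirror_diff)

text \<open>The difference of two nonlinear terms is linear in either factor. Linearity in the sum
  gives persistence of oddness, where \<open>g\<close> is the mirror image of \<open>f\<close>;
  linearity in the difference gives continuity of the nonlinear term in time.\<close>

lemma conv_difference_of_squares:
  assumes f: "(\<lambda>k. (cmod (f k))\<^sup>2) summable_on UNIV" and g: "(\<lambda>k. (cmod (g k))\<^sup>2) summable_on UNIV"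
  shows "conv (\<lambda>k. f k - g k) (\<lambda>k. f k + g k) k = conv f f k - conv g g k"
proof -
  note ff = conv_bound(1)[OF f f, of k] and fg = conv_bound(1)[OF f g, of k]
    and gf = conv_bound(1)[OF g f, of k] and gg = conv_bound(1)[OF g g, of k]
  have "conv (\<lambda>k. f k - g k) (\<lambda>k. f k + g k) k =
      (\<Sum>\<^sub>\<infinity>j. ((f j * f (k - j) + f j * g (k - j)) + (- (g j * f (k - j)) + - (g j * g (k - j)))))"
    unfolding conv_def by (intro infsum_cong) (simp add: algebra_simps)
  also have "\<dots> = (conv f f k + conv f g k) + (- conv g f k + - conv g g k)"
    unfolding conv_def using ff fg gf gg
    by (intro infsumI has_sum_add has_sum_uminusI has_sum_infsum)
  finally show ?thesis using conv_commute[of f g k] by simp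
qed

text \<open>Integration in \<open>y\<close> decouples the rows of constant second frequency: by the
  reality condition \<open>conv f f (m, 0)\<close> is the sum over \<open>n\<close> of the
  autocorrelations at lag \<open>m\<close> of the rows \<open>b n\<close>. Each row is odd in the
  first frequency, so the one-dimensional estimate applies to it, and the weights
  \<open>p ^ 4\<close> of all rows together are controlled by \<open>h2_sq f\<close>.\<close>

lemma conv_dirichlet_odd:
  assumes f: "h2 f" and real: "\<And>k. f (- k) = cnj (f k)" and odd: "\<And>k. f (mirror k) = - f k"
    and N: "1 \<le> N"
  shows "cmod (\<Sum>m\<in>{- 2 * N..2 * N}. conv f f (m, 0)) \<le> inv_square_sum / real_of_int N * h2_sq f"
proof -
  define b where "b n p = f (p, n)" for n p
  have b_odd: "b n (- p) = - b n p" for n p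
    using odd[of "(p, n)"] by (simp add: b_def mirror_def)
  have b_real: "f ((m, 0) - (p, n)) = cnj (b n (p - m))" for m p n
    using real[of "(p - m, n)"] by (simp add: b_def)
  have swap: "bij_betw prod.swap UNIV (UNIV :: (int \<times> int) set)"
    by (rule bij_betw_byWitness[where f' = prod.swap]) auto
  define S where "S n = (\<Sum>\<^sub>\<infinity>p. ((real_of_int p)\<^sup>2 * cmod (b n p))\<^sup>2)" for n
  have m: "\<bar>(real_of_int (fst k))\<^sup>2\<bar> \<le> bracket k" for k using fst_le_bracket(1)[of k] by simp
  note w = h2_weighted[OF f m]
  have w': "(\<lambda>x. ((real_of_int (fst (prod.swap x)))\<^sup>2 * cmod (f (prod.swap x)))\<^sup>2) summable_on UNIV"
    using w(1) summable_on_reindex_bij_betw[OF swap, of "\<lambda>k. ((real_of_int (fst k))\<^sup>2 * cmod (f k))\<^sup>2"] by simp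
  have w2: "(\<lambda>(n, p). ((real_of_int p)\<^sup>2 * cmod (b n p))\<^sup>2) summable_on UNIV"
    by (rule back_subst[of "\<lambda>h. h summable_on UNIV", OF w']) (auto simp: b_def)
  have rows: "(\<lambda>p. ((real_of_int p)\<^sup>2 * cmod (b n p))\<^sup>2) summable_on UNIV" for n
    using w2 summable_on_SigmaD1[of "\<lambda>n p. ((real_of_int p)\<^sup>2 * cmod (b n p))\<^sup>2" UNIV "\<lambda>_. UNIV" n] by simp
  have S: "S summable_on UNIV"
    unfolding S_def using summable_on_Sigma_banach[of "\<lambda>n p. ((real_of_int p)\<^sup>2 * cmod (b n p))\<^sup>2" UNIV "\<lambda>_. UNIV"] w2
    by simp
  have S_le: "infsum S UNIV \<le> h2_sq f"
  proof -
    have "infsum S UNIV = (\<Sum>\<^sub>\<infinity>x. (\<lambda>(n, p). ((real_of_int p)\<^sup>2 * cmod (b n p))\<^sup>2) x)"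
      unfolding S_def using infsum_Sigma_banach[of "\<lambda>(n, p). ((real_of_int p)\<^sup>2 * cmod (b n p))\<^sup>2" UNIV "\<lambda>_. UNIV"] w2
      by simp
    also have "\<dots> = (\<Sum>\<^sub>\<infinity>x. ((real_of_int (fst (prod.swap x)))\<^sup>2 * cmod (f (prod.swap x)))\<^sup>2)"
      by (simp add: b_def case_prod_beta prod.swap_def)
    also have "\<dots> = (\<Sum>\<^sub>\<infinity>k. ((real_of_int (fst k))\<^sup>2 * cmod (f k))\<^sup>2)"
      by (rule infsum_reindex_bij_betw[OF swap, of "\<lambda>k. ((real_of_int (fst k))\<^sup>2 * cmod (f k))\<^sup>2"])
    also have "\<dots> \<le> h2_sq f" by (rule w(2))
    finally show ?thesis .
  qed
  define G where "G m n = (\<Sum>\<^sub>\<infinity>p. b n p * cnj (b n (p - m)))" for m n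
  have conv_G: "G m summable_on UNIV" "conv f f (m, 0) = infsum (G m) UNIV" for m
  proof -
    define H where "H = (\<lambda>j. f j * f ((m, 0) - j))"
    have H: "H summable_on UNIV"
      unfolding H_def by (rule conv_bound(1)) (rule h2_l2(1)[OF f])+
    have Hs: "H (prod.swap x) = (case x of (n, p) \<Rightarrow> b n p * cnj (b n (p - m)))" for x
      unfolding H_def by (cases x) (simp only: prod.swap_def fst_conv snd_conv b_real prod.case, simp add: b_def)
    have H': "(\<lambda>(n, p). b n p * cnj (b n (p - m))) summable_on UNIV \<times> UNIV"
      using H summable_on_reindex_bij_betw[OF swap, of H] unfolding Hs by simp
    show "G m summable_on UNIV"
      unfolding G_def using summable_on_Sigma_banach[OF H'] by simp
    have "conv f f (m, 0) = infsum H UNIV" by (simp add: conv_def H_def)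
    also have "\<dots> = (\<Sum>\<^sub>\<infinity>(n, p). b n p * cnj (b n (p - m)))"
      using infsum_reindex_bij_betw[OF swap, of H] unfolding Hs by simp
    also have "\<dots> = infsum (G m) UNIV"
      unfolding G_def using infsum_Sigma_banach[OF H'] by simp
    finally show "conv f f (m, 0) = infsum (G m) UNIV" .
  qed
  have le: "cmod (\<Sum>m\<in>{- 2 * N..2 * N}. G m n) \<le> inv_square_sum / real_of_int N * S n" for n
    unfolding G_def S_def by (rule dirichlet_odd[OF b_odd rows N])
  have major: "(\<lambda>n. inv_square_sum / real_of_int N * S n) summable_on UNIV"
    using S by (rule summable_on_cmult_right)
  have sG: "(\<lambda>n. norm (\<Sum>m\<in>{- 2 * N..2 * N}. G m n)) summable_on UNIV"
    by (rule summable_on_comparison_test[OF major]) (use le in auto)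
  have "(\<Sum>m\<in>{- 2 * N..2 * N}. conv f f (m, 0)) = (\<Sum>\<^sub>\<infinity>n. \<Sum>m\<in>{- 2 * N..2 * N}. G m n)"
    using infsum_sum_finite(2)[of "{- 2 * N..2 * N}" G UNIV] conv_G by simp
  then have "cmod (\<Sum>m\<in>{- 2 * N..2 * N}. conv f f (m, 0)) \<le> (\<Sum>\<^sub>\<infinity>n. norm (\<Sum>m\<in>{- 2 * N..2 * N}. G m n))"
    using norm_infsum_bound[OF sG] by simp
  also have "\<dots> \<le> (\<Sum>\<^sub>\<infinity>n. inv_square_sum / real_of_int N * S n)"
    using sG major le by (rule infsum_mono)
  also have "\<dots> = inv_square_sum / real_of_int N * infsum S UNIV"
    by (rule infsum_cmult_right')
  also have "\<dots> \<le> inv_square_sum / real_of_int N * h2_sq f"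
    using N S_le inv_square_sum_nonneg by (intro mult_left_mono) auto
  finally show ?thesis .
qed

section \<open>The flow of the Fourier coefficients\<close>

definition nonlin :: "(int \<times> int \<Rightarrow> complex) \<Rightarrow> int \<times> int \<Rightarrow> complex" where
  "nonlin f k = - (\<i> / 2) * (of_int (fst k) * conv f f k)"

definition flow_rhs :: "real \<Rightarrow> real \<Rightarrow> real \<Rightarrow> (int \<times> int \<Rightarrow> complex) \<Rightarrow> int \<times> int \<Rightarrow> complex" where
  "flow_rhs \<epsilon> \<delta> \<beta> f k = - of_real (linear_symbol \<epsilon> \<delta> \<beta> k) * f k + nonlin f k"

lemma cmod_dot_le: "2 * Re (cnj x * y) \<le> 2 * (cmod x * cmod y)" "\<bar>2 * Re (cnj x * y)\<bar> \<le> 2 * (cmod x * cmod y)"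
  using abs_Re_le_cmod[of "cnj x * y"] by (simp_all add: norm_mult)

lemma Re_linear_term: "2 * Re (cnj x * (- of_real s * x + n)) = - 2 * s * (cmod x)\<^sup>2 + 2 * Re (cnj x * n)"
proof -
  have "cnj x * (- of_real s * x + n) = - of_real s * (x * cnj x) + cnj x * n"
    by (simp add: algebra_simps)
  also have "x * cnj x = of_real ((cmod x)\<^sup>2)" by (rule complex_norm_square[symmetric])
  finally show ?thesis by simp
qed

text \<open>The forcing \<open>n\<close> is left open because two systems are treated: the solution
  itself, and its even part, whose forcing is bilinear in two different sequences. The upper bound
  on the symbol gives the absolute summability and the size bound demanded by
  \<open>energy_inequality\<close>; the lower bound gives the dissipation.\<close>

lemma forced_energy:
  fixes f n g :: "int \<times> int \<Rightarrow> complex"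
  assumes g_def: "\<And>k. g k = - of_real (linear_symbol \<epsilon> \<delta> \<beta> k) * f k + n k"
    and f: "h2 f" and n: "(\<lambda>k. cmod (f k) * cmod (n k)) summable_on UNIV"
    and lower: "\<And>k. c * (bracket k)\<^sup>2 - C \<le> linear_symbol \<epsilon> \<delta> \<beta> k"
    and upper: "\<And>k. \<bar>linear_symbol \<epsilon> \<delta> \<beta> k\<bar> \<le> U * (bracket k)\<^sup>2"
  shows "(\<lambda>k. cmod (f k) * cmod (g k)) summable_on UNIV"
    and "(\<Sum>\<^sub>\<infinity>k. cmod (f k) * cmod (g k)) \<le> U * h2_sq f + (\<Sum>\<^sub>\<infinity>k. cmod (f k) * cmod (n k))"
    and "(\<lambda>k. 2 * Re (cnj (f k) * g k)) summable_on UNIV"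
    and "(\<Sum>\<^sub>\<infinity>k. 2 * Re (cnj (f k) * g k)) \<le>
      - 2 * c * h2_sq f + 2 * C * l2_sq f + (\<Sum>\<^sub>\<infinity>k. 2 * Re (cnj (f k) * n k))"
proof -
  have f2: "(\<lambda>k. (bracket k)\<^sup>2 * (cmod (f k))\<^sup>2) summable_on UNIV" using f by (simp add: h2_def)
  note l2 = h2_l2(1)[OF f]
  have maj: "(\<lambda>k. U * ((bracket k)\<^sup>2 * (cmod (f k))\<^sup>2) + cmod (f k) * cmod (n k)) summable_on UNIV"
    using f2 n by (intro summable_on_add summable_on_cmult_right)
  have le: "cmod (f k) * cmod (g k) \<le> U * ((bracket k)\<^sup>2 * (cmod (f k))\<^sup>2) + cmod (f k) * cmod (n k)" for k
  proof -
    have "cmod (g k) \<le> cmod (- of_real (linear_symbol \<epsilon> \<delta> \<beta> k) * f k) + cmod (n k)"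
      unfolding g_def by (rule norm_triangle_ineq)
    also have "\<dots> \<le> U * (bracket k)\<^sup>2 * cmod (f k) + cmod (n k)"
      using upper[of k] by (auto simp: norm_mult intro!: mult_right_mono)
    finally have "cmod (f k) * cmod (g k) \<le> cmod (f k) * (U * (bracket k)\<^sup>2 * cmod (f k) + cmod (n k))"
      by (rule mult_left_mono) simp
    then show ?thesis by (simp add: algebra_simps power2_eq_square)
  qed
  show s: "(\<lambda>k. cmod (f k) * cmod (g k)) summable_on UNIV"
    by (rule summable_on_comparison_test[OF maj]) (use le in auto)
  have "(\<Sum>\<^sub>\<infinity>k. cmod (f k) * cmod (g k)) \<le>
      (\<Sum>\<^sub>\<infinity>k. U * ((bracket k)\<^sup>2 * (cmod (f k))\<^sup>2) + cmod (f k) * cmod (n k))"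
    using s maj le by (rule infsum_mono)
  also have "\<dots> = U * h2_sq f + (\<Sum>\<^sub>\<infinity>k. cmod (f k) * cmod (n k))"
    using f2 n by (subst infsum_add) (auto simp: h2_sq_def infsum_cmult_right' intro: summable_on_cmult_right)
  finally show "(\<Sum>\<^sub>\<infinity>k. cmod (f k) * cmod (g k)) \<le> U * h2_sq f + (\<Sum>\<^sub>\<infinity>k. cmod (f k) * cmod (n k))" .
  have Re_sum: "(\<lambda>k. 2 * Re (cnj (f k) * h k)) summable_on UNIV"
    if "(\<lambda>k. cmod (f k) * cmod (h k)) summable_on UNIV" for h
  proof (rule abs_summable_summable, rule summable_on_comparison_test[OF summable_on_cmult_right[OF that, of 2]])
    show "norm (2 * Re (cnj (f k) * h k)) \<le> 2 * (cmod (f k) * cmod (h k))" for k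
      using cmod_dot_le(2)[of "f k" "h k"] by simp
  qed auto
  show sg: "(\<lambda>k. 2 * Re (cnj (f k) * g k)) summable_on UNIV" by (rule Re_sum[OF s])
  have sn: "(\<lambda>k. 2 * Re (cnj (f k) * n k)) summable_on UNIV" by (rule Re_sum[OF n])
  have hs: "((\<lambda>k. - 2 * c * ((bracket k)\<^sup>2 * (cmod (f k))\<^sup>2) + 2 * C * (cmod (f k))\<^sup>2 + 2 * Re (cnj (f k) * n k))
      has_sum (- 2 * c * h2_sq f + 2 * C * l2_sq f + (\<Sum>\<^sub>\<infinity>k. 2 * Re (cnj (f k) * n k)))) UNIV"
    unfolding h2_sq_def l2_sq_def
    by (intro has_sum_add has_sum_cmult_right has_sum_infsum f2 l2 sn)
  have le: "2 * Re (cnj (f k) * g k) \<le>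
      - 2 * c * ((bracket k)\<^sup>2 * (cmod (f k))\<^sup>2) + 2 * C * (cmod (f k))\<^sup>2 + 2 * Re (cnj (f k) * n k)" for k
  proof -
    have "2 * Re (cnj (f k) * g k) = - 2 * linear_symbol \<epsilon> \<delta> \<beta> k * (cmod (f k))\<^sup>2 + 2 * Re (cnj (f k) * n k)"
      unfolding g_def by (rule Re_linear_term)
    moreover have "(c * (bracket k)\<^sup>2 - C) * (cmod (f k))\<^sup>2 \<le> linear_symbol \<epsilon> \<delta> \<beta> k * (cmod (f k))\<^sup>2"
      by (intro mult_right_mono lower) simp
    ultimately show ?thesis by (simp add: algebra_simps)
  qed
  show "(\<Sum>\<^sub>\<infinity>k. 2 * Re (cnj (f k) * g k)) \<le>
      - 2 * c * h2_sq f + 2 * C * l2_sq f + (\<Sum>\<^sub>\<infinity>k. 2 * Re (cnj (f k) * n k))"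
    by (rule has_sum_mono[OF has_sum_infsum[OF sg] hs]) (rule le)
qed

text \<open>What the estimates need to know about a solution. Boundedness on compact time intervals
  is qualitative only: it provides dominating constants and never enters the radius of the absorbing
  ball.\<close>

locale fourier_flow =
  fixes \<epsilon> \<delta> \<beta> :: real and a :: "real \<Rightarrow> int \<times> int \<Rightarrow> complex"
  assumes eps: "0 < \<epsilon>"
    and h2: "\<And>t. 0 \<le> t \<Longrightarrow> h2 (a t)"
    and bounded: "\<And>T. 0 \<le> T \<Longrightarrow> \<exists>B. \<forall>t\<in>{0..T}. h2_sq (a t) \<le> B"
    and real: "\<And>t k. 0 \<le> t \<Longrightarrow> a t (- k) = cnj (a t k)"
    and ode: "\<And>t k. 0 \<le> t \<Longrightarrow>
      ((\<lambda>s. a s k) has_vector_derivative flow_rhs \<epsilon> \<delta> \<beta> (a t) k) (at t within {0..})"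
    and odd_initial: "\<And>k. a 0 (mirror k) = - a 0 k"
begin

lemma ode_on: "S \<subseteq> {0..} \<Longrightarrow> t \<in> S \<Longrightarrow>
    ((\<lambda>s. a s k) has_vector_derivative flow_rhs \<epsilon> \<delta> \<beta> (a t) k) (at t within S)"
  using ode[of t k] by (auto intro: has_vector_derivative_within_subset)

lemma nonlin_summable:
  assumes "0 \<le> t"
  shows "(\<lambda>k. cmod (a t k) * cmod (nonlin (a t) k)) summable_on UNIV"
    and "(\<Sum>\<^sub>\<infinity>k. cmod (a t k) * cmod (nonlin (a t) k)) \<le> sqrt (h2_sq (a t)) * sqrt inv_bracket_sum * h2_sq (a t)"
proof -
  note f = h2[OF assms]
  have eq: "cmod (a t k) * cmod (nonlin (a t) k) = 1 / 2 * (cmod (of_int (fst k) * a t k) * cmod (conv (a t) (a t) k))" for k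
    by (simp add: nonlin_def norm_mult norm_divide)
  note tri = trilinear_conv[OF h2_l1(1)[OF f] h2_fst(1)[OF f] h2_l2(1)[OF f] zero_less_one]
  show "(\<lambda>k. cmod (a t k) * cmod (nonlin (a t) k)) summable_on UNIV"
    unfolding eq by (intro summable_on_cmult_right tri(2))
  have "(\<Sum>\<^sub>\<infinity>k. cmod (a t k) * cmod (nonlin (a t) k)) =
      1 / 2 * (\<Sum>\<^sub>\<infinity>k. cmod (of_int (fst k) * a t k) * cmod (conv (a t) (a t) k))"
    unfolding eq by (rule infsum_cmult_right')
  also have "\<dots> \<le> 1 / 2 * ((\<Sum>\<^sub>\<infinity>k. cmod (a t k)) * (1 * l2_sq (\<lambda>k. of_int (fst k) * a t k) + l2_sq (a t) / (4 * 1)))"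
    by (intro mult_left_mono tri(3)) simp
  also have "\<dots> \<le> 1 / 2 * ((sqrt (h2_sq (a t)) * sqrt inv_bracket_sum) * (2 * h2_sq (a t)))"
    using h2_l1(2)[OF f] h2_fst(2)[OF f] h2_l2(2)[OF f] l2_sq_nonneg[of "a t"] l2_sq_nonneg[of "\<lambda>k. of_int (fst k) * a t k"]
      h2_sq_nonneg[of "a t"]
    by (intro mult_left_mono mult_mono) (auto intro!: infsum_nonneg mult_nonneg_nonneg simp: inv_bracket_sum_nonneg)
  finally show "(\<Sum>\<^sub>\<infinity>k. cmod (a t k) * cmod (nonlin (a t) k)) \<le> sqrt (h2_sq (a t)) * sqrt inv_bracket_sum * h2_sq (a t)"
    by simp
qed

lemma nonlin_energy_zero:
  assumes "0 \<le> t"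
  shows "(\<Sum>\<^sub>\<infinity>k. 2 * Re (cnj (a t k) * nonlin (a t) k)) = 0"
proof -
  define h where "h k = cnj (a t k) * (of_int (fst k) * conv (a t) (a t) k)" for k
  have "(\<lambda>k. cmod (of_int (fst k) * a t k) * cmod (conv (a t) (a t) k)) summable_on UNIV"
    using h2[OF assms] by (intro trilinear_conv(2)[OF _ _ _ zero_less_one] h2_l1 h2_fst h2_l2)
  then have "(\<lambda>k. norm (h k)) summable_on UNIV"
    by (simp add: h_def norm_mult mult.commute mult.left_commute)
  then have h: "h summable_on UNIV" by (rule abs_summable_summable)
  have h0: "infsum h UNIV = 0"
    unfolding h_def using conv_cancel[OF h2[OF assms] real[OF assms]] .
  have "2 * Re (cnj (a t k) * nonlin (a t) k) = Im (h k)" for k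
  proof -
    have "cnj (a t k) * nonlin (a t) k = - (\<i> / 2) * h k" by (simp add: h_def nonlin_def)
    then show ?thesis by simp
  qed
  then show ?thesis using infsum_Im[OF h] h0 by simp
qed

text \<open>Reflection changes the sign of \<open>fst k\<close>, so adding the equations of
  \<open>a\<close> and of its mirror image turns the nonlinear terms into a difference, which
  factors as \<open>conv (s t) (w t)\<close>. The even part \<open>w\<close> thus solves a linear
  equation whose coefficient \<open>s\<close> is bounded in l^1 on \<open>{0..T}\<close>, and it
  starts at zero.\<close>

lemma odd_persists:
  assumes "0 \<le> T"
  shows "a T (mirror k) = - a T k"
proof -
  define w where "w t k = a t k + a t (mirror k)" for t k
  define s where "s t k = a t k - a t (mirror k)" for t k
  define n where "n t k = - (\<i> / 2) * (of_int (fst k) * conv (s t) (w t) k)" for t k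
  define g where "g t k = - of_real (linear_symbol \<epsilon> \<delta> \<beta> k) * w t k + n t k" for t k
  obtain B where B: "\<And>t. t \<in> {0..T} \<Longrightarrow> h2_sq (a t) \<le> B" using bounded[OF assms] by blast
  obtain C where C: "0 \<le> C" "\<And>k. \<epsilon> / 4 * (bracket k)\<^sup>2 - C \<le> linear_symbol \<epsilon> \<delta> \<beta> k"
    using linear_symbol_lower[OF eps] by blast
  define U where "U = \<bar>\<epsilon>\<bar> + \<bar>\<delta>\<bar> + 1 + \<bar>\<beta> - 1\<bar>"
  have U: "\<bar>linear_symbol \<epsilon> \<delta> \<beta> k\<bar> \<le> U * (bracket k)\<^sup>2" for k
    unfolding U_def by (rule linear_symbol_upper)
  have U0: "0 \<le> U" by (simp add: U_def)
  have hm: "h2 (\<lambda>k. a t (mirror k))" "h2_sq (\<lambda>k. a t (mirror k)) = h2_sq (a t)" if "0 \<le> t" for t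
    using h2[OF that] h2_mirror[of "a t"] by auto
  have hw: "h2 (w t)" and hs: "h2 (s t)" if "0 \<le> t" for t
    unfolding w_def s_def using h2_add(1) h2_diff(1) h2[OF that] hm(1)[OF that] by blast+
  have wB: "h2_sq (w t) \<le> 4 * B" and sB: "h2_sq (s t) \<le> 4 * B" if "t \<in> {0..T}" for t
    unfolding w_def s_def
    using h2_add(2)[OF h2 hm(1), of t t] h2_diff(2)[OF h2 hm(1), of t t] hm(2)[of t] B[OF that] that by auto
  define S where "S = sqrt (4 * B) * sqrt inv_bracket_sum"
  have S: "(\<Sum>\<^sub>\<infinity>k. cmod (s t k)) \<le> S" if "t \<in> {0..T}" for t
  proof -
    have "(\<Sum>\<^sub>\<infinity>k. cmod (s t k)) \<le> sqrt (h2_sq (s t)) * sqrt inv_bracket_sum"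
      by (rule h2_l1(2)[OF hs]) (use that in auto)
    also have "\<dots> \<le> S"
      unfolding S_def using sB[OF that] by (intro mult_right_mono) (auto simp: inv_bracket_sum_nonneg)
    finally show ?thesis .
  qed
  have S0: "0 \<le> S"
    using S[of 0] assms infsum_nonneg[of UNIV "\<lambda>k. cmod (s 0 k)"] by force
  \<comment> \<open>Small enough that the part of the forcing carrying a derivative of
    \<open>w\<close> stays below the dissipation \<open>\<epsilon> / 2 * h2_sq (w t)\<close>; the
    \<open>+ 1\<close> guards against \<open>S = 0\<close>.\<close>
  define \<theta> where "\<theta> = (\<epsilon> / 2) / (S + 1)"
  have \<theta>: "0 < \<theta>" "S * \<theta> \<le> \<epsilon> / 2"
    using eps S0 by (auto simp: \<theta>_def field_simps)
  have n_eq: "2 * (cmod (w t k) * cmod (n t k)) = cmod (of_int (fst k) * w t k) * cmod (conv (s t) (w t) k)" for t k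
    by (simp add: n_def norm_mult norm_divide)
  have tri_s: "(\<lambda>k. cmod (of_int (fst k) * w t k) * cmod (conv (s t) (w t) k)) summable_on UNIV"
    and tri_le: "(\<Sum>\<^sub>\<infinity>k. cmod (of_int (fst k) * w t k) * cmod (conv (s t) (w t) k)) \<le>
      S * (\<theta> * h2_sq (w t) + l2_sq (w t) / (4 * \<theta>))"
    if t: "t \<in> {0..T}" for t
  proof -
    have t0: "0 \<le> t" using t by simp
    note tri = trilinear_conv[OF h2_l1(1)[OF hs[OF t0]] h2_fst(1)[OF hw[OF t0]] h2_l2(1)[OF hw[OF t0]] \<theta>(1)]
    show "(\<lambda>k. cmod (of_int (fst k) * w t k) * cmod (conv (s t) (w t) k)) summable_on UNIV" by (rule tri(2))
    note tri(3)
    also have "(\<Sum>\<^sub>\<infinity>k. cmod (s t k)) * (\<theta> * l2_sq (\<lambda>k. of_int (fst k) * w t k) + l2_sq (w t) / (4 * \<theta>))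
        \<le> S * (\<theta> * h2_sq (w t) + l2_sq (w t) / (4 * \<theta>))"
      using S[OF t] S0 \<theta>(1) h2_fst(2)[OF hw[OF t0]] l2_sq_nonneg
      by (intro mult_mono add_mono mult_left_mono add_nonneg_nonneg mult_nonneg_nonneg divide_nonneg_nonneg) auto
    finally show "(\<Sum>\<^sub>\<infinity>k. cmod (of_int (fst k) * w t k) * cmod (conv (s t) (w t) k)) \<le>
      S * (\<theta> * h2_sq (w t) + l2_sq (w t) / (4 * \<theta>))" .
  qed
  have n_s: "(\<lambda>k. cmod (w t k) * cmod (n t k)) summable_on UNIV"
    and n_le: "2 * (\<Sum>\<^sub>\<infinity>k. cmod (w t k) * cmod (n t k)) \<le> S * (\<theta> * h2_sq (w t) + l2_sq (w t) / (4 * \<theta>))"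
    if t: "t \<in> {0..T}" for t
  proof -
    have "(\<lambda>k. 1 / 2 * (2 * (cmod (w t k) * cmod (n t k)))) summable_on UNIV"
      unfolding n_eq by (intro summable_on_cmult_right tri_s t)
    then show "(\<lambda>k. cmod (w t k) * cmod (n t k)) summable_on UNIV" by simp
    show "2 * (\<Sum>\<^sub>\<infinity>k. cmod (w t k) * cmod (n t k)) \<le> S * (\<theta> * h2_sq (w t) + l2_sq (w t) / (4 * \<theta>))"
      unfolding infsum_cmult_right'[symmetric] n_eq by (rule tri_le[OF t])
  qed
  note fe = forced_energy[OF g_def hw n_s C(2) U]
  \<comment> \<open>Minus the largest possible growth rate: \<open>2 * C\<close> from unstable modes
    and \<open>S / (4 * \<theta>)\<close> from the part of the forcing without derivatives. The
    extra \<open>1\<close> keeps \<open>c\<close> away from zero.\<close>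
  define c where "c = - (2 * C + S / (4 * \<theta>) + 1)"
  have c0: "c \<noteq> 0"
  proof -
    have "0 \<le> S / (4 * \<theta>)" using S0 \<theta>(1) by simp
    then show ?thesis using C(1) unfolding c_def by linarith
  qed
  define B' where "B' = 4 * B + U * (4 * B) + S * (\<theta> * (4 * B) + 4 * B / (4 * \<theta>))"
  have B0: "0 \<le> B" using B[of 0] assms h2_sq_nonneg[of "a 0"] by force
  have "exp (c * T) * (\<Sum>\<^sub>\<infinity>k. (cmod (w T k))\<^sup>2) - (\<Sum>\<^sub>\<infinity>k. (cmod (w 0 k))\<^sup>2) \<le> 0 / c * (exp (c * T) - 1)"
  proof (rule energy_inequality[where v = "\<lambda>k t. w t k" and g = "\<lambda>k t. g t k" and B = B', OF assms])
    fix t assume t: "t \<in> {0..T}"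
    then have t0: "0 \<le> t" by simp
    show "((\<lambda>t. w t k) has_vector_derivative g t k) (at t within {0..T})" for k
    proof -
      have "((\<lambda>t. w t k) has_vector_derivative
          flow_rhs \<epsilon> \<delta> \<beta> (a t) k + flow_rhs \<epsilon> \<delta> \<beta> (a t) (mirror k)) (at t within {0..T})"
        unfolding w_def using t by (intro has_vector_derivative_add ode_on) auto
      also have "flow_rhs \<epsilon> \<delta> \<beta> (a t) k + flow_rhs \<epsilon> \<delta> \<beta> (a t) (mirror k) = g t k"
      proof -
        have sym: "linear_symbol \<epsilon> \<delta> \<beta> (mirror k) = linear_symbol \<epsilon> \<delta> \<beta> k"
          by (simp add: linear_symbol_def)
        have "conv (s t) (w t) k = conv (a t) (a t) k - conv (a t) (a t) (mirror k)"
          unfolding s_def w_def conv_mirror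
          by (intro conv_difference_of_squares h2_l2(1) h2 hm t0)
        then have mir: "conv (a t) (a t) (mirror k) = conv (a t) (a t) k - conv (s t) (w t) k" by simp
        show ?thesis
          by (simp only: flow_rhs_def nonlin_def g_def n_def mirror_simps sym mir)
            (simp add: w_def algebra_simps)
      qed
      finally show ?thesis .
    qed
    show "(\<lambda>k. (cmod (w t k))\<^sup>2) summable_on UNIV" by (rule h2_l2(1)[OF hw[OF t0]])
    have l2B: "l2_sq (w t) \<le> 4 * B" using h2_l2(2)[OF hw[OF t0]] wB[OF t] by linarith
    have n_B: "0 \<le> S * (\<theta> * (4 * B) + 4 * B / (4 * \<theta>))"
      using S0 \<theta>(1) B0 by simp
    show "(\<Sum>\<^sub>\<infinity>k. (cmod (w t k))\<^sup>2) \<le> B'"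
      using l2B n_B U0 B0 mult_nonneg_nonneg[of U "4 * B"] unfolding l2_sq_def[symmetric] B'_def by linarith
    show "(\<lambda>k. cmod (w t k) * cmod (g t k)) summable_on UNIV" by (rule fe(1)[OF t0 t])
    have "U * h2_sq (w t) \<le> U * (4 * B)" using U0 wB[OF t] by (rule mult_left_mono[rotated])
    moreover have "S * (\<theta> * h2_sq (w t) + l2_sq (w t) / (4 * \<theta>)) \<le> S * (\<theta> * (4 * B) + 4 * B / (4 * \<theta>))"
      using S0 \<theta>(1) wB[OF t] l2B by (intro mult_left_mono add_mono divide_right_mono) auto
    moreover have "0 \<le> (\<Sum>\<^sub>\<infinity>k. cmod (w t k) * cmod (n t k))" by (rule infsum_nonneg) auto
    ultimately show "(\<Sum>\<^sub>\<infinity>k. cmod (w t k) * cmod (g t k)) \<le> B'"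
      using fe(2)[OF t0 t] n_le[OF t] B0 unfolding B'_def by linarith
    have "(\<Sum>\<^sub>\<infinity>k. 2 * Re (cnj (w t k) * n t k)) \<le> (\<Sum>\<^sub>\<infinity>k. 2 * (cmod (w t k) * cmod (n t k)))"
    proof (rule infsum_mono)
      show maj: "(\<lambda>k. 2 * (cmod (w t k) * cmod (n t k))) summable_on UNIV"
        using n_s[OF t] by (rule summable_on_cmult_right)
      show "(\<lambda>k. 2 * Re (cnj (w t k) * n t k)) summable_on UNIV"
        by (rule abs_summable_summable, rule summable_on_comparison_test[OF maj])
          (use cmod_dot_le(2) in auto)
    qed (rule cmod_dot_le(1))
    also have "\<dots> \<le> S * (\<theta> * h2_sq (w t) + l2_sq (w t) / (4 * \<theta>))"
      using n_le[OF t] by (simp add: infsum_cmult_right')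
    also have "\<dots> = (S * \<theta>) * h2_sq (w t) + (S / (4 * \<theta>)) * l2_sq (w t)" by (simp add: algebra_simps)
    also have "\<dots> \<le> \<epsilon> / 2 * h2_sq (w t) + (S / (4 * \<theta>)) * l2_sq (w t)"
      using \<theta>(2) h2_sq_nonneg[of "w t"] by (intro add_right_mono mult_right_mono) auto
    finally have "(\<Sum>\<^sub>\<infinity>k. 2 * Re (cnj (w t k) * g t k)) \<le> 2 * C * l2_sq (w t) + (S / (4 * \<theta>)) * l2_sq (w t)"
      using fe(4)[OF t0 t] by (simp add: algebra_simps)
    moreover have "c * l2_sq (w t) = - (2 * C * l2_sq (w t)) - (S / (4 * \<theta>)) * l2_sq (w t) - l2_sq (w t)"
      by (simp add: c_def algebra_simps)
    ultimately show "c * (\<Sum>\<^sub>\<infinity>k. (cmod (w t k))\<^sup>2) + (\<Sum>\<^sub>\<infinity>k. 2 * Re (cnj (w t k) * g t k)) \<le> 0"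
      using l2_sq_nonneg[of "w t"] unfolding l2_sq_def[symmetric] by linarith
  qed (rule c0)
  moreover have "w 0 k = 0" for k by (simp add: w_def odd_initial)
  ultimately have "exp (c * T) * (\<Sum>\<^sub>\<infinity>k. (cmod (w T k))\<^sup>2) \<le> 0" by simp
  then have "(\<Sum>\<^sub>\<infinity>k. (cmod (w T k))\<^sup>2) \<le> 0" by (simp add: mult_le_0_iff not_le)
  then have "(cmod (w T k))\<^sup>2 = 0"
    by (rule nonneg_infsum_le_0D) (use h2_l2(1)[OF hw[OF assms]] in auto)
  then show ?thesis by (simp add: w_def add_eq_0_iff)
qed

end

section \<open>The background profile\<close>

text \<open>The Fourier coefficients of the background profile, a function of the first variable whose derivative
  is \<open>M\<close> minus \<open>M\<close> times the Dirichlet kernel of order \<open>2N\<close>.\<close>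

definition profile :: "real \<Rightarrow> int \<Rightarrow> int \<times> int \<Rightarrow> complex" where
  "profile M N k = (if snd k = 0 \<and> fst k \<in> {- 2 * N..2 * N} - {0} then \<i> * of_real M / of_int (fst k) else 0)"

text \<open>The profile has finite support, so sums against it are finite. A general
  \<open>h\<close> with \<open>h 0 k = 0\<close> covers its norm and its pairings with the flow at
  once.\<close>

lemma infsum_profile:
  fixes h :: "complex \<Rightarrow> int \<times> int \<Rightarrow> 'a::{comm_monoid_add, t2_space}"
  assumes "\<And>k. h 0 k = 0"
  shows "(\<lambda>k. h (profile M N k) k) summable_on UNIV"
    and "(\<Sum>\<^sub>\<infinity>k. h (profile M N k) k) = (\<Sum>m\<in>{- 2 * N..2 * N} - {0}. h (\<i> * of_real M / of_int m) (m, 0))"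
proof -
  define F where "F = (\<lambda>m. (m, 0 :: int)) ` ({- 2 * N..2 * N} - {0})"
  have z: "h (profile M N k) k = 0" if "k \<notin> F" for k
  proof -
    have "profile M N k = 0"
      using that by (cases k) (auto simp: profile_def F_def)
    then show ?thesis by (simp add: assms)
  qed
  have "finite F" by (simp add: F_def)
  show "(\<lambda>k. h (profile M N k) k) summable_on UNIV"
    by (rule summable_on_cong_neutral[THEN iffD1, of UNIV F "\<lambda>k. h (profile M N k) k"])
      (use z \<open>finite F\<close> in auto)
  have "(\<Sum>\<^sub>\<infinity>k. h (profile M N k) k) = (\<Sum>\<^sub>\<infinity>k\<in>F. h (profile M N k) k)"
    by (rule infsum_cong_neutral) (use z in auto)
  also have "\<dots> = (\<Sum>k\<in>F. h (profile M N k) k)" using \<open>finite F\<close> by simp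
  also have "\<dots> = (\<Sum>m\<in>{- 2 * N..2 * N} - {0}. h (profile M N (m, 0)) (m, 0))"
    unfolding F_def by (subst sum.reindex) (auto simp: inj_on_def)
  also have "\<dots> = (\<Sum>m\<in>{- 2 * N..2 * N} - {0}. h (\<i> * of_real M / of_int m) (m, 0))"
    by (intro sum.cong) (auto simp: profile_def)
  finally show "(\<Sum>\<^sub>\<infinity>k. h (profile M N k) k) = (\<Sum>m\<in>{- 2 * N..2 * N} - {0}. h (\<i> * of_real M / of_int m) (m, 0))" .
qed

lemma conv_zero_eq_l2_sq:
  assumes "\<And>k. f (- k) = cnj (f k)" "(\<lambda>k. (cmod (f k))\<^sup>2) summable_on UNIV"
  shows "conv f f 0 = of_real (l2_sq f)"
proof -
  have "conv f f 0 = (\<Sum>\<^sub>\<infinity>k. of_real ((cmod (f k))\<^sup>2))"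
    unfolding conv_def by (intro infsum_cong) (simp add: assms(1) complex_norm_square del: of_real_power)
  also have "\<dots> = of_real (l2_sq f)"
    unfolding l2_sq_def using has_sum_of_real[OF has_sum_infsum[OF assms(2)]] by (rule infsumI)
  finally show ?thesis .
qed

context fourier_flow begin

text \<open>Relative to the energy balance of \<open>a\<close>, the shift adds the pairing of the
  profile with the right-hand side. Its nonlinear part is the damping
  \<open>- M * l2_sq (a t)\<close> plus \<open>M\<close> times the kernel term, which the choice of
  \<open>N\<close> places below the dissipation; its linear part is split by Young's inequality into
  \<open>l2_sq (a t)\<close> and the constant \<open>K\<close>.\<close>

lemma profile_energy:
  assumes C: "\<And>k. \<epsilon> / 4 * (bracket k)\<^sup>2 - C \<le> linear_symbol \<epsilon> \<delta> \<beta> k"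
    and M: "M = 2 * C + 3" and M0: "0 \<le> M"
    and N: "1 \<le> N" "M * (inv_square_sum / real_of_int N) \<le> \<epsilon> / 2"
    and K: "K = (\<Sum>m\<in>{- 2 * N..2 * N} - {0}. (linear_symbol \<epsilon> \<delta> \<beta> (m, 0) * cmod (\<i> * of_real M / of_int m))\<^sup>2)"
    and P: "P = (\<Sum>m\<in>{- 2 * N..2 * N} - {0}. (cmod (\<i> * of_real M / of_int m))\<^sup>2)"
    and T: "0 \<le> T"
  shows "exp T * (\<Sum>\<^sub>\<infinity>k. (cmod (a T k - profile M N k))\<^sup>2) - (\<Sum>\<^sub>\<infinity>k. (cmod (a 0 k - profile M N k))\<^sup>2)
    \<le> (K + 2 * P) * (exp T - 1)"
proof -
  define \<phi> where "\<phi> = profile M N"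
  define I where "I = {- 2 * N..2 * N} - {0}"
  define p :: "int \<Rightarrow> complex" where "p m = \<i> * of_real M / of_int m" for m
  define U where "U = \<bar>\<epsilon>\<bar> + \<bar>\<delta>\<bar> + 1 + \<bar>\<beta> - 1\<bar>"
  have U: "\<bar>linear_symbol \<epsilon> \<delta> \<beta> k\<bar> \<le> U * (bracket k)\<^sup>2" for k
    unfolding U_def by (rule linear_symbol_upper)
  have U0: "0 \<le> U" by (simp add: U_def)
  obtain B where B: "\<And>t. t \<in> {0..T} \<Longrightarrow> h2_sq (a t) \<le> B" using bounded[OF T] by blast
  have B0: "0 \<le> B" using B[of 0] T h2_sq_nonneg[of "a 0"] by force
  define g where "g t k = flow_rhs \<epsilon> \<delta> \<beta> (a t) k" for t k
  note fe = forced_energy[OF _ h2 nonlin_summable(1) C U]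
  have g_eq: "g t k = - of_real (linear_symbol \<epsilon> \<delta> \<beta> k) * a t k + nonlin (a t) k" for t k
    by (simp add: g_def flow_rhs_def)
  have phi2: "(\<lambda>k. (cmod (\<phi> k))\<^sup>2) summable_on UNIV" "(\<Sum>\<^sub>\<infinity>k. (cmod (\<phi> k))\<^sup>2) = P"
    unfolding \<phi>_def P using infsum_profile[of "\<lambda>x k. (cmod x)\<^sup>2"] by auto
  have phig: "(\<lambda>k. cmod (\<phi> k) * cmod (g t k)) summable_on UNIV"
    "(\<Sum>\<^sub>\<infinity>k. cmod (\<phi> k) * cmod (g t k)) = (\<Sum>m\<in>I. cmod (p m) * cmod (g t (m, 0)))" for t
    unfolding \<phi>_def I_def p_def using infsum_profile[of "\<lambda>x k. cmod x * cmod (g t k)"] by auto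
  have phiRe: "(\<lambda>k. 2 * Re (cnj (\<phi> k) * g t k)) summable_on UNIV"
    "(\<Sum>\<^sub>\<infinity>k. 2 * Re (cnj (\<phi> k) * g t k)) = (\<Sum>m\<in>I. 2 * Re (cnj (p m) * g t (m, 0)))" for t
    unfolding \<phi>_def I_def p_def using infsum_profile[of "\<lambda>x k. 2 * Re (cnj x * g t k)"] by auto
  have v2: "(\<lambda>k. (cmod (a t k - \<phi> k))\<^sup>2) summable_on UNIV"
    and v2_le: "(\<Sum>\<^sub>\<infinity>k. (cmod (a t k - \<phi> k))\<^sup>2) \<le> 2 * l2_sq (a t) + 2 * P" if "0 \<le> t" for t
  proof -
    have hs: "((\<lambda>k. 2 * (cmod (a t k))\<^sup>2 + 2 * (cmod (\<phi> k))\<^sup>2) has_sum (2 * l2_sq (a t) + 2 * P)) UNIV"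
      unfolding phi2(2)[symmetric] l2_sq_def
      by (intro has_sum_add has_sum_cmult_right has_sum_infsum phi2(1) h2_l2(1)[OF h2[OF that]])
    have le: "(cmod (a t k - \<phi> k))\<^sup>2 \<le> 2 * (cmod (a t k))\<^sup>2 + 2 * (cmod (\<phi> k))\<^sup>2" for k
      using norm_add_sq_le[of "a t k" "- \<phi> k"] by simp
    show s: "(\<lambda>k. (cmod (a t k - \<phi> k))\<^sup>2) summable_on UNIV"
      by (rule summable_on_comparison_test[OF has_sum_imp_summable[OF hs]]) (use le in auto)
    show "(\<Sum>\<^sub>\<infinity>k. (cmod (a t k - \<phi> k))\<^sup>2) \<le> 2 * l2_sq (a t) + 2 * P"
      by (rule has_sum_mono[OF has_sum_infsum[OF s] hs]) (rule le)
  qed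
  \<comment> \<open>These quantities, up to \<open>B'\<close>, form the bound uniform in time that
    \<open>energy_inequality\<close> requires; the final estimate does not depend on them.\<close>
  define S where "S = sqrt B * sqrt inv_bracket_sum"
  define G where "G = U * B + S * B"
  define Gp where "Gp m = \<bar>linear_symbol \<epsilon> \<delta> \<beta> (m, 0)\<bar> * sqrt B + \<bar>real_of_int m\<bar> * B" for m
  define B' where "B' = (2 * B + 2 * P) + (G + (\<Sum>m\<in>I. cmod (p m) * Gp m))"
  have S0: "0 \<le> S" by (simp add: S_def inv_bracket_sum_nonneg B0)
  have P0: "0 \<le> P" unfolding P by (rule sum_nonneg) auto
  have ag: "(\<lambda>k. cmod (a t k) * cmod (g t k)) summable_on UNIV"
    "(\<Sum>\<^sub>\<infinity>k. cmod (a t k) * cmod (g t k)) \<le> G" if t: "t \<in> {0..T}" for t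
  proof -
    have t0: "0 \<le> t" using t by simp
    show "(\<lambda>k. cmod (a t k) * cmod (g t k)) summable_on UNIV"
      by (rule fe(1)[OF g_eq t0 t0])
    have "sqrt (h2_sq (a t)) * sqrt inv_bracket_sum * h2_sq (a t) \<le> S * B"
      unfolding S_def using B[OF t] h2_sq_nonneg[of "a t"] B0
      by (intro mult_mono) (auto simp: inv_bracket_sum_nonneg)
    moreover have "U * h2_sq (a t) \<le> U * B" using U0 B[OF t] by (intro mult_left_mono)
    ultimately show "(\<Sum>\<^sub>\<infinity>k. cmod (a t k) * cmod (g t k)) \<le> G"
      using fe(2)[OF g_eq t0 t0] nonlin_summable(2)[OF t0] unfolding G_def by linarith
  qed
  have g_le: "cmod (g t (m, 0)) \<le> Gp m" if t: "t \<in> {0..T}" for t m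
  proof -
    have t0: "0 \<le> t" using t by simp
    have l2B: "l2_sq (a t) \<le> B" using h2_l2(2)[OF h2[OF t0]] B[OF t] by linarith
    have "(cmod (a t (m, 0)))\<^sup>2 \<le> l2_sq (a t)"
      using finite_sum_le_infsum[OF h2_l2(1)[OF h2[OF t0]], of "{(m, 0)}"] by (simp add: l2_sq_def)
    then have 1: "cmod (a t (m, 0)) \<le> sqrt B" using l2B by (intro real_le_rsqrt) linarith
    have "cmod (conv (a t) (a t) (m, 0)) \<le> l2_sq (a t)"
      using conv_bound(2)[OF h2_l2(1)[OF h2[OF t0]] h2_l2(1)[OF h2[OF t0]], of "(m, 0)"] l2_sq_nonneg[of "a t"] by simp
    then have 2: "cmod (conv (a t) (a t) (m, 0)) \<le> B" using l2B by linarith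
    have "cmod (g t (m, 0)) \<le> \<bar>linear_symbol \<epsilon> \<delta> \<beta> (m, 0)\<bar> * cmod (a t (m, 0)) + 1 / 2 * (\<bar>real_of_int m\<bar> * cmod (conv (a t) (a t) (m, 0)))"
      unfolding g_eq by (rule order_trans[OF norm_triangle_ineq]) (simp add: norm_mult nonlin_def norm_divide)
    also have "\<dots> \<le> \<bar>linear_symbol \<epsilon> \<delta> \<beta> (m, 0)\<bar> * sqrt B + 1 * (\<bar>real_of_int m\<bar> * B)"
      using 1 2 by (intro add_mono mult_left_mono mult_mono) auto
    finally show ?thesis by (simp add: Gp_def)
  qed
  have "exp (1 * T) * (\<Sum>\<^sub>\<infinity>k. (cmod (a T k - \<phi> k))\<^sup>2) - (\<Sum>\<^sub>\<infinity>k. (cmod (a 0 k - \<phi> k))\<^sup>2)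
      \<le> (K + 2 * P) / 1 * (exp (1 * T) - 1)"
  proof (rule energy_inequality[where v = "\<lambda>k t. a t k - \<phi> k" and g = "\<lambda>k t. g t k" and B = B', OF T])
    fix t assume t: "t \<in> {0..T}"
    then have t0: "0 \<le> t" by simp
    show "((\<lambda>t. a t k - \<phi> k) has_vector_derivative g t k) (at t within {0..T})" for k
      unfolding has_vector_derivative_diff_const g_def using t by (intro ode_on) auto
    show "(\<lambda>k. (cmod (a t k - \<phi> k))\<^sup>2) summable_on UNIV" by (rule v2[OF t0])
    have l2B: "l2_sq (a t) \<le> B" using h2_l2(2)[OF h2[OF t0]] B[OF t] by linarith
    have pG: "(\<Sum>m\<in>I. cmod (p m) * cmod (g t (m, 0))) \<le> (\<Sum>m\<in>I. cmod (p m) * Gp m)"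
      by (intro sum_mono mult_left_mono g_le t) auto
    have pG0: "0 \<le> (\<Sum>m\<in>I. cmod (p m) * cmod (g t (m, 0)))" by (intro sum_nonneg) auto
    have G0: "0 \<le> G" using U0 S0 B0 by (simp add: G_def)
    show "(\<Sum>\<^sub>\<infinity>k. (cmod (a t k - \<phi> k))\<^sup>2) \<le> B'"
      using v2_le[OF t0] l2B pG pG0 G0 unfolding B'_def by linarith
    have maj: "((\<lambda>k. cmod (a t k) * cmod (g t k) + cmod (\<phi> k) * cmod (g t k)) has_sum
        ((\<Sum>\<^sub>\<infinity>k. cmod (a t k) * cmod (g t k)) + (\<Sum>m\<in>I. cmod (p m) * cmod (g t (m, 0))))) UNIV"
      unfolding phig(2)[symmetric] by (intro has_sum_add has_sum_infsum phig(1) ag(1) t)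
    have le: "cmod (a t k - \<phi> k) * cmod (g t k) \<le> cmod (a t k) * cmod (g t k) + cmod (\<phi> k) * cmod (g t k)" for k
      using mult_right_mono[OF norm_triangle_ineq4[of "a t k" "\<phi> k"], of "cmod (g t k)"] by (simp add: algebra_simps)
    show s: "(\<lambda>k. cmod (a t k - \<phi> k) * cmod (g t k)) summable_on UNIV"
      by (rule summable_on_comparison_test[OF has_sum_imp_summable[OF maj]]) (use le in auto)
    have "(\<Sum>\<^sub>\<infinity>k. cmod (a t k - \<phi> k) * cmod (g t k)) \<le>
        (\<Sum>\<^sub>\<infinity>k. cmod (a t k) * cmod (g t k)) + (\<Sum>m\<in>I. cmod (p m) * cmod (g t (m, 0)))"
      by (rule has_sum_mono[OF has_sum_infsum[OF s] maj]) (rule le)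
    then show "(\<Sum>\<^sub>\<infinity>k. cmod (a t k - \<phi> k) * cmod (g t k)) \<le> B'"
      using ag(2)[OF t] pG B0 P0 unfolding B'_def by linarith
    have agRe: "(\<lambda>k. 2 * Re (cnj (a t k) * g t k)) summable_on UNIV"
      "(\<Sum>\<^sub>\<infinity>k. 2 * Re (cnj (a t k) * g t k)) \<le> - (\<epsilon> / 2) * h2_sq (a t) + 2 * C * l2_sq (a t)"
      using fe(3,4)[OF g_eq t0 t0] nonlin_energy_zero[OF t0] by auto
    have D: "(\<Sum>\<^sub>\<infinity>k. 2 * Re (cnj (a t k - \<phi> k) * g t k)) =
        (\<Sum>\<^sub>\<infinity>k. 2 * Re (cnj (a t k) * g t k)) + (\<Sum>m\<in>I. - (2 * Re (cnj (p m) * g t (m, 0))))"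
    proof -
      have "((\<lambda>k. 2 * Re (cnj (a t k) * g t k) + - (2 * Re (cnj (\<phi> k) * g t k))) has_sum
          ((\<Sum>\<^sub>\<infinity>k. 2 * Re (cnj (a t k) * g t k)) + - (\<Sum>m\<in>I. 2 * Re (cnj (p m) * g t (m, 0))))) UNIV"
        unfolding phiRe(2)[symmetric] by (intro has_sum_add has_sum_uminusI has_sum_infsum agRe phiRe(1))
      moreover have "2 * Re (cnj (a t k - \<phi> k) * g t k) = 2 * Re (cnj (a t k) * g t k) + - (2 * Re (cnj (\<phi> k) * g t k))" for k
        by (simp add: algebra_simps)
      ultimately show ?thesis
        unfolding sum_negf by (simp only: infsumI)
    qed
    have "(\<Sum>m\<in>I. - (2 * Re (cnj (p m) * g t (m, 0)))) \<le>
        (\<Sum>m\<in>I. ((cmod (a t (m, 0)))\<^sup>2 + (linear_symbol \<epsilon> \<delta> \<beta> (m, 0) * cmod (p m))\<^sup>2) + M * Re (conv (a t) (a t) (m, 0)))"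
    proof (rule sum_mono)
      fix m assume "m \<in> I"
      then have m: "m \<noteq> 0" by (simp add: I_def)
      define \<sigma> where "\<sigma> = linear_symbol \<epsilon> \<delta> \<beta> (m, 0)"
      define z where "z = conv (a t) (a t) (m, 0)"
      \<comment> \<open>The factor \<open>1 / m\<close> of the profile cancels the derivative in the
        nonlinear term, leaving the coefficient of the square alone.\<close>
      have "cnj (p m) * nonlin (a t) (m, 0) = - of_real (M / 2) * z"
        using m by (simp add: p_def nonlin_def z_def field_simps)
      then have "cnj (p m) * g t (m, 0) = - of_real \<sigma> * (cnj (p m) * a t (m, 0)) + - of_real (M / 2) * z"
        unfolding g_eq \<sigma>_def[symmetric] by (simp add: algebra_simps)
      then have "- (2 * Re (cnj (p m) * g t (m, 0))) = 2 * \<sigma> * Re (cnj (p m) * a t (m, 0)) + M * Re z"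
        by simp
      moreover have "2 * \<sigma> * Re (cnj (p m) * a t (m, 0)) \<le> (cmod (a t (m, 0)))\<^sup>2 + (\<sigma> * cmod (p m))\<^sup>2"
      proof -
        have "2 * \<sigma> * Re (cnj (p m) * a t (m, 0)) \<le> \<bar>2 * \<sigma> * Re (cnj (p m) * a t (m, 0))\<bar>" by simp
        also have "\<dots> = 2 * \<bar>\<sigma>\<bar> * \<bar>Re (cnj (p m) * a t (m, 0))\<bar>" by (simp add: abs_mult)
        also have "\<dots> \<le> 2 * \<bar>\<sigma>\<bar> * (cmod (p m) * cmod (a t (m, 0)))"
          using abs_Re_le_cmod[of "cnj (p m) * a t (m, 0)"] by (intro mult_left_mono) (auto simp: norm_mult)
        also have "\<dots> = 2 * cmod (a t (m, 0)) * (\<bar>\<sigma>\<bar> * cmod (p m))" by simp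
        also have "\<dots> \<le> (cmod (a t (m, 0)))\<^sup>2 + (\<bar>\<sigma>\<bar> * cmod (p m))\<^sup>2" by (rule sum_squares_bound)
        finally show ?thesis by (simp add: power_mult_distrib)
      qed
      ultimately show "- (2 * Re (cnj (p m) * g t (m, 0))) \<le>
          ((cmod (a t (m, 0)))\<^sup>2 + (linear_symbol \<epsilon> \<delta> \<beta> (m, 0) * cmod (p m))\<^sup>2) + M * Re (conv (a t) (a t) (m, 0))"
        by (simp add: \<sigma>_def z_def)
    qed
    also have "\<dots> = (\<Sum>m\<in>I. (cmod (a t (m, 0)))\<^sup>2) + K + M * (\<Sum>m\<in>I. Re (conv (a t) (a t) (m, 0)))"
      by (simp add: sum.distrib sum_distrib_left K I_def p_def)
    finally have phi_part: "(\<Sum>m\<in>I. - (2 * Re (cnj (p m) * g t (m, 0)))) \<le> \<dots>" .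
    have low: "(\<Sum>m\<in>I. (cmod (a t (m, 0)))\<^sup>2) \<le> l2_sq (a t)"
    proof -
      have "(\<Sum>m\<in>I. (cmod (a t (m, 0)))\<^sup>2) = (\<Sum>k\<in>(\<lambda>m. (m, 0)) ` I. (cmod (a t k))\<^sup>2)"
        by (subst sum.reindex) (auto simp: inj_on_def)
      also have "\<dots> \<le> l2_sq (a t)"
        unfolding l2_sq_def by (rule finite_sum_le_infsum[OF h2_l2(1)[OF h2[OF t0]]]) (auto simp: I_def)
      finally show ?thesis .
    qed
    \<comment> \<open>The index set omits \<open>m = 0\<close>, where the convolution is all of
      \<open>l2_sq (a t)\<close>. Completing the sum to the full Dirichlet kernel therefore releases
      \<open>- M * l2_sq (a t)\<close>, and oddness makes the completed sum small.\<close>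
    have "M * (\<Sum>m\<in>I. Re (conv (a t) (a t) (m, 0))) \<le> \<epsilon> / 2 * h2_sq (a t) - M * l2_sq (a t)"
    proof -
      have c0: "conv (a t) (a t) (0, 0) = of_real (l2_sq (a t))"
        using conv_zero_eq_l2_sq[OF real[OF t0] h2_l2(1)[OF h2[OF t0]]] by (simp add: zero_prod_def)
      have "(\<Sum>m\<in>{- 2 * N..2 * N}. Re (conv (a t) (a t) (m, 0))) =
          l2_sq (a t) + (\<Sum>m\<in>I. Re (conv (a t) (a t) (m, 0)))"
        unfolding I_def using N by (subst sum.remove[of _ 0]) (auto simp: c0)
      moreover have "(\<Sum>m\<in>{- 2 * N..2 * N}. Re (conv (a t) (a t) (m, 0))) \<le> inv_square_sum / real_of_int N * h2_sq (a t)"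
        using conv_dirichlet_odd[OF h2[OF t0] real[OF t0] odd_persists[OF t0] N(1)]
          complex_Re_le_cmod[of "\<Sum>m\<in>{- 2 * N..2 * N}. conv (a t) (a t) (m, 0)"] by simp
      ultimately have "M * (\<Sum>m\<in>I. Re (conv (a t) (a t) (m, 0))) \<le> M * (inv_square_sum / real_of_int N * h2_sq (a t) - l2_sq (a t))"
        using M0 by (intro mult_left_mono) auto
      also have "\<dots> = M * (inv_square_sum / real_of_int N) * h2_sq (a t) - M * l2_sq (a t)" by (simp add: algebra_simps)
      also have "\<dots> \<le> \<epsilon> / 2 * h2_sq (a t) - M * l2_sq (a t)"
        using N(2) h2_sq_nonneg[of "a t"] by (intro diff_right_mono mult_right_mono) auto
      finally show ?thesis .
    qed
    then have "(\<Sum>\<^sub>\<infinity>k. 2 * Re (cnj (a t k - \<phi> k) * g t k)) \<le> 2 * C * l2_sq (a t) + l2_sq (a t) + K - M * l2_sq (a t)"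
      unfolding D using agRe(2) phi_part low by linarith
    \<comment> \<open>The origin of \<open>M = 2 * C + 3\<close>: \<open>2 * C\<close> is spent on
      the unstable modes, \<open>1\<close> on the linear forcing by the profile, and the remaining
      \<open>2\<close> dominates the energy of \<open>a t - \<phi>\<close>, which by
      \<open>v2_le\<close> is at most \<open>2 * l2_sq (a t) + 2 * P\<close>.\<close>
    also have "\<dots> = - 2 * l2_sq (a t) + K" by (simp add: M algebra_simps)
    finally show "1 * (\<Sum>\<^sub>\<infinity>k. (cmod (a t k - \<phi> k))\<^sup>2) + (\<Sum>\<^sub>\<infinity>k. 2 * Re (cnj (a t k - \<phi> k) * g t k)) \<le> K + 2 * P"
      using v2_le[OF t0] by simp
  qed simp
  then show ?thesis by (simp add: \<phi>_def)
qed

end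

lemma absorbing_l2:
  assumes eps: "0 < \<epsilon>"
  shows "\<exists>Q. \<forall>a. fourier_flow \<epsilon> \<delta> \<beta> a \<longrightarrow> (\<exists>T\<ge>0. \<forall>t\<ge>T. l2_sq (a t) \<le> Q)"
proof -
  obtain C where C: "0 \<le> C" "\<And>k. \<epsilon> / 4 * (bracket k)\<^sup>2 - C \<le> linear_symbol \<epsilon> \<delta> \<beta> k"
    using linear_symbol_lower[OF eps] by blast
  define M where "M = 2 * C + 3"
  have M0: "0 \<le> M" using C(1) by (simp add: M_def)
  \<comment> \<open>The order is chosen after \<open>M\<close>, so that \<open>M\<close> times the
    constant of the kernel estimate fits below \<open>\<epsilon> / 2\<close>.\<close>
  define N where "N = max 1 \<lceil>2 * M * inv_square_sum / \<epsilon>\<rceil>"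
  have N1: "1 \<le> N" by (simp add: N_def)
  have "2 * M * inv_square_sum / \<epsilon> \<le> real_of_int \<lceil>2 * M * inv_square_sum / \<epsilon>\<rceil>" by simp
  also have "\<dots> \<le> N" by (simp add: N_def)
  finally have N2: "M * (inv_square_sum / real_of_int N) \<le> \<epsilon> / 2"
    using eps N1 by (simp add: field_simps)
  define K where "K = (\<Sum>m\<in>{- 2 * N..2 * N} - {0}. (linear_symbol \<epsilon> \<delta> \<beta> (m, 0) * cmod (\<i> * of_real M / of_int m))\<^sup>2)"
  define P where "P = (\<Sum>m\<in>{- 2 * N..2 * N} - {0}. (cmod (\<i> * of_real M / of_int m))\<^sup>2)"
  have KP: "0 \<le> K + 2 * P" unfolding K_def P_def by (intro add_nonneg_nonneg mult_nonneg_nonneg sum_nonneg) auto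
  have "\<exists>T\<ge>0. \<forall>t\<ge>T. l2_sq (a t) \<le> 2 * (K + 2 * P + 1) + 2 * P" if "fourier_flow \<epsilon> \<delta> \<beta> a" for a
  proof -
    interpret fourier_flow \<epsilon> \<delta> \<beta> a by fact
    define E where "E t = (\<Sum>\<^sub>\<infinity>k. (cmod (a t k - profile M N k))\<^sup>2)" for t
    have E0: "0 \<le> E 0" unfolding E_def by (rule infsum_nonneg) auto
    \<comment> \<open>By time \<open>ln (E 0 + 1)\<close> the initial energy has been damped to at
      most \<open>1\<close>. The data thus influence the entry time, but not the radius.\<close>
    have E: "E t \<le> K + 2 * P + 1" if t: "ln (E 0 + 1) \<le> t" "0 \<le> t" for t
    proof -
      have e: "exp t * E t - E 0 \<le> (K + 2 * P) * (exp t - 1)"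
        unfolding E_def by (rule profile_energy[OF C(2) M_def M0 N1 N2 K_def P_def t(2)])
      have "E 0 + 1 \<le> exp t" using t(1) E0 ln_le_cancel_iff[of "E 0 + 1" "exp t"] by simp
      moreover have "(K + 2 * P) * (exp t - 1) \<le> (K + 2 * P) * exp t" using KP by (intro mult_left_mono) auto
      ultimately have "exp t * E t \<le> exp t * (K + 2 * P + 1)" using e by (simp add: algebra_simps)
      then show ?thesis by simp
    qed
    have "l2_sq (a t) \<le> 2 * E t + 2 * P" if t: "0 \<le> t" for t
    proof -
      have phi2: "(\<lambda>k. (cmod (profile M N k))\<^sup>2) summable_on UNIV" "(\<Sum>\<^sub>\<infinity>k. (cmod (profile M N k))\<^sup>2) = P"
        unfolding P_def using infsum_profile[of "\<lambda>x k. (cmod x)\<^sup>2"] by auto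
      have v2: "(\<lambda>k. (cmod (a t k - profile M N k))\<^sup>2) summable_on UNIV"
      proof (rule summable_on_comparison_test)
        show "(\<lambda>k. 2 * (cmod (a t k))\<^sup>2 + 2 * (cmod (profile M N k))\<^sup>2) summable_on UNIV"
          by (intro summable_on_add summable_on_cmult_right phi2 h2_l2(1)[OF h2[OF t]])
        show "(cmod (a t k - profile M N k))\<^sup>2 \<le> 2 * (cmod (a t k))\<^sup>2 + 2 * (cmod (profile M N k))\<^sup>2" for k
          using norm_add_sq_le[of "a t k" "- profile M N k"] by simp
      qed auto
      have hs: "((\<lambda>k. 2 * (cmod (a t k - profile M N k))\<^sup>2 + 2 * (cmod (profile M N k))\<^sup>2) has_sum (2 * E t + 2 * P)) UNIV"
        unfolding phi2(2)[symmetric] E_def by (intro has_sum_add has_sum_cmult_right has_sum_infsum phi2 v2)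
      show ?thesis unfolding l2_sq_def
        by (rule has_sum_mono[OF has_sum_infsum[OF h2_l2(1)[OF h2[OF t]]] hs])
          (use norm_add_sq_le[of "a t k - profile M N k" "profile M N k" for k] in auto)
    qed
    then have "l2_sq (a t) \<le> 2 * (K + 2 * P + 1) + 2 * P" if "max 0 (ln (E 0 + 1)) \<le> t" for t
      using E[of t] that by force
    then show ?thesis by (intro exI[of _ "max 0 (ln (E 0 + 1))"]) auto
  qed
  then show ?thesis by blast
qed

section \<open>Smoothing\<close>

context fourier_flow begin

text \<open>For low frequencies, where \<open>C\<close> may outweigh the dissipation,
  \<open>(bracket k)^2\<close> is at most \<open>8 / \<epsilon> * C\<close> and the assumed bound at
  time \<open>s + 1\<close> is enough. For all others \<open>\<sigma>\<close> is at least
  \<open>\<epsilon> / 8 * (bracket k)^2\<close>, and unit time of linear damping gives the gain. The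
  factor \<open>8 / \<epsilon> * (C + 1)\<close> covers both cases.\<close>

lemma mode_bound:
  assumes C: "0 \<le> C" "\<And>k. \<epsilon> / 4 * (bracket k)\<^sup>2 - C \<le> linear_symbol \<epsilon> \<delta> \<beta> k"
    and s: "0 \<le> s"
    and R: "cmod (a s k) \<le> R" "cmod (a (s + 1) k) \<le> R"
    and B: "\<And>t. t \<in> {s..s + 1} \<Longrightarrow> cmod (nonlin (a t) k) \<le> B"
  shows "(bracket k)\<^sup>2 * cmod (a (s + 1) k) \<le> 8 / \<epsilon> * (C + 1) * (R + B)"
proof -
  define \<sigma> where "\<sigma> = linear_symbol \<epsilon> \<delta> \<beta> k"
  have R0: "0 \<le> R" using R(1) norm_ge_zero[of "a s k"] by linarith
  have B0: "0 \<le> B" using B[of s] norm_ge_zero[of "nonlin (a s) k"] by (auto simp del: norm_ge_zero)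
  show ?thesis
  proof (cases "\<epsilon> / 4 * (bracket k)\<^sup>2 \<le> 2 * C")
    case True
    then have "(bracket k)\<^sup>2 \<le> 8 / \<epsilon> * C" using eps by (simp add: field_simps)
    then have "(bracket k)\<^sup>2 * cmod (a (s + 1) k) \<le> 8 / \<epsilon> * C * R"
      using R(2) eps C(1) by (intro mult_mono) auto
    also have "\<dots> \<le> 8 / \<epsilon> * (C + 1) * (R + B)"
      using eps C(1) R0 B0 by (intro mult_mono) auto
    finally show ?thesis .
  next
    case False
    then have \<sigma>: "\<epsilon> / 8 * (bracket k)\<^sup>2 \<le> \<sigma>" using C(2)[of k] unfolding \<sigma>_def by linarith
    have b: "0 < \<epsilon> / 8 * (bracket k)\<^sup>2" using eps bracket_pos[of k] by simp
    have "cmod (a (s + 1) k) \<le> (R + B) / \<sigma>"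
    proof (rule linear_ode_bound[where n = "\<lambda>t. nonlin (a t) k" and a = "\<lambda>t. a t k"])
      show "0 < \<sigma>" using b \<sigma> by linarith
      show "((\<lambda>t. a t k) has_vector_derivative - complex_of_real \<sigma> * a t k + nonlin (a t) k) (at t within {s..s + 1})"
        if "t \<in> {s..s + 1}" for t
        using ode_on[OF _ that, of k] s by (simp add: flow_rhs_def \<sigma>_def)
    qed (use B R in auto)
    also have "\<dots> \<le> (R + B) / (\<epsilon> / 8 * (bracket k)\<^sup>2)"
      using \<sigma> b R0 B0 by (intro divide_left_mono) auto
    finally have "(bracket k)\<^sup>2 * cmod (a (s + 1) k) \<le> 8 / \<epsilon> * (R + B)"
      using eps bracket_pos[of k] by (simp add: field_simps)
    also have "\<dots> \<le> 8 / \<epsilon> * (C + 1) * (R + B)"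
      using eps C(1) R0 B0 by (intro mult_right_mono) (auto simp: field_simps)
    finally show ?thesis .
  qed
qed

text \<open>Two rounds of \<open>mode_bound\<close>, each using up one unit of time, hence
  \<open>T + 2\<close>. Working mode by mode avoids energy estimates in stronger norms: a bound on
  each single nonlinear coefficient suffices, since the fourth-order damping gains enough decay to
  sum over the plane lattice.\<close>

lemma h2_from_l2:
  assumes C: "0 \<le> C" "\<And>k. \<epsilon> / 4 * (bracket k)\<^sup>2 - C \<le> linear_symbol \<epsilon> \<delta> \<beta> k"
    and T: "0 \<le> T" and Q: "\<And>t. T \<le> t \<Longrightarrow> l2_sq (a t) \<le> Q"
    and A: "A = 8 / \<epsilon> * (C + 1)"
    and t: "T + 2 \<le> t"
  shows "h2_sq (a t) \<le> (A * (sqrt Q + sqrt ((A * (sqrt Q + Q))\<^sup>2 * inv_bracket_sum) * sqrt Q))\<^sup>2 * inv_bracket_sum"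
proof -
  have Q0: "0 \<le> Q" using Q[of T] l2_sq_nonneg[of "a T"] by linarith
  have A0: "0 \<le> A" using eps C(1) by (simp add: A)
  have l2: "(\<lambda>k. (cmod (a t k))\<^sup>2) summable_on UNIV" if "T \<le> t" for t
    using h2_l2(1)[OF h2] T that by auto
  have mode: "cmod (a t k) \<le> sqrt Q" if "T \<le> t" for t k
  proof -
    have "(cmod (a t k))\<^sup>2 \<le> l2_sq (a t)"
      using finite_sum_le_infsum[OF l2[OF that], of "{k}"] by (simp add: l2_sq_def)
    then show ?thesis using Q[OF that] by (intro real_le_rsqrt) linarith
  qed
  have step1: "(bracket k)\<^sup>2 * cmod (a t k) \<le> A * (sqrt Q + Q) * sqrt (bracket k)" if t: "T + 1 \<le> t" for t k
  proof -
    have sb: "1 \<le> sqrt (bracket k)" using bracket_ge_1[of k] by simp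
    have "(bracket k)\<^sup>2 * cmod (a (t - 1 + 1) k) \<le> 8 / \<epsilon> * (C + 1) * (sqrt Q + sqrt (bracket k) * Q)"
    proof (rule mode_bound[OF C])
      show "cmod (nonlin (a \<tau>) k) \<le> sqrt (bracket k) * Q" if "\<tau> \<in> {t - 1..t - 1 + 1}" for \<tau>
      proof -
        have \<tau>: "T \<le> \<tau>" using that t by auto
        have "cmod (conv (a \<tau>) (a \<tau>) k) \<le> l2_sq (a \<tau>)"
          using conv_bound(2)[OF l2[OF \<tau>] l2[OF \<tau>], of k] l2_sq_nonneg[of "a \<tau>"] by simp
        then have 1: "cmod (conv (a \<tau>) (a \<tau>) k) \<le> Q" using Q[OF \<tau>] by linarith
        have "\<bar>real_of_int (fst k)\<bar> \<le> sqrt (bracket k)"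
          using fst_le_bracket(1)[of k] by (intro real_le_rsqrt) simp
        then have "\<bar>real_of_int (fst k)\<bar> * cmod (conv (a \<tau>) (a \<tau>) k) \<le> sqrt (bracket k) * Q"
          using 1 bracket_pos[of k] by (intro mult_mono) auto
        moreover have "0 \<le> \<bar>real_of_int (fst k)\<bar> * cmod (conv (a \<tau>) (a \<tau>) k)" by simp
        moreover have "cmod (nonlin (a \<tau>) k) = 1 / 2 * (\<bar>real_of_int (fst k)\<bar> * cmod (conv (a \<tau>) (a \<tau>) k))"
          by (simp add: nonlin_def norm_mult norm_divide)
        ultimately show ?thesis by linarith
      qed
    qed (use mode t T in auto)
    also have "\<dots> \<le> A * (sqrt Q * sqrt (bracket k) + sqrt (bracket k) * Q)"
      unfolding A[symmetric] using A0 sb Q0 by (intro mult_left_mono add_right_mono) (auto simp: mult_le_cancel_left1)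
    finally show ?thesis by (simp add: algebra_simps)
  qed
  \<comment> \<open>After the first round \<open>a t k\<close> is of order \<open>bracket k\<close>
    to the power \<open>-3/2\<close>. Multiplication by \<open>fst k\<close> costs a power
    \<open>1/2\<close>, so the squares are of order \<open>1 / (bracket k)^2\<close>, which is just
    summable enough.\<close>
  have grad: "l2_sq (\<lambda>k. of_int (fst k) * a t k) \<le> (A * (sqrt Q + Q))\<^sup>2 * inv_bracket_sum" if t: "T + 1 \<le> t" for t
  proof -
    have hs: "((\<lambda>k. (A * (sqrt Q + Q))\<^sup>2 * (1 / (bracket k)\<^sup>2)) has_sum ((A * (sqrt Q + Q))\<^sup>2 * inv_bracket_sum)) UNIV"
      unfolding inv_bracket_sum_def by (intro has_sum_cmult_right has_sum_infsum summable_on_inverse_bracket)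
    have s: "(\<lambda>k. (cmod (of_int (fst k) * a t k))\<^sup>2) summable_on UNIV"
      using h2_fst(1)[OF h2] T t by auto
    show ?thesis unfolding l2_sq_def
    proof (rule has_sum_mono[OF has_sum_infsum[OF s] hs])
      fix k
      have b: "0 < bracket k" by (rule bracket_pos)
      have "((bracket k)\<^sup>2 * cmod (a t k))\<^sup>2 \<le> (A * (sqrt Q + Q) * sqrt (bracket k))\<^sup>2"
        using step1[OF t, of k] by (intro power_mono) auto
      moreover have "((bracket k)\<^sup>2 * cmod (a t k))\<^sup>2 = (bracket k)\<^sup>2 * (bracket k * (cmod (a t k))\<^sup>2) * bracket k"
        by (simp add: power2_eq_square)
      moreover have "(x * sqrt (bracket k))\<^sup>2 = x\<^sup>2 * bracket k" for x
        using b by (simp add: power_mult_distrib)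
      ultimately have "(bracket k)\<^sup>2 * (bracket k * (cmod (a t k))\<^sup>2) * bracket k \<le> (A * (sqrt Q + Q))\<^sup>2 * bracket k"
        by simp
      then have "(bracket k)\<^sup>2 * (bracket k * (cmod (a t k))\<^sup>2) \<le> (A * (sqrt Q + Q))\<^sup>2"
        using b by (rule mult_right_le_imp_le)
      moreover have "(cmod (of_int (fst k) * a t k))\<^sup>2 \<le> bracket k * (cmod (a t k))\<^sup>2"
        using fst_le_bracket(1)[of k] by (simp add: norm_mult power_mult_distrib mult_right_mono)
      ultimately have "(bracket k)\<^sup>2 * (cmod (of_int (fst k) * a t k))\<^sup>2 \<le> (A * (sqrt Q + Q))\<^sup>2"
        using mult_left_mono[of "(cmod (of_int (fst k) * a t k))\<^sup>2" "bracket k * (cmod (a t k))\<^sup>2" "(bracket k)\<^sup>2"]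
        by auto
      then show "(cmod (of_int (fst k) * a t k))\<^sup>2 \<le> (A * (sqrt Q + Q))\<^sup>2 * (1 / (bracket k)\<^sup>2)"
        using b by (simp add: field_simps)
    qed
  qed
  define D where "D = sqrt ((A * (sqrt Q + Q))\<^sup>2 * inv_bracket_sum) * sqrt Q"
  have step2: "(bracket k)\<^sup>2 * cmod (a t k) \<le> A * (sqrt Q + D)" for k
  proof -
    have "(bracket k)\<^sup>2 * cmod (a (t - 1 + 1) k) \<le> 8 / \<epsilon> * (C + 1) * (sqrt Q + D)"
    proof (rule mode_bound[OF C])
      show "cmod (nonlin (a \<tau>) k) \<le> D" if "\<tau> \<in> {t - 1..t - 1 + 1}" for \<tau>
      proof -
        have \<tau>: "T \<le> \<tau>" "T + 1 \<le> \<tau>" using that t by auto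
        define d where "d k = of_int (fst k) * a \<tau> k" for k
        have d: "(\<lambda>k. (cmod (d k))\<^sup>2) summable_on UNIV"
          unfolding d_def using h2_fst(1)[OF h2] T \<tau> by auto
        note b1 = conv_bound[OF d l2[OF \<tau>(1)], of k] and b2 = conv_bound[OF l2[OF \<tau>(1)] d, of k]
        \<comment> \<open>Leibniz' rule, from \<open>fst k = fst j + fst (k - j)\<close>: once the
          derivative falls on a square-summable factor, the nonlinear coefficients are bounded
          without loss in \<open>k\<close>.\<close>
        have "of_int (fst k) * conv (a \<tau>) (a \<tau>) k = (\<Sum>\<^sub>\<infinity>j. d j * a \<tau> (k - j) + a \<tau> j * d (k - j))"
          unfolding conv_def infsum_cmult_right'[symmetric] by (intro infsum_cong) (simp add: d_def algebra_simps)
        also have "\<dots> = conv d (a \<tau>) k + conv (a \<tau>) d k"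
          unfolding conv_def using b1(1) b2(1) by (rule infsum_add)
        finally have "cmod (of_int (fst k) * conv (a \<tau>) (a \<tau>) k) \<le> 2 * (sqrt (l2_sq d) * sqrt (l2_sq (a \<tau>)))"
          using b1(2) b2(2) norm_triangle_ineq[of "conv d (a \<tau>) k" "conv (a \<tau>) d k"] by (simp add: mult.commute)
        also have "\<dots> \<le> 2 * D"
          unfolding D_def using grad[OF \<tau>(2)] Q[OF \<tau>(1)] l2_sq_nonneg inv_bracket_sum_nonneg
          unfolding d_def[symmetric] by (intro mult_left_mono mult_mono) auto
        finally show ?thesis by (simp add: nonlin_def norm_mult norm_divide)
      qed
    qed (use mode t T in auto)
    then show ?thesis by (simp add: A)
  qed
  have hs: "((\<lambda>k. (A * (sqrt Q + D))\<^sup>2 * (1 / (bracket k)\<^sup>2)) has_sum ((A * (sqrt Q + D))\<^sup>2 * inv_bracket_sum)) UNIV"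
    unfolding inv_bracket_sum_def by (intro has_sum_cmult_right has_sum_infsum summable_on_inverse_bracket)
  have "h2_sq (a t) \<le> (A * (sqrt Q + D))\<^sup>2 * inv_bracket_sum"
    unfolding h2_sq_def
  proof (rule has_sum_mono[OF has_sum_infsum hs])
    show "(\<lambda>k. (bracket k)\<^sup>2 * (cmod (a t k))\<^sup>2) summable_on UNIV"
      using h2[of t] T t by (simp add: h2_def)
    fix k
    have b: "0 < bracket k" by (rule bracket_pos)
    have "((bracket k)\<^sup>2 * cmod (a t k))\<^sup>2 \<le> (A * (sqrt Q + D))\<^sup>2"
      using step2[of k] by (intro power_mono) auto
    moreover have "((bracket k)\<^sup>2 * cmod (a t k))\<^sup>2 = (bracket k)\<^sup>2 * ((bracket k)\<^sup>2 * (cmod (a t k))\<^sup>2)"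
      by (simp add: power2_eq_square)
    ultimately have "(bracket k)\<^sup>2 * ((bracket k)\<^sup>2 * (cmod (a t k))\<^sup>2) \<le> (A * (sqrt Q + D))\<^sup>2"
      by simp
    then show "(bracket k)\<^sup>2 * (cmod (a t k))\<^sup>2 \<le> (A * (sqrt Q + D))\<^sup>2 * (1 / (bracket k)\<^sup>2)"
      using b by (simp add: field_simps)
  qed
  then show ?thesis by (simp add: D_def)
qed

end

theorem absorbing_h2:
  assumes eps: "0 < \<epsilon>"
  shows "\<exists>R. \<forall>a. fourier_flow \<epsilon> \<delta> \<beta> a \<longrightarrow> (\<exists>T. \<forall>t\<ge>T. h2_sq (a t) \<le> R)"
proof -
  obtain Q where Q: "\<And>a. fourier_flow \<epsilon> \<delta> \<beta> a \<Longrightarrow> \<exists>T\<ge>0. \<forall>t\<ge>T. l2_sq (a t) \<le> Q"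
    using absorbing_l2[OF eps] by blast
  obtain C where C: "0 \<le> C" "\<And>k. \<epsilon> / 4 * (bracket k)\<^sup>2 - C \<le> linear_symbol \<epsilon> \<delta> \<beta> k"
    using linear_symbol_lower[OF eps] by blast
  define A where "A = 8 / \<epsilon> * (C + 1)"
  define R where "R = (A * (sqrt Q + sqrt ((A * (sqrt Q + Q))\<^sup>2 * inv_bracket_sum) * sqrt Q))\<^sup>2 * inv_bracket_sum"
  have "\<exists>T. \<forall>t\<ge>T. h2_sq (a t) \<le> R" if a: "fourier_flow \<epsilon> \<delta> \<beta> a" for a
  proof -
    obtain T where T: "0 \<le> T" "\<And>t. T \<le> t \<Longrightarrow> l2_sq (a t) \<le> Q" using Q[OF a] by blast
    have "h2_sq (a t) \<le> R" if "T + 2 \<le> t" for t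
      unfolding R_def by (rule fourier_flow.h2_from_l2[OF a C T A_def that])
    then show ?thesis by blast
  qed
  then show ?thesis by blast
qed

section \<open>Uniqueness of Fourier coefficients on the torus\<close>

abbreviation cell :: "(real \<times> real) set" where
  "cell \<equiv> {0..2 * pi} \<times> {0..2 * pi}"

lemma cell_eq_cbox: "cell = cbox (0, 0) (2 * pi, 2 * pi)"
  by (simp add: cbox_Pair_eq)

lemma cell_borel [measurable]: "cell \<in> sets borel"
  unfolding cell_eq_cbox by simp

lemma space_torus [simp]: "space torus = cell"
  by (simp add: torus_def space_restrict_space)

lemma measurable_torus: "f \<in> borel_measurable borel \<Longrightarrow> f \<in> borel_measurable torus"
  unfolding torus_def by (rule measurable_restrict_space1) simp

lemma sets_torus: "A \<in> sets torus \<Longrightarrow> A \<in> sets borel"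
  unfolding torus_def using sets_restrict_space_iff[of cell lborel A] by simp

lemma emeasure_torus: "emeasure torus cell = ennreal ((2 * pi)\<^sup>2)"
proof -
  have "emeasure torus cell = emeasure lborel cell"
    unfolding torus_def by (simp add: emeasure_restrict_space space_restrict_space)
  also have "\<dots> = ennreal ((2 * pi)\<^sup>2)"
    unfolding cell_eq_cbox by (subst emeasure_lborel_cbox) (auto simp: Basis_prod_def power2_eq_square)
  finally show ?thesis .
qed

interpretation torus: finite_measure torus
  by standard (simp add: emeasure_torus)

lemma integral_torus:
  fixes f :: "real \<times> real \<Rightarrow> 'a::euclidean_space"
  assumes "continuous_on UNIV f"
  shows "integrable torus f"
    and "integral\<^sup>L torus f = integral {0..2 * pi} (\<lambda>x. integral {0..2 * pi} (\<lambda>y. f (x, y)))"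
proof -
  have c: "continuous_on cell f" using assms continuous_on_subset by blast
  have si: "set_integrable lborel cell f"
    using c unfolding cell_eq_cbox set_integrable_def by (intro borel_integrable_compact) auto
  then show "integrable torus f"
    unfolding torus_def set_integrable_def by (simp add: integrable_restrict_space)
  have "integral\<^sup>L torus f = (LINT p:cell|lborel. f p)"
    unfolding torus_def set_lebesgue_integral_def by (simp add: integral_restrict_space)
  also have "\<dots> = integral cell f" by (rule set_borel_integral_eq_integral[OF si])
  also have "\<dots> = integral {0..2 * pi} (\<lambda>x. integral {0..2 * pi} (\<lambda>y. f (x, y)))"
    using integral_prod_continuous[of 0 0 "2 * pi" "2 * pi" f] c unfolding cell_eq_cbox by simp
  finally show "integral\<^sup>L torus f = integral {0..2 * pi} (\<lambda>x. integral {0..2 * pi} (\<lambda>y. f (x, y)))" .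
qed

section \<open>Characters and their orthogonality\<close>

definition torus_char :: "int \<times> int \<Rightarrow> real \<times> real \<Rightarrow> complex" where
  "torus_char \<xi> p = cis (real_of_int (fst \<xi>) * fst p + real_of_int (snd \<xi>) * snd p)"

lemma norm_torus_char [simp]: "norm (torus_char \<xi> p) = 1"
  by (simp add: torus_char_def)

lemma torus_char_add: "torus_char (\<xi> + \<eta>) p = torus_char \<xi> p * torus_char \<eta> p"
  by (simp add: torus_char_def cis_mult algebra_simps)

lemma torus_char_0 [simp]: "torus_char 0 p = 1"
  by (simp add: torus_char_def)

lemma cnj_torus_char: "cnj (torus_char \<xi> p) = torus_char (- \<xi>) p"
  by (simp add: torus_char_def cis_cnj)

lemma torus_char_uminus: "torus_char (- \<xi>) p = cis (- (real_of_int (fst \<xi>) * fst p + real_of_int (snd \<xi>) * snd p))"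
  by (simp add: torus_char_def)

lemma continuous_on_torus_char [continuous_intros]: "continuous_on S (torus_char \<xi>)"
  unfolding torus_char_def by (intro continuous_intros)

lemma torus_char_borel [measurable]: "torus_char \<xi> \<in> borel_measurable borel"
  by (intro borel_measurable_continuous_onI continuous_intros)

lemma torus_char_measurable [measurable]: "torus_char \<xi> \<in> borel_measurable torus"
  by (rule measurable_torus) measurable

lemma fourier_char:
  "fourier u \<xi> = (\<integral>p. of_real (u p) * torus_char (- \<xi>) p \<partial>torus) / of_real ((2 * pi)\<^sup>2)"
  by (simp add: fourier_def torus_char_uminus)

lemma integral_cis_period:
  "integral {0..2 * pi} (\<lambda>x. cis (real_of_int n * x)) = (if n = 0 then of_real (2 * pi) else 0)"
proof (cases "n = 0")
  case False
  have "((\<lambda>x. cis (real_of_int n * x)) has_integral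
      (- \<i> / of_int n * cis (real_of_int n * (2 * pi)) - (- \<i> / of_int n * cis (real_of_int n * 0)))) {0..2 * pi}"
  proof (rule fundamental_theorem_of_calculus)
    fix x :: real
    have "((\<lambda>x. - \<i> / of_int n * cis (real_of_int n * x)) has_vector_derivative
        (- \<i> / of_int n * (real_of_int n *\<^sub>R (\<i> * cis (real_of_int n * x))))) (at x within {0..2 * pi})"
    proof (rule has_vector_derivative_mult_right)
      have "(cis has_vector_derivative (\<i> * cis y)) (at y within S)" for y S
        unfolding has_vector_derivative_def
        by (rule has_derivative_eq_rhs, rule has_derivative_cis[OF has_derivative_ident])
          (auto simp: scaleR_conv_of_real mult_ac fun_eq_iff)
      moreover have "((\<lambda>x. real_of_int n * x) has_vector_derivative real_of_int n) (at x within {0..2 * pi})"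
        by (auto intro!: derivative_eq_intros)
      ultimately have "(cis \<circ> (\<lambda>x. real_of_int n * x) has_vector_derivative (real_of_int n *\<^sub>R (\<i> * cis (real_of_int n * x))))
          (at x within {0..2 * pi})"
        by (rule vector_diff_chain_within[rotated])
      then
      show "((\<lambda>x. cis (real_of_int n * x)) has_vector_derivative (real_of_int n *\<^sub>R (\<i> * cis (real_of_int n * x))))
          (at x within {0..2 * pi})"
        by (simp add: o_def)
    qed
    also have "- \<i> / of_int n * (real_of_int n *\<^sub>R (\<i> * cis (real_of_int n * x))) = cis (real_of_int n * x)"
      using False by (simp add: scaleR_conv_of_real field_simps)
    finally show "((\<lambda>x. - \<i> / of_int n * cis (real_of_int n * x)) has_vector_derivative
        cis (real_of_int n * x)) (at x within {0..2 * pi})" .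
  qed auto
  moreover have "cis (real_of_int n * (2 * pi)) = 1"
    using cis_multiple_2pi[of "real_of_int n"] by (simp add: mult_ac)
  ultimately show ?thesis using False by (simp add: integral_unique)
qed (simp add: scaleR_conv_of_real)

lemma integral_torus_char: "integral\<^sup>L torus (torus_char \<xi>) = (if \<xi> = 0 then of_real ((2 * pi)\<^sup>2) else 0)"
proof -
  have "integral\<^sup>L torus (torus_char \<xi>) = integral {0..2 * pi} (\<lambda>x. integral {0..2 * pi} (\<lambda>y. torus_char \<xi> (x, y)))"
    by (rule integral_torus(2)) (intro continuous_intros)
  also have "\<dots> = integral {0..2 * pi} (\<lambda>x. cis (real_of_int (fst \<xi>) * x)) * integral {0..2 * pi} (\<lambda>y. cis (real_of_int (snd \<xi>) * y))"
    by (simp add: torus_char_def cis_mult[symmetric])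
  also have "\<dots> = (if \<xi> = 0 then of_real ((2 * pi)\<^sup>2) else 0)"
    by (cases \<xi>) (auto simp: integral_cis_period power2_eq_square zero_prod_def)
  finally show ?thesis .
qed

lemma integrable_mult_bounded_torus:
  fixes f g :: "real \<times> real \<Rightarrow> complex"
  assumes "integrable torus f" "g \<in> borel_measurable torus" "\<And>p. norm (g p) \<le> B"
  shows "integrable torus (\<lambda>p. f p * g p)"
proof (rule Bochner_Integration.integrable_bound)
  show "integrable torus (\<lambda>p. B * norm (f p))" using assms(1) by auto
  show "(\<lambda>p. f p * g p) \<in> borel_measurable torus" using assms(1,2) by measurable
  show "AE p in torus. norm (f p * g p) \<le> norm (B * norm (f p))"
  proof (rule AE_I2)
    fix p
    have "0 \<le> B" using assms(3)[of p] norm_ge_zero order_trans by blast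
    moreover have "norm (f p) * norm (g p) \<le> norm (f p) * B" by (intro mult_left_mono assms(3)) simp
    ultimately show "norm (f p * g p) \<le> norm (B * norm (f p))" by (simp add: norm_mult mult.commute)
  qed
qed

lemma integrable_mult_char:
  "integrable torus f \<Longrightarrow> integrable torus (\<lambda>p. f p * torus_char \<xi> p)"
  by (rule integrable_mult_bounded_torus[where B = 1]) auto

section \<open>Integrable functions orthogonal to all characters\<close>

definition char_free :: "(real \<times> real \<Rightarrow> complex) \<Rightarrow> bool" where
  "char_free h \<longleftrightarrow> integrable torus h \<and> (\<forall>\<xi>. (\<integral>p. h p * torus_char \<xi> p \<partial>torus) = 0)"

lemma char_free_mult_char:
  assumes "char_free h"
  shows "char_free (\<lambda>p. h p * torus_char \<eta> p)"
  unfolding char_free_def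
proof (intro conjI allI)
  show "integrable torus (\<lambda>p. h p * torus_char \<eta> p)"
    using assms by (simp add: char_free_def integrable_mult_char)
  fix \<xi>
  have "(\<integral>p. h p * torus_char \<eta> p * torus_char \<xi> p \<partial>torus) = (\<integral>p. h p * torus_char (\<eta> + \<xi>) p \<partial>torus)"
    by (simp add: torus_char_add mult.assoc)
  then show "(\<integral>p. h p * torus_char \<eta> p * torus_char \<xi> p \<partial>torus) = 0"
    using assms unfolding char_free_def by metis
qed

lemma char_free_integral:
  assumes "char_free h"
  shows "integral\<^sup>L torus h = 0"
proof -
  have "(\<integral>p. h p * torus_char 0 p \<partial>torus) = 0" using assms unfolding char_free_def by blast
  then show ?thesis by simp
qed

lemma char_free_add: "char_free h \<Longrightarrow> char_free g \<Longrightarrow> char_free (\<lambda>p. h p + g p)"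
  by (auto simp: char_free_def distrib_right integrable_mult_char)

lemma char_free_cmult: "char_free h \<Longrightarrow> char_free (\<lambda>p. c * h p)"
  by (auto simp: char_free_def mult.assoc)

text \<open>Realises the quotient by the periods as a compact subset of a Euclidean space, where
  Stone-Weierstrass applies. Functions of \<open>torus_embed p\<close> are automatically
  periodic.\<close>

definition torus_embed :: "real \<times> real \<Rightarrow> complex \<times> complex" where
  "torus_embed p = (cis (fst p), cis (snd p))"

lemma continuous_on_torus_embed: "continuous_on S torus_embed"
  unfolding torus_embed_def by (intro continuous_intros)

lemma torus_embed_sphere: "torus_embed p \<in> sphere 0 1 \<times> sphere 0 1"
  by (simp add: torus_embed_def)

text \<open>The real coordinates of \<open>torus_embed p\<close> are sines and cosines, hence
  combinations of characters, and multiplication by a character only permutes the coefficients that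
  vanish. The claim is proved for all \<open>h\<close> at once so that a product of polynomials is
  handled by multiplying twice.\<close>

lemma char_free_polynomial:
  assumes "real_polynomial_function g" "char_free h"
  shows "char_free (\<lambda>p. h p * of_real (g (torus_embed p)))"
  using assms
proof (induction arbitrary: h rule: real_polynomial_function.induct)
  case (linear f)
  interpret bounded_linear f by fact
  have split: "f (z, w) = Re z * f (1, 0) + Im z * f (\<i>, 0) + Re w * f (0, 1) + Im w * f (0, \<i>)" for z w
  proof -
    have "(z, w) = Re z *\<^sub>R (1, 0) + Im z *\<^sub>R (\<i>, 0) + Re w *\<^sub>R (0, 1) + Im w *\<^sub>R (0, \<i>)"
      by (auto simp: complex_eq_iff)
    then have "f (z, w) = f (Re z *\<^sub>R (1, 0) + Im z *\<^sub>R (\<i>, 0) + Re w *\<^sub>R (0, 1) + Im w *\<^sub>R (0, \<i>))" by simp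
    then show ?thesis by (simp only: add scaleR) simp
  qed
  have trig: "complex_of_real (cos (fst p)) = (torus_char (1, 0) p + torus_char (- 1, 0) p) / 2"
    "complex_of_real (sin (fst p)) = - \<i> / 2 * (torus_char (1, 0) p - torus_char (- 1, 0) p)"
    "complex_of_real (cos (snd p)) = (torus_char (0, 1) p + torus_char (0, - 1) p) / 2"
    "complex_of_real (sin (snd p)) = - \<i> / 2 * (torus_char (0, 1) p - torus_char (0, - 1) p)" for p
    by (simp_all add: torus_char_def complex_eq_iff)
  have cs: "char_free (\<lambda>p. h p * ((torus_char \<xi> p + torus_char \<eta> p) / 2))"
    "char_free (\<lambda>p. h p * (- \<i> / 2 * (torus_char \<xi> p - torus_char \<eta> p)))" for \<xi> \<eta>
  proof -
    note m = char_free_mult_char[OF \<open>char_free h\<close>]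
    show "char_free (\<lambda>p. h p * ((torus_char \<xi> p + torus_char \<eta> p) / 2))"
      using char_free_cmult[OF char_free_add[OF m[of \<xi>] m[of \<eta>]], of "1 / 2"]
      by (simp add: distrib_left add_divide_distrib)
    show "char_free (\<lambda>p. h p * (- \<i> / 2 * (torus_char \<xi> p - torus_char \<eta> p)))"
      using char_free_cmult[OF char_free_add[OF m[of \<xi>] char_free_cmult[OF m[of \<eta>], of "- 1"]], of "- \<i> / 2"]
      by (simp add: algebra_simps)
  qed
  have "char_free (\<lambda>p. of_real (f (1, 0)) * (h p * of_real (cos (fst p))) + of_real (f (\<i>, 0)) * (h p * of_real (sin (fst p)))
      + of_real (f (0, 1)) * (h p * of_real (cos (snd p))) + of_real (f (0, \<i>)) * (h p * of_real (sin (snd p))))"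
    unfolding trig by (intro char_free_add char_free_cmult cs)
  also have "(\<lambda>p. of_real (f (1, 0)) * (h p * of_real (cos (fst p))) + of_real (f (\<i>, 0)) * (h p * of_real (sin (fst p)))
      + of_real (f (0, 1)) * (h p * of_real (cos (snd p))) + of_real (f (0, \<i>)) * (h p * of_real (sin (snd p)))) =
      (\<lambda>p. h p * of_real (f (torus_embed p)))"
  proof
    fix p
    have "f (torus_embed p) = cos (fst p) * f (1, 0) + sin (fst p) * f (\<i>, 0) + cos (snd p) * f (0, 1) + sin (snd p) * f (0, \<i>)"
      by (simp only: torus_embed_def split[of "cis (fst p)" "cis (snd p)"] cis.sel)
    then have "complex_of_real (f (torus_embed p)) = of_real (cos (fst p)) * of_real (f (1, 0)) + of_real (sin (fst p)) * of_real (f (\<i>, 0))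
        + of_real (cos (snd p)) * of_real (f (0, 1)) + of_real (sin (snd p)) * of_real (f (0, \<i>))"
      by (simp only: of_real_add of_real_mult)
    then show "of_real (f (1, 0)) * (h p * of_real (cos (fst p))) + of_real (f (\<i>, 0)) * (h p * of_real (sin (fst p)))
      + of_real (f (0, 1)) * (h p * of_real (cos (snd p))) + of_real (f (0, \<i>)) * (h p * of_real (sin (snd p))) =
      h p * of_real (f (torus_embed p))"
      by (simp only: distrib_left mult_ac)
  qed
  finally show ?case .
next
  case (const c)
  then show ?case using char_free_cmult[of h "of_real c"] by (simp add: mult.commute)
next
  case (add f g)
  then show ?case using char_free_add[OF add.IH(1)[OF add.prems] add.IH(2)[OF add.prems]]
    by (simp add: distrib_left)
next
  case (mult f g)
  then show ?case using mult.IH(2)[OF mult.IH(1)[OF mult.prems]]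
    by (simp add: mult.assoc)
qed

text \<open>Uniform approximation of \<open>f\<close> by polynomials on the compact image changes
  the integral by at most \<open>e\<close> times the L^1 norm of \<open>h\<close>.\<close>

lemma char_free_continuous:
  fixes f :: "complex \<times> complex \<Rightarrow> real"
  assumes h: "char_free h" and f: "continuous_on UNIV f"
  shows "(\<integral>p. h p * of_real (f (torus_embed p)) \<partial>torus) = 0"
proof -
  define J where "J = norm (\<integral>p. h p * of_real (f (torus_embed p)) \<partial>torus)"
  have hi: "integrable torus h" using h by (simp add: char_free_def)
  have S: "compact (sphere 0 1 \<times> sphere 0 1 :: (complex \<times> complex) set)" by (intro compact_Times compact_sphere)
  have fS: "continuous_on (sphere 0 1 \<times> sphere 0 1) f" using f continuous_on_subset by blast
  from compact_imp_bounded[OF compact_continuous_image[OF fS S]]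
  obtain B where B: "\<bar>f z\<bar> \<le> B" if "z \<in> sphere 0 1 \<times> sphere 0 1" for z
    unfolding bounded_iff by auto
  have fm: "(\<lambda>p. of_real (f (torus_embed p)) :: complex) \<in> borel_measurable torus"
    by (intro measurable_torus borel_measurable_continuous_onI continuous_intros
        continuous_on_compose2[OF f continuous_on_torus_embed]) auto
  have fi: "integrable torus (\<lambda>p. h p * of_real (f (torus_embed p)))"
    using B[OF torus_embed_sphere] by (intro integrable_mult_bounded_torus[OF hi fm, of B]) auto
  have "J \<le> e * (\<integral>p. norm (h p) \<partial>torus)" if e: "0 < e" for e
  proof -
    obtain g where g: "real_polynomial_function g" "\<And>z. z \<in> sphere 0 1 \<times> sphere 0 1 \<Longrightarrow> \<bar>f z - g z\<bar> < e"
      by (rule Stone_Weierstrass_real_polynomial_function[OF S fS e]) blast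
    note gh = char_free_polynomial[OF g(1) h]
    have gi: "integrable torus (\<lambda>p. h p * of_real (g (torus_embed p)))"
      and g0: "(\<integral>p. h p * of_real (g (torus_embed p)) \<partial>torus) = 0"
      using gh char_free_integral[OF gh] by (simp_all add: char_free_def)
    have "(\<integral>p. h p * of_real (f (torus_embed p)) \<partial>torus) =
        (\<integral>p. h p * of_real (f (torus_embed p)) - h p * of_real (g (torus_embed p)) \<partial>torus)"
      using fi gi g0 by (subst Bochner_Integration.integral_diff) auto
    then have "J \<le> (\<integral>p. norm (h p * of_real (f (torus_embed p)) - h p * of_real (g (torus_embed p))) \<partial>torus)"
      unfolding J_def by (simp add: integral_norm_bound)
    also have "\<dots> \<le> (\<integral>p. e * norm (h p) \<partial>torus)"
    proof (rule integral_mono)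
      show "integrable torus (\<lambda>p. norm (h p * of_real (f (torus_embed p)) - h p * of_real (g (torus_embed p))))"
        using fi gi by auto
      show "integrable torus (\<lambda>p. e * norm (h p))" using hi by auto
      fix p
      have "norm (h p * of_real (f (torus_embed p)) - h p * of_real (g (torus_embed p))) =
          norm (h p) * \<bar>f (torus_embed p) - g (torus_embed p)\<bar>"
        by (simp only: right_diff_distrib[symmetric] of_real_diff[symmetric] norm_mult norm_of_real)
      also have "\<dots> \<le> norm (h p) * e"
        using g(2)[OF torus_embed_sphere, of p] by (intro mult_left_mono) auto
      finally show "norm (h p * of_real (f (torus_embed p)) - h p * of_real (g (torus_embed p))) \<le> e * norm (h p)"
        by (simp add: mult.commute)
    qed
    also have "\<dots> = e * (\<integral>p. norm (h p) \<partial>torus)" by simp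
    finally show ?thesis .
  qed note le = this
  define I where "I = (\<integral>p. norm (h p) \<partial>torus)"
  have "I \<ge> 0" unfolding I_def by (rule Bochner_Integration.integral_nonneg) auto
  have "J \<le> 0"
  proof (rule field_le_epsilon)
    fix e :: real assume "0 < e"
    then have "0 < e / (I + 1)" using \<open>I \<ge> 0\<close> by simp
    then have "J \<le> e / (I + 1) * I" unfolding I_def by (rule le)
    also have "\<dots> \<le> e" using \<open>0 < e\<close> \<open>I \<ge> 0\<close> by (simp add: field_simps)
    finally show "J \<le> 0 + e" by simp
  qed
  then show ?thesis by (simp add: J_def)
qed

text \<open>\<open>torus_embed\<close> identifies opposite edges of the closed cell; removing them
  costs only a null set.\<close>

lemma AE_torus_interior: "AE p in torus. p \<in> {0<..<2 * pi} \<times> {0<..<2 * pi}"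
proof -
  have ae: "AE p in lborel. p \<in> cell \<longrightarrow> p \<in> box (0, 0) (2 * pi, 2 * pi)"
  proof (rule AE_I')
    show "cbox (0, 0) (2 * pi, 2 * pi) - box (0, 0) (2 * pi, 2 * pi) \<in> null_sets lborel"
      using negligible_frontier_interval[of "(0, 0)" "(2 * pi, 2 * pi)"]
      by (subst null_sets_completion_iff[symmetric]) (auto simp: negligible_iff_null_sets)
  qed (auto simp: cell_eq_cbox)
  have "AE p in torus. p \<in> box (0, 0) (2 * pi, 2 * pi)"
    unfolding torus_def by (subst AE_restrict_space_iff) (use ae in auto)
  then show ?thesis
    by eventually_elim (auto simp: box_def Basis_prod_def)
qed

text \<open>The hypotheses are asymmetric because \<open>q\<close> will come from a closed subset of
  the cell and may lie on an edge, while \<open>p\<close> is a generic point. Two numbers with the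
  same sine and cosine differ by a multiple of \<open>2 * pi\<close>, and here they are less than
  one period apart.\<close>

lemma torus_embed_inj:
  assumes "p \<in> {0<..<2 * pi} \<times> {0<..<2 * pi}" "q \<in> cell" "torus_embed p = torus_embed q"
  shows "p = q"
proof -
  have *: "x = y" if "0 < x" "x < 2 * pi" "0 \<le> y" "y \<le> 2 * pi" "cis x = cis y" for x y :: real
  proof -
    have "sin x = sin y \<and> cos x = cos y" using that(5) by (auto simp: complex_eq_iff)
    then obtain n :: int where n: "x = y + 2 * pi * of_int n" using sin_cos_eq_iff[of x y] by auto
    have "- 1 < real_of_int n" and "real_of_int n < 1"
    proof -
      have "2 * pi * (- 1) < 2 * pi * real_of_int n" using n that by linarith
      then show "- 1 < real_of_int n" by (subst (asm) mult_less_cancel_left_pos) auto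
      have "2 * pi * real_of_int n < 2 * pi * 1" using n that by linarith
      then show "real_of_int n < 1" by (subst (asm) mult_less_cancel_left_pos) auto
    qed
    then have "n = 0" by linarith
    with n show ?thesis by simp
  qed
  show ?thesis
    using assms by (cases p; cases q) (auto simp: torus_embed_def intro!: *)
qed

text \<open>The indicator of the image of \<open>A\<close> is a pointwise limit of continuous
  cutoffs of the distance to it. Pulled back to the cell, that indicator agrees with the indicator
  of \<open>A\<close> off the edges.\<close>

lemma char_free_closed:
  assumes h: "char_free h" and A: "closed A"
  shows "(\<integral>p. h p * indicator A p \<partial>torus) = 0"
proof (cases "A \<inter> cell = {}")
  \<comment> \<open>Kept apart because \<open>infdist\<close> to the empty set is \<open>0\<close>,
    so the cutoffs \<open>f n\<close> below would be constantly \<open>1\<close>.\<close>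
  case True
  have "(\<integral>p. h p * indicator A p \<partial>torus) = (\<integral>p. 0 \<partial>torus)"
    by (rule Bochner_Integration.integral_cong) (use True in \<open>auto simp: indicator_def\<close>)
  then show ?thesis by simp
next
  case False
  define C where "C = torus_embed ` (A \<inter> cell)"
  have "compact (A \<inter> cell)" unfolding cell_eq_cbox using A by (intro closed_Int_compact) auto
  then have C: "compact C" "C \<noteq> {}"
    using False by (auto simp: C_def intro!: compact_continuous_image continuous_on_torus_embed)
  define f where "f n z = max 0 (1 - real n * infdist z C)" for n z
  have fc: "continuous_on UNIV (f n)" for n unfolding f_def by (intro continuous_intros)
  have f01: "0 \<le> f n z" "f n z \<le> 1" for n z
    unfolding f_def using infdist_nonneg[of z C] by auto
  have fl: "(\<lambda>n. f n z) \<longlonglongrightarrow> indicator C z" for z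
  proof (cases "z \<in> C")
    case True
    then show ?thesis by (simp add: f_def)
  next
    case False
    then have d: "0 < infdist z C"
      using C compact_imp_closed infdist_pos_not_in_closed by blast
    obtain N where "1 / infdist z C < real N" using reals_Archimedean2 by blast
    then have "f n z = 0" if "N \<le> n" for n
    proof -
      have "1 < real N * infdist z C" using \<open>1 / infdist z C < real N\<close> d by (simp add: field_simps)
      also have "\<dots> \<le> real n * infdist z C" using that d by (intro mult_right_mono) auto
      finally show ?thesis by (simp add: f_def)
    qed
    then have "eventually (\<lambda>n. f n z = 0) sequentially" by (auto simp: eventually_sequentially)
    then show ?thesis using False by (simp add: tendsto_eventually)
  qed
  have hi: "integrable torus h" using h by (simp add: char_free_def)
  have fm: "(\<lambda>p. of_real (f n (torus_embed p)) :: complex) \<in> borel_measurable torus" for n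
    by (intro measurable_torus borel_measurable_continuous_onI continuous_intros
        continuous_on_compose2[OF fc continuous_on_torus_embed]) auto
  have "(\<lambda>n. \<integral>p. h p * of_real (f n (torus_embed p)) \<partial>torus) \<longlonglongrightarrow> (\<integral>p. h p * indicator A p \<partial>torus)"
  proof (rule integral_dominated_convergence)
    show "(\<lambda>p. h p * indicator A p) \<in> borel_measurable torus"
      using borel_measurable_integrable[OF hi] A
      by (intro borel_measurable_times measurable_torus[of "indicator A"] borel_measurable_indicator) auto
    show "(\<lambda>p. h p * of_real (f n (torus_embed p))) \<in> borel_measurable torus" for n
      using hi fm by (intro borel_measurable_times) auto
    show "integrable torus (\<lambda>p. norm (h p))" using hi by auto
    show "AE p in torus. (\<lambda>n. h p * of_real (f n (torus_embed p))) \<longlonglongrightarrow> h p * indicator A p"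
      using AE_torus_interior
    proof eventually_elim
      case (elim p)
      have "indicator C (torus_embed p) = (indicator A p :: real)"
        using elim torus_embed_inj[OF elim] by (auto simp: C_def indicator_def image_iff)
      then have "(\<lambda>n. f n (torus_embed p)) \<longlonglongrightarrow> (indicator A p :: real)" using fl[of "torus_embed p"] by simp
      from tendsto_mult[OF tendsto_const[of "h p"] tendsto_of_real[OF this]]
      show ?case by (auto simp: indicator_def split: if_splits)
    qed
    show "AE p in torus. norm (h p * of_real (f n (torus_embed p))) \<le> norm (h p)" for n
      using f01 by (intro AE_I2) (auto simp: norm_mult mult_left_le)
  qed
  then show ?thesis
    unfolding char_free_continuous[OF h fc] by (simp add: LIMSEQ_const_iff)
qed

text \<open>Closed sets are stable under intersection and generate the Borel sets, so the integral
  of \<open>h\<close> over every Borel set vanishes; in particular over the sets where a real or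
  imaginary part has a fixed sign.\<close>

lemma char_free_imp_AE_zero:
  assumes h: "char_free h"
  shows "AE p in torus. h p = 0"
proof -
  have hi: "integrable torus h" using h by (simp add: char_free_def)
  have hb: "(\<integral>p. h p * indicator A p \<partial>torus) = 0" if "A \<in> sets borel" for A
  proof -
    have A: "A \<in> sigma_sets UNIV (Collect closed)" using that by (simp add: borel_eq_closed)
    have ind: "integrable torus (\<lambda>p. h p * indicator B p)" if "B \<in> sigma_sets UNIV (Collect closed)" for B
      using that by (intro integrable_mult_bounded_torus[OF hi, of _ 1] measurable_torus borel_measurable_indicator)
        (auto simp: borel_eq_closed indicator_def)
    show ?thesis
    proof (rule sigma_sets_induct_disjoint[OF _ _ A])
      show "Int_stable (Collect closed :: (real \<times> real) set set)" by (auto simp: Int_stable_def)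
      show "(Collect closed :: (real \<times> real) set set) \<subseteq> Pow UNIV" by simp
      show "(\<integral>p. h p * indicator B p \<partial>torus) = 0" if "B \<in> Collect closed" for B
        using char_free_closed[OF h] that by simp
      show "(\<integral>p. h p * indicator {} p \<partial>torus) = 0" by simp
      show "(\<integral>p. h p * indicator (UNIV - B) p \<partial>torus) = 0"
        if B: "B \<in> sigma_sets UNIV (Collect closed)" "(\<integral>p. h p * indicator B p \<partial>torus) = 0" for B
      proof -
        have "(\<integral>p. h p * indicator (UNIV - B) p \<partial>torus) = (\<integral>p. h p - h p * indicator B p \<partial>torus)"
          by (intro Bochner_Integration.integral_cong) (auto simp: indicator_def)
        also have "\<dots> = (\<integral>p. h p \<partial>torus) - 0"
          using hi ind[OF B(1)] B(2) by (subst Bochner_Integration.integral_diff) auto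
        finally show ?thesis using char_free_integral[OF h] by simp
      qed
      show "(\<integral>p. h p * indicator (\<Union>i. B i) p \<partial>torus) = 0"
        if B: "disjoint_family B" "range B \<subseteq> sigma_sets UNIV (Collect closed)"
          "\<And>i::nat. (\<integral>p. h p * indicator (B i) p \<partial>torus) = 0" for B
      proof -
        have "(\<integral>p. h p * indicator (\<Union>i<n. B i) p \<partial>torus) = 0" for n
        proof -
          have "disjoint_family_on B {..<n}"
            using B(1) by (auto simp: disjoint_family_on_def)
          then have "(\<integral>p. h p * indicator (\<Union>i<n. B i) p \<partial>torus) = (\<integral>p. (\<Sum>i<n. h p * indicator (B i) p) \<partial>torus)"
            by (simp add: indicator_UN_disjoint sum_distrib_left)
          also have "\<dots> = (\<Sum>i<n. \<integral>p. h p * indicator (B i) p \<partial>torus)"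
            using B(2) by (intro Bochner_Integration.integral_sum ind) auto
          finally show ?thesis using B(3) by simp
        qed
        moreover have "(\<lambda>n. \<integral>p. h p * indicator (\<Union>i<n. B i) p \<partial>torus) \<longlonglongrightarrow> (\<integral>p. h p * indicator (\<Union>i. B i) p \<partial>torus)"
        proof (rule integral_dominated_convergence)
          have Bb: "B i \<in> sets borel" for i using B(2) by (auto simp: borel_eq_closed)
          have Ub: "(\<Union>i<n. B i) \<in> sets borel" "(\<Union>i. B i) \<in> sets borel" for n using Bb by auto
          show "(\<lambda>p. h p * indicator (\<Union>i. B i) p) \<in> borel_measurable torus"
            by (intro borel_measurable_times measurable_torus[OF borel_measurable_indicator] Ub borel_measurable_integrable[OF hi])
          show "(\<lambda>p. h p * indicator (\<Union>i<n. B i) p) \<in> borel_measurable torus" for n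
            by (intro borel_measurable_times measurable_torus[OF borel_measurable_indicator] Ub borel_measurable_integrable[OF hi])
          show "integrable torus (\<lambda>p. norm (h p))" using hi by auto
          show "AE p in torus. (\<lambda>n. h p * indicator (\<Union>i<n. B i) p) \<longlonglongrightarrow> h p * indicator (\<Union>i. B i) p"
            by (intro AE_I2 tendsto_mult tendsto_const LIMSEQ_indicator_UN)
          show "AE p in torus. norm (h p * indicator (\<Union>i<n. B i) p) \<le> norm (h p)" for n
            by (intro AE_I2) (auto simp: indicator_def)
        qed
        ultimately show ?thesis by (simp add: LIMSEQ_const_iff)
      qed
    qed
  qed
  \<comment> \<open>Applied to \<open>c = 1, - 1, \<i>, - \<i>\<close>, this bounds both the real
    and the imaginary part from both sides.\<close>
  have nonpos: "AE p in torus. Re (c * h p) \<le> 0" for c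
  proof -
    have ci: "integrable torus (\<lambda>p. c * h p)" using hi by simp
    then have [measurable]: "(\<lambda>p. Re (c * h p)) \<in> borel_measurable torus"
      by (intro borel_measurable_integrable integrable_Re)
    define A where "A = {p \<in> space torus. 0 < Re (c * h p)}"
    have A: "A \<in> sets borel" unfolding A_def by (rule sets_torus) measurable
    have cAi: "integrable torus (\<lambda>p. c * h p * indicator A p)"
      using A by (intro integrable_mult_bounded_torus[OF ci, of _ 1] measurable_torus[of "indicator A"] borel_measurable_indicator)
        (auto simp: indicator_def)
    have "(\<integral>p. c * h p * indicator A p \<partial>torus) = 0"
      using hb[OF A] by (simp add: mult.assoc)
    then have "(\<integral>p. Re (c * h p * indicator A p) \<partial>torus) = 0"
      using integral_Re[OF cAi] by simp
    moreover have eq: "Re (c * h p * indicator A p) = Re (c * h p) * indicator A p" for p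
      by (auto simp: indicator_def)
    moreover have nn: "0 \<le> Re (c * h p) * indicator A p" for p
      by (auto simp: A_def indicator_def)
    ultimately have "AE p in torus. Re (c * h p) * indicator A p = 0"
      using integral_nonneg_eq_0_iff_AE[of torus "\<lambda>p. Re (c * h p) * indicator A p"] integrable_Re[OF cAi] by simp
    then show ?thesis
    proof (rule AE_mp, intro AE_I2 impI)
      fix p assume "p \<in> space torus" "Re (c * h p) * indicator A p = 0"
      then show "Re (c * h p) \<le> 0" by (auto simp: A_def indicator_def split: if_splits)
    qed
  qed
  show ?thesis
    using nonpos[of 1] nonpos[of "- 1"] nonpos[of \<i>] nonpos[of "- \<i>"]
    by eventually_elim (auto simp: complex_eq_iff)
qed

section \<open>Fourier series of square-integrable functions\<close>

lemma L2_mult_integrable: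
  assumes "u \<in> L2_torus" "v \<in> L2_torus"
  shows "integrable torus (\<lambda>p. u p * v p)"
proof (rule Bochner_Integration.integrable_bound)
  show "integrable torus (\<lambda>p. (u p)\<^sup>2 + (v p)\<^sup>2)" using assms by (auto simp: L2_torus_def)
  show "(\<lambda>p. u p * v p) \<in> borel_measurable torus"
    using assms by (auto simp: L2_torus_def intro!: borel_measurable_times)
  show "AE p in torus. norm (u p * v p) \<le> norm ((u p)\<^sup>2 + (v p)\<^sup>2)"
  proof (rule AE_I2)
    fix p
    have "2 * \<bar>u p\<bar> * \<bar>v p\<bar> \<le> \<bar>u p\<bar>\<^sup>2 + \<bar>v p\<bar>\<^sup>2" by (rule sum_squares_bound)
    moreover have "0 \<le> \<bar>u p\<bar> * \<bar>v p\<bar>" by simp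
    ultimately have "\<bar>u p\<bar> * \<bar>v p\<bar> \<le> (u p)\<^sup>2 + (v p)\<^sup>2" unfolding power2_abs by linarith
    then show "norm (u p * v p) \<le> norm ((u p)\<^sup>2 + (v p)\<^sup>2)"
      by (simp add: abs_mult)
  qed
qed

lemma bounded_in_L2_torus:
  assumes "periodic w" "w \<in> borel_measurable torus" "\<And>p. \<bar>w p\<bar> \<le> 1"
  shows "w \<in> L2_torus"
  unfolding L2_torus_def
proof (intro CollectI conjI assms(1,2))
  show "integrable torus (\<lambda>p. (w p)\<^sup>2)"
    using assms(2,3) by (intro torus.integrable_const_bound[where B = 1]) (auto simp: abs_square_le_1)
qed

lemma L2_integrable:
  assumes "u \<in> L2_torus"
  shows "integrable torus u"
proof -
  have "(\<lambda>_. 1) \<in> L2_torus" by (rule bounded_in_L2_torus) (auto simp: periodic_def)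
  from L2_mult_integrable[OF assms this] show ?thesis by simp
qed

lemma L2_measurable: "u \<in> L2_torus \<Longrightarrow> u \<in> borel_measurable torus"
  by (simp add: L2_torus_def)

lemma integrable_of_real_char:
  assumes "integrable torus u"
  shows "integrable torus (\<lambda>p. of_real (u p) * torus_char \<xi> p)"
  using assms by (intro integrable_mult_char) auto

lemma fourier_add:
  assumes "integrable torus u" "integrable torus v"
  shows "fourier (\<lambda>p. u p + v p) \<xi> = fourier u \<xi> + fourier v \<xi>"
  unfolding fourier_char
  by (simp add: distrib_right add_divide_distrib integrable_of_real_char assms)

lemma fourier_cmult: "fourier (\<lambda>p. c * u p) \<xi> = of_real c * fourier u \<xi>"
  unfolding fourier_char by (simp add: mult.assoc)

lemma fourier_diff:
  assumes "integrable torus u" "integrable torus v"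
  shows "fourier (\<lambda>p. u p - v p) \<xi> = fourier u \<xi> - fourier v \<xi>"
  using fourier_add[OF assms(1), of "\<lambda>p. - 1 * v p" \<xi>] assms(2) fourier_cmult[of "- 1" v \<xi>] by simp

lemma fourier_cong_AE:
  assumes "u \<in> borel_measurable torus" "v \<in> borel_measurable torus" "AE p in torus. u p = v p"
  shows "fourier u \<xi> = fourier v \<xi>"
proof -
  have "(\<integral>p. of_real (u p) * torus_char (- \<xi>) p \<partial>torus) = (\<integral>p. of_real (v p) * torus_char (- \<xi>) p \<partial>torus)"
    by (rule integral_cong_AE) (use assms in \<open>auto intro!: borel_measurable_times borel_measurable_of_real\<close>)
  then show ?thesis by (simp add: fourier_char)
qed

lemma fourier_uminus_index: "fourier u (- \<xi>) = cnj (fourier u \<xi>)"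
proof -
  have "(\<integral>p. of_real (u p) * torus_char (- (- \<xi>)) p \<partial>torus) = (\<integral>p. cnj (of_real (u p) * torus_char (- \<xi>) p) \<partial>torus)"
    by (simp add: cnj_torus_char)
  also have "\<dots> = cnj (\<integral>p. of_real (u p) * torus_char (- \<xi>) p \<partial>torus)" by (rule Bochner_Integration.integral_cnj)
  finally show ?thesis unfolding fourier_char by simp
qed

lemma sobolev_2_iff: "u \<in> sobolev 2 \<longleftrightarrow> u \<in> L2_torus \<and> h2 (fourier u)"
  by (simp add: sobolev_def h2_def bracket_def)

lemma sobolev_norm_2: "sobolev_norm 2 u = sqrt (h2_sq (fourier u))"
  by (simp add: sobolev_norm_def h2_sq_def bracket_def)

text \<open>The partial sums over boxes are bounded by the l^1 norm of \<open>c\<close>, so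
  dominated convergence with the majorant \<open>A * norm (v p)\<close> exchanges sum and
  integral.\<close>

lemma fourier_series_integral:
  fixes c :: "int \<times> int \<Rightarrow> complex"
  assumes c: "(\<lambda>\<xi>. norm (c \<xi>)) summable_on UNIV" and v: "integrable torus v"
  shows "integrable torus (\<lambda>p. (\<Sum>\<^sub>\<infinity>\<xi>. c \<xi> * torus_char \<xi> p) * v p)"
    and "(\<integral>p. (\<Sum>\<^sub>\<infinity>\<xi>. c \<xi> * torus_char \<xi> p) * v p \<partial>torus) = (\<Sum>\<^sub>\<infinity>\<xi>. c \<xi> * (\<integral>p. v p * torus_char \<xi> p \<partial>torus))"
proof -
  define A where "A = (\<Sum>\<^sub>\<infinity>\<xi>. norm (c \<xi>))"
  have sc: "(\<lambda>\<xi>. c \<xi> * torus_char \<xi> p) summable_on UNIV" for p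
    by (rule abs_summable_summable) (use c in \<open>simp add: norm_mult\<close>)
  have lim: "(\<lambda>n. \<Sum>\<xi>\<in>freq_box n. c \<xi> * torus_char \<xi> p) \<longlonglongrightarrow> (\<Sum>\<^sub>\<infinity>\<xi>. c \<xi> * torus_char \<xi> p)" for p
    by (rule sum_freq_box_tendsto[OF sc])
  have meas: "(\<lambda>p. \<Sum>\<^sub>\<infinity>\<xi>. c \<xi> * torus_char \<xi> p) \<in> borel_measurable torus"
    by (rule borel_measurable_LIMSEQ_metric[OF _ lim]) measurable
  have bound: "norm (\<Sum>\<xi>\<in>freq_box n. c \<xi> * torus_char \<xi> p) \<le> A" for n p
  proof -
    have "norm (\<Sum>\<xi>\<in>freq_box n. c \<xi> * torus_char \<xi> p) \<le> (\<Sum>\<xi>\<in>freq_box n. norm (c \<xi>))"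
      by (rule order_trans[OF norm_sum]) (simp add: norm_mult)
    also have "\<dots> \<le> A" unfolding A_def using c by (intro finite_sum_le_infsum) auto
    finally show ?thesis .
  qed
  have vm: "v \<in> borel_measurable torus" using v by auto
  have dct: "integrable torus (\<lambda>p. (\<Sum>\<^sub>\<infinity>\<xi>. c \<xi> * torus_char \<xi> p) * v p)"
    "(\<lambda>n. \<integral>p. (\<Sum>\<xi>\<in>freq_box n. c \<xi> * torus_char \<xi> p) * v p \<partial>torus) \<longlonglongrightarrow> (\<integral>p. (\<Sum>\<^sub>\<infinity>\<xi>. c \<xi> * torus_char \<xi> p) * v p \<partial>torus)"
  proof -
    have 1: "(\<lambda>p. (\<Sum>\<^sub>\<infinity>\<xi>. c \<xi> * torus_char \<xi> p) * v p) \<in> borel_measurable torus"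
      by (intro borel_measurable_times meas vm)
    have 2: "(\<lambda>p. (\<Sum>\<xi>\<in>freq_box n. c \<xi> * torus_char \<xi> p) * v p) \<in> borel_measurable torus" for n
      by (intro borel_measurable_times borel_measurable_sum vm) auto
    have 3: "integrable torus (\<lambda>p. A * norm (v p))" using v by auto
    have 4: "AE p in torus. (\<lambda>n. (\<Sum>\<xi>\<in>freq_box n. c \<xi> * torus_char \<xi> p) * v p) \<longlonglongrightarrow> (\<Sum>\<^sub>\<infinity>\<xi>. c \<xi> * torus_char \<xi> p) * v p"
      by (intro AE_I2 tendsto_mult lim tendsto_const)
    have 5: "AE p in torus. norm ((\<Sum>\<xi>\<in>freq_box n. c \<xi> * torus_char \<xi> p) * v p) \<le> A * norm (v p)" for n
      unfolding norm_mult by (intro AE_I2 mult_right_mono bound) simp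
    show "integrable torus (\<lambda>p. (\<Sum>\<^sub>\<infinity>\<xi>. c \<xi> * torus_char \<xi> p) * v p)"
      by (rule integrable_dominated_convergence[OF 1 2 3 4 5])
    show "(\<lambda>n. \<integral>p. (\<Sum>\<xi>\<in>freq_box n. c \<xi> * torus_char \<xi> p) * v p \<partial>torus) \<longlonglongrightarrow> (\<integral>p. (\<Sum>\<^sub>\<infinity>\<xi>. c \<xi> * torus_char \<xi> p) * v p \<partial>torus)"
      by (rule integral_dominated_convergence[OF 1 2 3 4 5])
  qed
  show "integrable torus (\<lambda>p. (\<Sum>\<^sub>\<infinity>\<xi>. c \<xi> * torus_char \<xi> p) * v p)" by (rule dct(1))
  have fin: "(\<integral>p. (\<Sum>\<xi>\<in>freq_box n. c \<xi> * torus_char \<xi> p) * v p \<partial>torus) = (\<Sum>\<xi>\<in>freq_box n. c \<xi> * (\<integral>p. v p * torus_char \<xi> p \<partial>torus))" for n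
  proof -
    have "(\<integral>p. (\<Sum>\<xi>\<in>freq_box n. c \<xi> * torus_char \<xi> p) * v p \<partial>torus) = (\<integral>p. (\<Sum>\<xi>\<in>freq_box n. c \<xi> * (v p * torus_char \<xi> p)) \<partial>torus)"
      by (intro Bochner_Integration.integral_cong) (simp_all add: sum_distrib_left sum_distrib_right mult_ac)
    also have "\<dots> = (\<Sum>\<xi>\<in>freq_box n. \<integral>p. c \<xi> * (v p * torus_char \<xi> p) \<partial>torus)"
      by (rule Bochner_Integration.integral_sum) (auto intro!: integrable_mult_char v)
    finally show ?thesis by simp
  qed
  have "(\<lambda>\<xi>. c \<xi> * (\<integral>p. v p * torus_char \<xi> p \<partial>torus)) summable_on UNIV"
  proof (rule abs_summable_summable, rule summable_on_comparison_test)
    show "(\<lambda>\<xi>. norm (c \<xi>) * (\<integral>p. norm (v p) \<partial>torus)) summable_on UNIV"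
      using c by (rule summable_on_cmult_left)
    show "norm (c \<xi> * (\<integral>p. v p * torus_char \<xi> p \<partial>torus)) \<le> norm (c \<xi>) * (\<integral>p. norm (v p) \<partial>torus)" for \<xi>
    proof -
      have "norm (\<integral>p. v p * torus_char \<xi> p \<partial>torus) \<le> (\<integral>p. norm (v p * torus_char \<xi> p) \<partial>torus)"
        by (rule integral_norm_bound)
      then show ?thesis by (simp add: norm_mult mult_left_mono)
    qed
  qed auto
  from sum_freq_box_tendsto[OF this] dct(2)
  show "(\<integral>p. (\<Sum>\<^sub>\<infinity>\<xi>. c \<xi> * torus_char \<xi> p) * v p \<partial>torus) = (\<Sum>\<^sub>\<infinity>\<xi>. c \<xi> * (\<integral>p. v p * torus_char \<xi> p \<partial>torus))"
    unfolding fin by (rule LIMSEQ_unique[rotated])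
qed

text \<open>By orthogonality of the characters the sum of the series has the same coefficients as
  \<open>u\<close>, so the difference is \<open>char_free\<close>.\<close>

lemma fourier_series_AE:
  assumes u: "u \<in> L2_torus" and c: "(\<lambda>\<xi>. norm (fourier u \<xi>)) summable_on UNIV"
  shows "AE p in torus. of_real (u p) = (\<Sum>\<^sub>\<infinity>\<xi>. fourier u \<xi> * torus_char \<xi> p)"
proof -
  define S where "S p = (\<Sum>\<^sub>\<infinity>\<xi>. fourier u \<xi> * torus_char \<xi> p)" for p
  have ui: "integrable torus (\<lambda>p. complex_of_real (u p))" using L2_integrable[OF u] by simp
  have chi: "integrable torus (torus_char \<eta>)" for \<eta>
    by (rule integral_torus(1)) (intro continuous_intros)
  note series = fourier_series_integral[OF c, folded S_def]
  have Si: "integrable torus S" using series(1)[OF chi[of 0]] by simp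
  have "char_free (\<lambda>p. of_real (u p) - S p)"
    unfolding char_free_def
  proof (intro conjI allI)
    show "integrable torus (\<lambda>p. complex_of_real (u p) - S p)" using ui Si by simp
    fix \<eta>
    have "(\<integral>p. S p * torus_char \<eta> p \<partial>torus) = (\<Sum>\<^sub>\<infinity>\<xi>. fourier u \<xi> * (\<integral>p. torus_char (\<eta> + \<xi>) p \<partial>torus))"
      using series(2)[OF chi[of \<eta>]] by (simp add: torus_char_add)
    also have "\<dots> = (\<Sum>\<^sub>\<infinity>\<xi>\<in>{- \<eta>}. fourier u \<xi> * (\<integral>p. torus_char (\<eta> + \<xi>) p \<partial>torus))"
      by (rule infsum_cong_neutral) (auto simp: integral_torus_char add_eq_0_iff2)
    also have "\<dots> = fourier u (- \<eta>) * of_real ((2 * pi)\<^sup>2)"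
      by (simp add: integral_torus_char)
    also have "\<dots> = (\<integral>p. of_real (u p) * torus_char \<eta> p \<partial>torus)"
      by (simp add: fourier_char)
    finally show "(\<integral>p. (of_real (u p) - S p) * torus_char \<eta> p \<partial>torus) = 0"
      using integrable_mult_char[OF ui] integrable_mult_char[OF Si] by (simp add: left_diff_distrib)
  qed
  from char_free_imp_AE_zero[OF this] show ?thesis
    by eventually_elim (simp add: S_def)
qed

text \<open>Only \<open>u\<close> is expanded into its series, so \<open>v\<close> may be any L^2
  function. In the equation \<open>v\<close> is the derivative of \<open>u\<close>, known here only
  as an element of L^2.\<close>

lemma fourier_mult:
  assumes u: "u \<in> L2_torus" "(\<lambda>\<xi>. norm (fourier u \<xi>)) summable_on UNIV" and v: "v \<in> L2_torus"
  shows "fourier (\<lambda>p. u p * v p) k = conv (fourier u) (fourier v) k"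
proof -
  define S where "S p = (\<Sum>\<^sub>\<infinity>\<xi>. fourier u \<xi> * torus_char \<xi> p)" for p
  have vi: "integrable torus (\<lambda>p. of_real (v p) * torus_char (- k) p)"
    by (intro integrable_of_real_char L2_integrable v)
  note series = fourier_series_integral[OF u(2) vi, folded S_def]
  have "(\<integral>p. of_real (u p * v p) * torus_char (- k) p \<partial>torus) = (\<integral>p. S p * (of_real (v p) * torus_char (- k) p) \<partial>torus)"
  proof (rule integral_cong_AE)
    show "(\<lambda>p. of_real (u p * v p) * torus_char (- k) p) \<in> borel_measurable torus"
      using L2_mult_integrable[OF u(1) v]
      by (intro borel_measurable_integrable integrable_of_real_char)
    show "(\<lambda>p. S p * (of_real (v p) * torus_char (- k) p)) \<in> borel_measurable torus"
      using series(1) by (rule borel_measurable_integrable)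
    show "AE p in torus. of_real (u p * v p) * torus_char (- k) p = S p * (of_real (v p) * torus_char (- k) p)"
      using fourier_series_AE[OF u] by eventually_elim (simp add: S_def)
  qed
  also have "\<dots> = (\<Sum>\<^sub>\<infinity>\<xi>. fourier u \<xi> * (\<integral>p. of_real (v p) * torus_char (- k) p * torus_char \<xi> p \<partial>torus))"
    by (rule series(2))
  also have "\<dots> = (\<Sum>\<^sub>\<infinity>\<xi>. of_real ((2 * pi)\<^sup>2) * (fourier u \<xi> * fourier v (k - \<xi>)))"
  proof (rule infsum_cong)
    fix \<xi>
    have "(\<integral>p. of_real (v p) * torus_char (- k) p * torus_char \<xi> p \<partial>torus) = (\<integral>p. of_real (v p) * torus_char (- (k - \<xi>)) p \<partial>torus)"
      using torus_char_add[of "- k" \<xi>] by (simp add: mult.assoc)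
    also have "\<dots> = of_real ((2 * pi)\<^sup>2) * fourier v (k - \<xi>)"
      by (simp add: fourier_char)
    finally show "fourier u \<xi> * (\<integral>p. of_real (v p) * torus_char (- k) p * torus_char \<xi> p \<partial>torus) =
        of_real ((2 * pi)\<^sup>2) * (fourier u \<xi> * fourier v (k - \<xi>))"
      by simp
  qed
  also have "\<dots> = of_real ((2 * pi)\<^sup>2) * conv (fourier u) (fourier v) k"
    unfolding conv_def by (rule infsum_cmult_right')
  finally show ?thesis by (simp add: fourier_char)
qed

text \<open>The reflection of \<open>x\<close>, shifted by a period so that it maps the cell onto
  itself; on periodic functions the shift is invisible.\<close>

definition flip :: "real \<times> real \<Rightarrow> real \<times> real" where
  "flip p = (2 * pi - fst p, snd p)"

lemma flip_borel [measurable]: "flip \<in> borel \<rightarrow>\<^sub>M borel"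
  unfolding flip_def by (intro borel_measurable_continuous_onI continuous_intros)

lemma distr_flip: "distr lborel borel flip = lborel"
proof (rule lborel_eqI[symmetric])
  fix l u :: "real \<times> real" assume le: "\<And>b. b \<in> Basis \<Longrightarrow> l \<bullet> b \<le> u \<bullet> b"
  obtain l1 l2 u1 u2 where lu: "l = (l1, l2)" "u = (u1, u2)" by (cases l; cases u)
  have le': "l1 \<le> u1" "l2 \<le> u2" using le[of "(1, 0)"] le[of "(0, 1)"] by (auto simp: lu Basis_prod_def)
  have "emeasure (distr lborel borel flip) (box l u) = emeasure lborel (flip -` box l u)"
    by (subst emeasure_distr) auto
  also have "flip -` box l u = box (2 * pi - u1, l2) (2 * pi - l1, u2)"
    by (auto simp: box_def Basis_prod_def lu flip_def)
  also have "emeasure lborel (box (2 * pi - u1, l2) (2 * pi - l1, u2)) = (\<Prod>b\<in>Basis. (u - l) \<bullet> b)"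
    using le' by (subst emeasure_lborel_box) (auto simp: Basis_prod_def lu)
  finally show "emeasure (distr lborel borel flip) (box l u) = (\<Prod>b\<in>Basis. (u - l) \<bullet> b)" .
qed simp

lemma integral_torus_flip:
  fixes f :: "real \<times> real \<Rightarrow> complex"
  assumes "f \<in> borel_measurable torus"
  shows "(\<integral>p. f (flip p) \<partial>torus) = (\<integral>p. f p \<partial>torus)"
proof -
  define F where "F p = indicator cell p *\<^sub>R f p" for p
  have F: "F \<in> borel_measurable borel"
    using assms unfolding F_def torus_def by (subst (asm) borel_measurable_restrict_space_iff) auto
  have cell: "indicator cell (flip p) = (indicator cell p :: real)" for p
    by (cases p) (auto simp: flip_def indicator_def)
  have "(\<integral>p. f p \<partial>torus) = (\<integral>p. F p \<partial>lborel)"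
    unfolding torus_def F_def by (simp add: integral_restrict_space)
  also have "\<dots> = (\<integral>p. F p \<partial>distr lborel borel flip)" by (simp add: distr_flip)
  also have "\<dots> = (\<integral>p. F (flip p) \<partial>lborel)"
    by (rule integral_distr) (use F in auto)
  also have "\<dots> = (\<integral>p. f (flip p) \<partial>torus)"
    unfolding torus_def F_def cell by (simp add: integral_restrict_space)
  finally show ?thesis by simp
qed

lemma fourier_mirror_odd:
  assumes u: "u \<in> L2_torus" and odd: "\<And>x y. - u (- x, y) = u (x, y)"
  shows "fourier u (mirror k) = - fourier u k"
proof -
  have flip_u: "u (flip p) = - u p" for p
  proof -
    obtain x y where p: "p = (x, y)" by (cases p)
    have "u (2 * pi - x, y) = u (- x, y)"
      using u unfolding L2_torus_def periodic_def by (auto dest: spec[of _ "- x"] simp: add.commute)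
    then show ?thesis using odd[of x y] by (simp add: p flip_def)
  qed
  have flip_char: "torus_char (- mirror k) (flip p) = torus_char (- k) p" for p
  proof -
    have "torus_char (- mirror k) (flip p) = cis (2 * pi * real_of_int (fst k)) * torus_char (- k) p"
      by (simp add: torus_char_def mirror_def flip_def cis_mult algebra_simps)
    then show ?thesis using cis_multiple_2pi[of "real_of_int (fst k)"] by simp
  qed
  have m: "(\<lambda>p. of_real (u p) * torus_char (- mirror k) p) \<in> borel_measurable torus"
    by (intro borel_measurable_integrable integrable_of_real_char L2_integrable u)
  have "(\<integral>p. of_real (u p) * torus_char (- mirror k) p \<partial>torus) = (\<integral>p. - (of_real (u p) * torus_char (- k) p) \<partial>torus)"
    using integral_torus_flip[OF m] by (simp add: flip_u flip_char)
  then show ?thesis by (simp add: fourier_char)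
qed

section \<open>From the equation to the Fourier system\<close>

text \<open>The identity \<open>u u_x = (u^2)_x / 2\<close> on coefficients: the frequency
  \<open>fst k\<close> splits over the two factors, and by commutativity both halves are
  equal.\<close>

lemma conv_derivative:
  assumes "h2 f"
  shows "conv f (\<lambda>k. sym_dx k * f k) k = \<i> / 2 * (of_int (fst k) * conv f f k)"
proof -
  define d where "d k = of_int (fst k) * f k" for k
  have l2: "(\<lambda>k. (cmod (f k))\<^sup>2) summable_on UNIV" using assms by (rule h2_l2(1))
  have d: "(\<lambda>k. (cmod (d k))\<^sup>2) summable_on UNIV"
    unfolding d_def using assms by (rule h2_fst(1))
  have "of_int (fst k) * conv f f k = (\<Sum>\<^sub>\<infinity>j. d j * f (k - j) + f j * d (k - j))"
    unfolding conv_def infsum_cmult_right'[symmetric] by (intro infsum_cong) (simp add: d_def algebra_simps)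
  also have "\<dots> = conv d f k + conv f d k"
    unfolding conv_def by (rule infsum_add[OF conv_bound(1)[OF d l2] conv_bound(1)[OF l2 d]])
  also have "\<dots> = 2 * conv f d k" by (simp add: conv_commute[of d f])
  finally have *: "of_int (fst k) * conv f f k = 2 * conv f d k" .
  have "conv f (\<lambda>k. sym_dx k * f k) k = (\<Sum>\<^sub>\<infinity>j. \<i> * (f j * d (k - j)))"
    unfolding conv_def by (intro infsum_cong) (simp add: sym_dx_def d_def)
  also have "\<dots> = \<i> * conv f d k" unfolding conv_def by (rule infsum_cmult_right')
  finally show ?thesis by (simp add: *)
qed

lemma equation_fourier:
  assumes u: "u \<in> sobolev 2" and g: "g \<in> L2_torus"
    and dx: "has_symbol sym_dx u ux" and dxx: "has_symbol (\<lambda>\<xi>. (sym_dx \<xi>)\<^sup>2) u uxx"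
    and dyy: "has_symbol (\<lambda>\<xi>. (sym_dy \<xi>)\<^sup>2) u uyy"
    and L3: "has_symbol (\<lambda>\<xi>. (sym_Lambda \<xi>) ^ 3) u u3"
    and D2: "has_symbol (\<lambda>\<xi>. (sym_Laplace \<xi>)\<^sup>2) u u4"
    and eq: "AE p in torus. g p + u p * ux p + (\<beta> - 1) * uxx p - uyy p - \<delta> * u3 p + \<epsilon> * u4 p = 0"
  shows "fourier g k = flow_rhs \<epsilon> \<delta> \<beta> (fourier u) k"
proof -
  have uL: "u \<in> L2_torus" and uh: "h2 (fourier u)" using u by (auto simp: sobolev_2_iff)
  have L: "ux \<in> L2_torus" "uxx \<in> L2_torus" "uyy \<in> L2_torus" "u3 \<in> L2_torus" "u4 \<in> L2_torus"
    using dx dxx dyy L3 D2 by (auto simp: has_symbol_def)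
  have F: "fourier ux = (\<lambda>\<xi>. sym_dx \<xi> * fourier u \<xi>)" "fourier uxx k = (sym_dx k)\<^sup>2 * fourier u k"
    "fourier uyy k = (sym_dy k)\<^sup>2 * fourier u k" "fourier u3 k = (sym_Lambda k) ^ 3 * fourier u k"
    "fourier u4 k = (sym_Laplace k)\<^sup>2 * fourier u k"
    using dx dxx dyy L3 D2 by (simp_all add: has_symbol_def fun_eq_iff del: split_paired_All)
  note I = L2_integrable[OF L(2)] L2_integrable[OF L(3)] L2_integrable[OF L(4)] L2_integrable[OF L(5)]
    L2_mult_integrable[OF uL L(1)]
  \<comment> \<open>The equation solved for \<open>g\<close>, arranged as a nested sum of constant
    multiples, the shape that \<open>fourier_add\<close> and \<open>fourier_cmult\<close> take
    apart.\<close>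
  define r where "r p = - 1 * (u p * ux p) + ((1 - \<beta>) * uxx p + (uyy p + (\<delta> * u3 p + - \<epsilon> * u4 p)))" for p
  have ri: "integrable torus r" unfolding r_def using I by auto
  have "fourier g k = fourier r k"
  proof (rule fourier_cong_AE)
    show "AE p in torus. g p = r p" using eq by eventually_elim (simp add: r_def algebra_simps)
  qed (use g ri in \<open>auto simp: L2_measurable\<close>)
  also have "\<dots> = of_real (- 1) * fourier (\<lambda>p. u p * ux p) k + (of_real (1 - \<beta>) * fourier uxx k + (fourier uyy k
      + (of_real \<delta> * fourier u3 k + of_real (- \<epsilon>) * fourier u4 k)))"
    unfolding r_def
    by (subst fourier_add, use I in force, use I in force)+ (simp only: fourier_cmult)
  also have "fourier (\<lambda>p. u p * ux p) k = \<i> / 2 * (of_int (fst k) * conv (fourier u) (fourier u) k)"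
    using fourier_mult[OF uL h2_l1(1)[OF uh] L(1), of k] conv_derivative[OF uh, of k] by (simp add: F(1))
  also have "of_real (- 1) * (\<i> / 2 * (of_int (fst k) * conv (fourier u) (fourier u) k)) + (of_real (1 - \<beta>) * fourier uxx k + (fourier uyy k
      + (of_real \<delta> * fourier u3 k + of_real (- \<epsilon>) * fourier u4 k))) = flow_rhs \<epsilon> \<delta> \<beta> (fourier u) k"
  proof -
    have "(sym_Laplace k)\<^sup>2 = of_real (freq_norm k ^ 4)"
    proof -
      have "sym_Laplace k = - of_real ((freq_norm k)\<^sup>2)"
        by (simp add: sym_Laplace_def sym_dx_def sym_dy_def freq_norm_def power_mult_distrib)
      then show ?thesis by simp
    qed
    then show ?thesis
      unfolding F flow_rhs_def nonlin_def linear_symbol_def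
      by (simp add: sym_dx_def sym_dy_def sym_Lambda_def power_mult_distrib algebra_simps)
  qed
  finally show ?thesis .
qed

text \<open>\<open>weak_time_deriv\<close> pairs with real L^2 functions only, so a complex
  coefficient is assembled from its pairings with a cosine and a sine.\<close>

lemma fourier_L2_inner:
  assumes "u \<in> L2_torus"
  shows "(\<lambda>p. Re (torus_char \<xi> p)) \<in> L2_torus" "(\<lambda>p. Im (torus_char \<xi> p)) \<in> L2_torus"
    and "fourier u \<xi> = (of_real (L2_inner u (\<lambda>p. Re (torus_char \<xi> p))) - \<i> * of_real (L2_inner u (\<lambda>p. Im (torus_char \<xi> p)))) / of_real ((2 * pi)\<^sup>2)"
proof -
  have per: "torus_char \<xi> (x + 2 * pi, y) = torus_char \<xi> (x, y)" "torus_char \<xi> (x, y + 2 * pi) = torus_char \<xi> (x, y)" for x y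
  proof -
    have "torus_char \<xi> (x + 2 * pi, y) = cis (2 * pi * real_of_int (fst \<xi>)) * torus_char \<xi> (x, y)"
      by (simp add: torus_char_def cis_mult algebra_simps)
    then show "torus_char \<xi> (x + 2 * pi, y) = torus_char \<xi> (x, y)" using cis_multiple_2pi[of "real_of_int (fst \<xi>)"] by simp
    have "torus_char \<xi> (x, y + 2 * pi) = cis (2 * pi * real_of_int (snd \<xi>)) * torus_char \<xi> (x, y)"
      by (simp add: torus_char_def cis_mult algebra_simps)
    then show "torus_char \<xi> (x, y + 2 * pi) = torus_char \<xi> (x, y)" using cis_multiple_2pi[of "real_of_int (snd \<xi>)"] by simp
  qed
  show R: "(\<lambda>p. Re (torus_char \<xi> p)) \<in> L2_torus"
    by (rule bounded_in_L2_torus) (use per abs_Re_le_cmod[of "torus_char \<xi> p" for p] in \<open>auto simp: periodic_def\<close>)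
  show I: "(\<lambda>p. Im (torus_char \<xi> p)) \<in> L2_torus"
    by (rule bounded_in_L2_torus) (use per abs_Im_le_cmod[of "torus_char \<xi> p" for p] in \<open>auto simp: periodic_def\<close>)
  have "(\<integral>p. of_real (u p) * torus_char (- \<xi>) p \<partial>torus) =
      (\<integral>p. complex_of_real (u p * Re (torus_char \<xi> p)) - \<i> * complex_of_real (u p * Im (torus_char \<xi> p)) \<partial>torus)"
    by (rule Bochner_Integration.integral_cong) (auto simp: complex_eq_iff cnj_torus_char[symmetric])
  also have "\<dots> = of_real (L2_inner u (\<lambda>p. Re (torus_char \<xi> p))) - \<i> * of_real (L2_inner u (\<lambda>p. Im (torus_char \<xi> p)))"
    unfolding L2_inner_def
    using L2_mult_integrable[OF assms R] L2_mult_integrable[OF assms I]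
    by (subst Bochner_Integration.integral_diff) (auto simp: integral_complex_of_real simp del: of_real_mult)
  finally show "fourier u \<xi> = (of_real (L2_inner u (\<lambda>p. Re (torus_char \<xi> p))) - \<i> * of_real (L2_inner u (\<lambda>p. Im (torus_char \<xi> p)))) / of_real ((2 * pi)\<^sup>2)"
    by (simp add: fourier_char)
qed

text \<open>The derivative \<open>g\<close> is controlled only at almost every time. The time
  integral ignores null sets, so the coefficients of \<open>g\<close> may be replaced by a
  continuous function \<open>f\<close>; the mode is then a primitive of \<open>f\<close>, hence
  differentiable at every time.\<close>

lemma weak_deriv_fourier:
  fixes f :: "real \<Rightarrow> complex"
  assumes \<eta>: "\<And>t. 0 \<le> t \<Longrightarrow> \<eta> t \<in> L2_torus" and g: "weak_time_deriv \<eta> g"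
    and f: "continuous_on {0..} f" and gf: "AE s in lborel. s > 0 \<longrightarrow> fourier (g s) k = f s"
    and t: "0 \<le> t"
  shows "fourier (\<eta> t) k = fourier (\<eta> 0) k + integral {0..t} f"
proof -
  define P where "P s = L2_inner (g s) (\<lambda>p. Re (torus_char k p))" for s
  define Q where "Q s = L2_inner (g s) (\<lambda>p. Im (torus_char k p))" for s
  define G where "G s = (complex_of_real (P s) - \<i> * of_real (Q s)) / of_real ((2 * pi)\<^sup>2)" for s
  have gL: "AE s in lborel. s > 0 \<longrightarrow> g s \<in> L2_torus" using g by (simp add: weak_time_deriv_def)
  have \<eta>0: "\<eta> 0 \<in> L2_torus" by (rule \<eta>) simp
  note mem = fourier_L2_inner(1,2)[OF \<eta>0, of k]
  have PQ: "set_integrable lborel {0<..<t} P" "set_integrable lborel {0<..<t} Q"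
    "L2_inner (\<eta> t) (\<lambda>p. Re (torus_char k p)) - L2_inner (\<eta> 0) (\<lambda>p. Re (torus_char k p)) = (LINT s:{0<..<t}|lborel. P s)"
    "L2_inner (\<eta> t) (\<lambda>p. Im (torus_char k p)) - L2_inner (\<eta> 0) (\<lambda>p. Im (torus_char k p)) = (LINT s:{0<..<t}|lborel. Q s)"
    using g mem t unfolding weak_time_deriv_def P_def Q_def by blast+
  have c: "set_integrable lborel {0<..<t} (\<lambda>s. complex_of_real (P s))" "set_integrable lborel {0<..<t} (\<lambda>s. complex_of_real (Q s))"
    using PQ(1,2)[unfolded set_integrable_def, THEN integrable_of_real, where 'a = complex]
    by (simp_all add: set_integrable_def scaleR_conv_of_real)
  have ci: "set_integrable lborel {0<..<t} (\<lambda>s. \<i> * complex_of_real (Q s))"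
    using c(2) by (rule set_integrable_mult_right)
  have Gi: "set_integrable lborel {0<..<t} G"
    unfolding G_def by (intro set_integrable_divide set_integral_diff(1) c(1) ci)
  have "(LINT s:{0<..<t}|lborel. G s) = (of_real (LINT s:{0<..<t}|lborel. P s) - \<i> * of_real (LINT s:{0<..<t}|lborel. Q s)) / of_real ((2 * pi)\<^sup>2)"
    unfolding G_def using c ci by (simp add: set_integral_diff(2) set_integral_complex_of_real)
  then have Gint: "(LINT s:{0<..<t}|lborel. G s) = fourier (\<eta> t) k - fourier (\<eta> 0) k"
    unfolding PQ(3,4)[symmetric] fourier_L2_inner(3)[OF \<eta>[OF t]] fourier_L2_inner(3)[OF \<eta>0]
    by (simp add: algebra_simps diff_divide_distrib add_divide_distrib)
  have "continuous_on {0..t} f" by (rule continuous_on_subset[OF f]) auto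
  then have "set_integrable lborel {0..t} f" by (rule borel_integrable_atLeastAtMost')
  then have fi: "set_integrable lborel {0<..<t} f" by (rule set_integrable_subset) auto
  have "(LINT s:{0<..<t}|lborel. G s) = (LINT s:{0<..<t}|lborel. f s)"
    unfolding set_lebesgue_integral_def
  proof (rule integral_cong_AE)
    show "(\<lambda>s. indicator {0<..<t} s *\<^sub>R G s) \<in> borel_measurable lborel"
      "(\<lambda>s. indicator {0<..<t} s *\<^sub>R f s) \<in> borel_measurable lborel"
      using Gi fi by (simp_all add: set_integrable_def borel_measurable_integrable)
    show "AE s in lborel. indicator {0<..<t} s *\<^sub>R G s = indicator {0<..<t} s *\<^sub>R f s"
      using gL gf
    proof eventually_elim
      case (elim s)
      then show ?case using fourier_L2_inner(3)[of "g s" k] by (auto simp: G_def P_def Q_def indicator_def)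
    qed
  qed
  also have "\<dots> = integral {0..t} f"
    using set_borel_integral_eq_integral(2)[OF fi] by (simp add: integral_open_interval_real)
  finally show ?thesis by (simp add: Gint algebra_simps)
qed

section \<open>Curves continuous into H^2\<close>

lemma at_within_halfline: "0 \<le> t \<Longrightarrow> at t within {0..t + 1} = at t within {0..}" for t :: real
  by (rule at_within_nhd[of _ "{..<t + 1}"]) auto

lemma cmod_sq_le_h2_sq:
  assumes "h2 f"
  shows "(cmod (f k))\<^sup>2 \<le> h2_sq f"
  using finite_sum_le_infsum[OF h2_l2(1)[OF assms], of "{k}"] h2_l2(2)[OF assms] by (simp add: l2_sq_def)

text \<open>Continuity in H^2 is separated from the equation: by itself it makes the right-hand side
  of every mode continuous in time, before any differentiability is known.\<close>

locale h2_curve =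
  fixes a :: "real \<Rightarrow> int \<times> int \<Rightarrow> complex"
  assumes h2: "\<And>t. 0 \<le> t \<Longrightarrow> h2 (a t)"
    and cont: "\<And>t. 0 \<le> t \<Longrightarrow> ((\<lambda>s. h2_sq (\<lambda>k. a s k - a t k)) \<longlongrightarrow> 0) (at t within {0..})"
begin

lemma h2_sq_le_diff:
  assumes "0 \<le> s" "0 \<le> t"
  shows "h2_sq (a s) \<le> 2 * h2_sq (\<lambda>k. a s k - a t k) + 2 * h2_sq (a t)"
  using h2_add(2)[OF h2_diff(1)[OF h2[OF assms(1)] h2[OF assms(2)]] h2[OF assms(2)]] by simp

lemma bounded:
  assumes "0 \<le> T"
  shows "\<exists>B. \<forall>t\<in>{0..T}. h2_sq (a t) \<le> B"
proof -
  \<comment> \<open>Compactness of the interval is used through bisection. The intersection with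
    \<open>{0..}\<close> is there because the small intervals around a point may extend to negative
    times, where nothing is known.\<close>
  define P where "P x y \<longleftrightarrow> (\<exists>B. \<forall>t\<in>{x..y} \<inter> {0..}. h2_sq (a t) \<le> B)" for x y
  have "P 0 T"
  proof (rule Bolzano[OF assms])
    fix x y z assume "P x y" "P y z" "x \<le> y" "y \<le> z"
    then obtain B C where "\<forall>t\<in>{x..y} \<inter> {0..}. h2_sq (a t) \<le> B" "\<forall>t\<in>{y..z} \<inter> {0..}. h2_sq (a t) \<le> C"
      by (auto simp: P_def)
    then have "\<forall>t\<in>{x..z} \<inter> {0..}. h2_sq (a t) \<le> max B C"
      by (metis IntD1 IntD2 IntI atLeastAtMost_iff le_cases max.coboundedI1 max.coboundedI2)
    then show "P x z" by (auto simp: P_def)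
  next
    fix x assume x: "0 \<le> x" "x \<le> T"
    have "\<forall>\<^sub>F s in at x within {0..}. h2_sq (\<lambda>k. a s k - a x k) < 1"
      using cont[OF x(1)] by (rule order_tendstoD) simp
    then obtain d where d: "0 < d" "\<And>s. s \<in> {0..} \<Longrightarrow> s \<noteq> x \<Longrightarrow> dist s x < d \<Longrightarrow> h2_sq (\<lambda>k. a s k - a x k) < 1"
      unfolding eventually_at by blast
    have "P y z" if yz: "y \<le> x \<and> x \<le> z \<and> z - y < d" for y z
      unfolding P_def
    proof (intro exI ballI)
      fix s assume s: "s \<in> {y..z} \<inter> {0..}"
      show "h2_sq (a s) \<le> 2 + 2 * h2_sq (a x)"
      proof (cases "s = x")
        case True
        then show ?thesis using h2_sq_nonneg[of "a x"] by simp
      next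
        case False
        then have "h2_sq (\<lambda>k. a s k - a x k) < 1"
          using s yz by (intro d(2)) (auto simp: dist_real_def)
        then show ?thesis using h2_sq_le_diff[of s x] s x by auto
      qed
    qed
    then show "\<exists>d>0. \<forall>y z. y \<le> x \<and> x \<le> z \<and> z - y < d \<longrightarrow> P y z" using d(1) by blast
  qed
  then show ?thesis by (force simp: P_def)
qed

lemma continuous_mode: "continuous_on {0..} (\<lambda>s. a s k)"
  unfolding continuous_on_def
proof
  fix t :: real assume "t \<in> {0..}"
  then have t: "0 \<le> t" by simp
  have "((\<lambda>s. a s k - a t k) \<longlongrightarrow> 0) (at t within {0..})"
  proof (rule Lim_null_comparison)
    show "((\<lambda>s. sqrt (h2_sq (\<lambda>k. a s k - a t k))) \<longlongrightarrow> 0) (at t within {0..})"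
      using tendsto_real_sqrt[OF cont[OF t]] by simp
    show "\<forall>\<^sub>F s in at t within {0..}. norm (a s k - a t k) \<le> sqrt (h2_sq (\<lambda>k. a s k - a t k))"
      unfolding eventually_at_filter
    proof (rule always_eventually, intro allI impI)
      fix s :: real assume "s \<in> {0..}"
      then show "norm (a s k - a t k) \<le> sqrt (h2_sq (\<lambda>k. a s k - a t k))"
        using cmod_sq_le_h2_sq[OF h2_diff(1)[OF h2 h2[OF t]], of s k] by (intro real_le_rsqrt) auto
    qed
  qed
  then show "((\<lambda>s. a s k) \<longlongrightarrow> a t k) (at t within {0..})" by (simp add: LIM_zero_iff)
qed

lemma continuous_conv: "continuous_on {0..} (\<lambda>s. conv (a s) (a s) k)"
  unfolding continuous_on_def
proof
  fix t :: real assume "t \<in> {0..}"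
  then have t: "0 \<le> t" by simp
  obtain B where B: "\<forall>s\<in>{0..t + 1}. h2_sq (a s) \<le> B" using bounded[of "t + 1"] t by auto
  have "((\<lambda>s. conv (a s) (a s) k - conv (a t) (a t) k) \<longlongrightarrow> 0) (at t within {0..t + 1})"
  proof (rule Lim_null_comparison)
    have "((\<lambda>s. sqrt (h2_sq (\<lambda>k. a s k - a t k)) * sqrt (4 * B)) \<longlongrightarrow> sqrt 0 * sqrt (4 * B)) (at t within {0..t + 1})"
      unfolding at_within_halfline[OF t] by (intro tendsto_mult tendsto_real_sqrt cont[OF t] tendsto_const)
    then show "((\<lambda>s. sqrt (h2_sq (\<lambda>k. a s k - a t k)) * sqrt (4 * B)) \<longlongrightarrow> 0) (at t within {0..t + 1})" by simp
    show "\<forall>\<^sub>F s in at t within {0..t + 1}. norm (conv (a s) (a s) k - conv (a t) (a t) k) \<le>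
        sqrt (h2_sq (\<lambda>k. a s k - a t k)) * sqrt (4 * B)"
      unfolding eventually_at_filter
    proof (rule always_eventually, intro allI impI)
      fix s assume s: "s \<in> {0..t + 1}"
      then have s0: "0 \<le> s" by simp
      note d = h2_diff(1)[OF h2[OF s0] h2[OF t]] and p = h2_add[OF h2[OF s0] h2[OF t]]
      have "conv (a s) (a s) k - conv (a t) (a t) k = conv (\<lambda>k. a s k - a t k) (\<lambda>k. a s k + a t k) k"
        by (rule conv_difference_of_squares[OF h2_l2(1)[OF h2[OF s0]] h2_l2(1)[OF h2[OF t]], symmetric])
      then have "norm (conv (a s) (a s) k - conv (a t) (a t) k) \<le>
          sqrt (l2_sq (\<lambda>k. a s k - a t k)) * sqrt (l2_sq (\<lambda>k. a s k + a t k))"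
        using conv_bound(2)[OF h2_l2(1)[OF d] h2_l2(1)[OF p(1)]] by simp
      also have "\<dots> \<le> sqrt (h2_sq (\<lambda>k. a s k - a t k)) * sqrt (4 * B)"
      proof (intro mult_mono real_sqrt_le_mono h2_l2(2)[OF d])
        have "h2_sq (a s) \<le> B" "h2_sq (a t) \<le> B" using B s t by auto
        then show "l2_sq (\<lambda>k. a s k + a t k) \<le> 4 * B" using h2_l2(2)[OF p(1)] p(2) by linarith
      qed (simp_all add: h2_sq_nonneg l2_sq_nonneg)
      finally show "norm (conv (a s) (a s) k - conv (a t) (a t) k) \<le> sqrt (h2_sq (\<lambda>k. a s k - a t k)) * sqrt (4 * B)" .
    qed
  qed
  then show "((\<lambda>s. conv (a s) (a s) k) \<longlongrightarrow> conv (a t) (a t) k) (at t within {0..})"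
    unfolding at_within_halfline[OF t] by (simp add: LIM_zero_iff)
qed

lemma continuous_flow_rhs: "continuous_on {0..} (\<lambda>s. flow_rhs \<epsilon> \<delta> \<beta> (a s) k)"
  unfolding flow_rhs_def nonlin_def
  by (intro continuous_intros continuous_mode continuous_conv)

end

lemma fourier_flow_of_solution:
  assumes eps: "0 < \<epsilon>" and \<eta>\<^sub>0: "\<eta>\<^sub>0 \<in> H2_odd" and sol: "global_solution \<epsilon> \<delta> \<beta> \<eta>\<^sub>0 \<eta>"
  shows "fourier_flow \<epsilon> \<delta> \<beta> (\<lambda>t. fourier (\<eta> t))"
proof -
  have C: "in_C_H2 T \<eta>" if "0 < T" for T
    using sol that by (simp add: global_solution_def)
  have sob: "\<eta> t \<in> sobolev 2" if "0 \<le> t" for t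
    using C[of "t + 1"] that by (auto simp: in_C_H2_def)
  have L2: "\<eta> t \<in> L2_torus" and hh: "h2 (fourier (\<eta> t))" if "0 \<le> t" for t
    using sob[OF that] by (auto simp: sobolev_2_iff)
  interpret h2_curve "\<lambda>t. fourier (\<eta> t)"
  proof
    fix t :: real assume t: "0 \<le> t"
    show "h2 (fourier (\<eta> t))" by (rule hh[OF t])
    have "((\<lambda>s. sobolev_norm 2 (\<lambda>p. \<eta> s p - \<eta> t p)) \<longlongrightarrow> 0) (at t within {0..t + 1})"
      using C[of "t + 1"] t by (auto simp: in_C_H2_def)
    then have "((\<lambda>s. (sobolev_norm 2 (\<lambda>p. \<eta> s p - \<eta> t p))\<^sup>2) \<longlongrightarrow> 0\<^sup>2) (at t within {0..})"
      unfolding at_within_halfline[OF t] by (rule tendsto_power)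
    moreover have "\<forall>\<^sub>F s in at t within {0..}. (sobolev_norm 2 (\<lambda>p. \<eta> s p - \<eta> t p))\<^sup>2 = h2_sq (\<lambda>k. fourier (\<eta> s) k - fourier (\<eta> t) k)"
      unfolding eventually_at_filter
    proof (rule always_eventually, intro allI impI)
      fix s :: real assume "s \<in> {0..}"
      then have "fourier (\<lambda>p. \<eta> s p - \<eta> t p) = (\<lambda>k. fourier (\<eta> s) k - fourier (\<eta> t) k)"
        using fourier_diff[OF L2_integrable[OF L2] L2_integrable[OF L2[OF t]], of s] by auto
      then show "(sobolev_norm 2 (\<lambda>p. \<eta> s p - \<eta> t p))\<^sup>2 = h2_sq (\<lambda>k. fourier (\<eta> s) k - fourier (\<eta> t) k)"
        by (simp add: sobolev_norm_2 h2_sq_nonneg)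
    qed
    ultimately show "((\<lambda>s. h2_sq (\<lambda>k. fourier (\<eta> s) k - fourier (\<eta> t) k)) \<longlongrightarrow> 0) (at t within {0..})"
      by (simp add: tendsto_cong)
  qed
  obtain g where g: "weak_time_deriv \<eta> g" and eqn: "AE t in lborel. t > 0 \<longrightarrow>
      (\<exists>ux uxx uyy u3 u4. has_symbol sym_dx (\<eta> t) ux \<and> has_symbol (\<lambda>\<xi>. (sym_dx \<xi>)\<^sup>2) (\<eta> t) uxx \<and>
        has_symbol (\<lambda>\<xi>. (sym_dy \<xi>)\<^sup>2) (\<eta> t) uyy \<and> has_symbol (\<lambda>\<xi>. (sym_Lambda \<xi>) ^ 3) (\<eta> t) u3 \<and>
        has_symbol (\<lambda>\<xi>. (sym_Laplace \<xi>)\<^sup>2) (\<eta> t) u4 \<and>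
        (AE p in torus. g t p + \<eta> t p * ux p + (\<beta> - 1) * uxx p - uyy p - \<delta> * u3 p + \<epsilon> * u4 p = 0))"
    using sol unfolding global_solution_def solves_equation_def by blast
  have gL: "AE s in lborel. s > 0 \<longrightarrow> g s \<in> L2_torus" using g by (simp add: weak_time_deriv_def)
  have g_rhs: "AE s in lborel. s > 0 \<longrightarrow> fourier (g s) k = flow_rhs \<epsilon> \<delta> \<beta> (fourier (\<eta> s)) k" for k
    using gL eqn
  proof eventually_elim
    case (elim s)
    show ?case
    proof
      assume s: "0 < s"
      with elim(2) obtain ux uxx uyy u3 u4 where
        "has_symbol sym_dx (\<eta> s) ux" "has_symbol (\<lambda>\<xi>. (sym_dx \<xi>)\<^sup>2) (\<eta> s) uxx"
        "has_symbol (\<lambda>\<xi>. (sym_dy \<xi>)\<^sup>2) (\<eta> s) uyy" "has_symbol (\<lambda>\<xi>. (sym_Lambda \<xi>) ^ 3) (\<eta> s) u3"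
        "has_symbol (\<lambda>\<xi>. (sym_Laplace \<xi>)\<^sup>2) (\<eta> s) u4"
        "AE p in torus. g s p + \<eta> s p * ux p + (\<beta> - 1) * uxx p - uyy p - \<delta> * u3 p + \<epsilon> * u4 p = 0"
        by blast
      with elim(1) s sob[of s] show "fourier (g s) k = flow_rhs \<epsilon> \<delta> \<beta> (fourier (\<eta> s)) k"
        by (intro equation_fourier) auto
    qed
  qed
  show ?thesis
  proof
    show "0 < \<epsilon>" by (rule eps)
    show "h2 (fourier (\<eta> t))" if "0 \<le> t" for t using that by (rule hh)
    show "\<exists>B. \<forall>t\<in>{0..T}. h2_sq (fourier (\<eta> t)) \<le> B" if "0 \<le> T" for T using that by (rule bounded)
    show "fourier (\<eta> t) (- k) = cnj (fourier (\<eta> t) k)" for t k by (rule fourier_uminus_index)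
    show "((\<lambda>s. fourier (\<eta> s) k) has_vector_derivative flow_rhs \<epsilon> \<delta> \<beta> (fourier (\<eta> t)) k) (at t within {0..})"
      if t: "0 \<le> t" for t k
    proof -
      define f where "f s = flow_rhs \<epsilon> \<delta> \<beta> (fourier (\<eta> s)) k" for s
      have f: "continuous_on {0..} f" unfolding f_def by (rule continuous_flow_rhs)
      have rep: "fourier (\<eta> s) k = fourier (\<eta> 0) k + integral {0..s} f" if "0 \<le> s" for s
        by (rule weak_deriv_fourier[OF L2 g f g_rhs[of k, folded f_def] that])
      have "((\<lambda>s. integral {0..s} f) has_vector_derivative f t) (at t within {0..t + 1})"
        using t by (intro integral_has_vector_derivative continuous_on_subset[OF f]) auto
      then have "((\<lambda>s. fourier (\<eta> 0) k + integral {0..s} f) has_vector_derivative 0 + f t) (at t within {0..t + 1})"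
        by (intro has_vector_derivative_add has_vector_derivative_const)
      then have der: "((\<lambda>s. fourier (\<eta> 0) k + integral {0..s} f) has_vector_derivative f t) (at t within {0..t + 1})"
        by simp
      have "((\<lambda>s. fourier (\<eta> s) k) has_vector_derivative f t) (at t within {0..t + 1})"
      proof (rule has_vector_derivative_transform[OF _ _ der])
        show "t \<in> {0..t + 1}" using t by simp
        show "fourier (\<eta> s) k = fourier (\<eta> 0) k + integral {0..s} f" if "s \<in> {0..t + 1}" for s
          using that by (intro rep) simp
      qed
      then show ?thesis unfolding f_def at_within_halfline[OF t] .
    qed
    show "fourier (\<eta> 0) (mirror k) = - fourier (\<eta> 0) k" for k
    proof -
      have \<eta>\<^sub>0L: "\<eta>\<^sub>0 \<in> L2_torus" and odd: "- \<eta>\<^sub>0 (- x, y) = \<eta>\<^sub>0 (x, y)" for x y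
        using \<eta>\<^sub>0 by (auto simp: H2_odd_def sobolev_def)
      \<comment> \<open>The initial value is prescribed only almost everywhere, so oddness is
        transferred through the coefficients, which do not see null sets.\<close>
      have "fourier (\<eta> 0) j = fourier \<eta>\<^sub>0 j" for j
        using sol by (intro fourier_cong_AE L2_measurable L2 \<eta>\<^sub>0L) (auto simp: global_solution_def)
      then show ?thesis using fourier_mirror_odd[OF \<eta>\<^sub>0L odd] by simp
    qed
  qed
qed

theorem theorem3:
  fixes \<epsilon> \<delta> \<beta> :: real
  assumes "\<beta> > 0"
    and "\<exists>\<gamma> lam L. 0 \<le> \<gamma> \<and> \<gamma> \<le> 2 \<and> L > 0 \<and> lam = 2 * pi / L \<and> \<delta> = \<gamma> * lam \<and> \<epsilon> = lam\<^sup>2"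
  shows "\<exists>R::real. \<forall>\<eta>\<^sub>0\<in>H2_odd. \<forall>\<eta>. global_solution \<epsilon> \<delta> \<beta> \<eta>\<^sub>0 \<eta> \<longrightarrow>
           Limsup at_top (\<lambda>t. ereal (sobolev_norm 2 (\<eta> t))) \<le> ereal R"
proof -
  have eps: "0 < \<epsilon>" using assms(2) by auto
  \<comment> \<open>\<open>R\<close> is fixed before the initial value and the solution are
    introduced; this is the uniformity claimed.\<close>
  obtain R where R: "\<And>a. fourier_flow \<epsilon> \<delta> \<beta> a \<Longrightarrow> \<exists>T. \<forall>t\<ge>T. h2_sq (a t) \<le> R"
    using absorbing_h2[OF eps] by blast
  have "Limsup at_top (\<lambda>t. ereal (sobolev_norm 2 (\<eta> t))) \<le> ereal (sqrt R)"
    if \<eta>: "\<eta>\<^sub>0 \<in> H2_odd" "global_solution \<epsilon> \<delta> \<beta> \<eta>\<^sub>0 \<eta>" for \<eta>\<^sub>0 \<eta>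
  proof (rule Limsup_bounded)
    obtain T where T: "\<And>t. T \<le> t \<Longrightarrow> h2_sq (fourier (\<eta> t)) \<le> R"
      using R[OF fourier_flow_of_solution[OF eps \<eta>]] by blast
    show "\<forall>\<^sub>F t in at_top. ereal (sobolev_norm 2 (\<eta> t)) \<le> ereal (sqrt R)"
      using eventually_ge_at_top[of T] by eventually_elim (simp add: sobolev_norm_2 T)
  qed
  then show ?thesis by blast
qed

end
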